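(* Let $N\in\mathbb{N}$, $G_i,H_i\in\mathbb{R}^{n\times n}$ for $i=1,\dots,N$, and $\bar T>0$. Consider the linear stochastic switched system $$dy(t)=G_{\sigma(t)}y(t)dt+H_{\sigma(t)}y(t)dW_1(t),\qquad y(0)=y_0\in\mathbb{R}^n,$$ with piecewise constant switching signal $\sigma:\mathbb{R}_{\ge0}\to\{1,\dots,N\}$. Assume that there exist a block-diagonal matrix-valued function $R=\mathrm{diag}_{i=1}^N(R_i)$, $R_i:[0,\bar T]\to\mathbb{S}^n$, with $R(\bar T)\succ0$, and a scalar $\varepsilon>0$ such that $$G_i^TR_i(\bar T)+R_i(\bar T)G_i+H_i^TR_i(\bar T)H_i\prec0,$$ $$\dot R_i(\tau)+G_i^TR_i(\tau)+R_i(\tau)G_i+H_i^TR_i(\tau)H_i\preceq0$$ and $$R_i(0)-R_j(\bar T)+\varepsilon I\preceq0$$ hold for all $\tau\in[0,\bar T]$ and for all $i,j=1,\dots,N$, $i\neq j$. Then the switched system is mean-square asymptotically stable under minimum dwell-time $\bar T$.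
   Context: $\mathbb{S}^n$ is the set of real symmetric $n\times n$ matrices; $\prec,\preceq,\succ$ refer to the (semi)definite order. $W_1$ is a standard scalar Wiener process and the equation is in the Itô sense; $y$ has continuous paths across switching instants. The switching signal is deterministic. Mean-square asymptotic stability under minimum dwell-time $\bar T$ means: for every switching signal $\sigma$ whose switching instants $t_1<t_2<\dots$, together with $t_0=0$, satisfy $t_{k+1}-t_k\ge\bar T$ for all $k\ge0$, and for every $y_0$, one has $\mathbb{E}[\|y(t)\|_2^2]\to0$ as $t\to\infty$. The functions $R_i$ are differentiable (one-sided derivatives at endpoints), with $\dot R_i=dR_i/d\tau$. *)

theory Defs
  imports "HOL-Probability.Probability"
begin

section \<open>Semidefinite order and block-diagonal matrices\<close>

definition symmetric_matrix :: "real^'n^'n \<Rightarrow> bool"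
  where "symmetric_matrix A \<longleftrightarrow> transpose A = A"

definition loewner_le :: "real^'n^'n \<Rightarrow> real^'n^'n \<Rightarrow> bool"  (infix \<open>\<preceq>\<close> 50)
  where "A \<preceq> B \<longleftrightarrow> symmetric_matrix (B - A) \<and> (\<forall>x. 0 \<le> x \<bullet> ((B - A) *v x))"

definition loewner_less :: "real^'n^'n \<Rightarrow> real^'n^'n \<Rightarrow> bool"  (infix \<open>\<prec>\<close> 50)
  where "A \<prec> B \<longleftrightarrow> symmetric_matrix (B - A) \<and> (\<forall>x. x \<noteq> 0 \<longrightarrow> 0 < x \<bullet> ((B - A) *v x))"

definition block_diag :: "('k::finite \<Rightarrow> real^'n^'n) \<Rightarrow> real^('k \<times> 'n)^('k \<times> 'n)"
  where "block_diag B = (\<chi> p q. if fst p = fst q then B (fst p) $ snd p $ snd q else 0)"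


section \<open>Wiener process\<close>

text \<open>Time is the half-line \<open>t \<ge> 0\<close>; values at negative times are irrelevant. The filtration is
  arbitrary (not necessarily complete or right-continuous).\<close>

locale wiener_process = prob_space M + filtration "space M" F
  for M :: "'w measure" and F :: "real \<Rightarrow> 'w measure" +
  fixes W :: "real \<Rightarrow> 'w \<Rightarrow> real"
  assumes subalg: "\<And>t. sets (F t) \<subseteq> sets M"
    and adapted: "\<And>t. 0 \<le> t \<Longrightarrow> W t \<in> borel_measurable (F t)"
    and start: "AE \<omega> in M. W 0 \<omega> = 0"
    and paths: "AE \<omega> in M. continuous_on {0..} (\<lambda>t. W t \<omega>)"
    and increments: "\<And>s t. 0 \<le> s \<Longrightarrow> s < t \<Longrightarrow>
      distributed M lborel (\<lambda>\<omega>. W t \<omega> - W s \<omega>) (normal_density 0 (sqrt (t - s)))"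
    and indep_increments: "\<And>s t. 0 \<le> s \<Longrightarrow> s < t \<Longrightarrow>
      indep_set (sets (F s)) {(\<lambda>\<omega>. W t \<omega> - W s \<omega>) -` B \<inter> space M | B. B \<in> sets borel}"


section \<open>Ito integral\<close>

text \<open>The triple \<open>(m, p, \<xi>)\<close> stands for the simple process
  \<open>\<Sum>i<m. \<xi> i\<close> on \<open>{p i <.. p (i + 1)}\<close>.\<close>

definition simple_process ::
    "(real \<Rightarrow> 'w measure) \<Rightarrow> nat \<Rightarrow> (nat \<Rightarrow> real) \<Rightarrow> (nat \<Rightarrow> 'w \<Rightarrow> 'b::euclidean_space) \<Rightarrow> bool"
  where "simple_process F m p \<xi> \<longleftrightarrow>
    0 \<le> p 0 \<and> (\<forall>i<m. p i \<le> p (Suc i)) \<and>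
    (\<forall>i<m. \<xi> i \<in> borel_measurable (F (p i)) \<and> bounded (\<xi> i ` space (F (p i))))"

definition simple_value ::
    "nat \<Rightarrow> (nat \<Rightarrow> real) \<Rightarrow> (nat \<Rightarrow> 'w \<Rightarrow> 'b::euclidean_space) \<Rightarrow> real \<Rightarrow> 'w \<Rightarrow> 'b"
  where "simple_value m p \<xi> s \<omega> = (\<Sum>i<m. indicator {p i<..p (Suc i)} s *\<^sub>R \<xi> i \<omega>)"

definition simple_integral ::
    "(real \<Rightarrow> 'w \<Rightarrow> real) \<Rightarrow> nat \<Rightarrow> (nat \<Rightarrow> real) \<Rightarrow> (nat \<Rightarrow> 'w \<Rightarrow> 'b::euclidean_space) \<Rightarrow> real \<Rightarrow> 'w \<Rightarrow> 'b"
  where "simple_integral W m p \<xi> t \<omega> =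
    (\<Sum>i<m. (W (min t (p (Suc i))) \<omega> - W (min t (p i)) \<omega>) *\<^sub>R \<xi> i \<omega>)"

text \<open>Measurability is demanded explicitly because \<open>emeasure\<close> is 0 on non-measurable sets.\<close>

definition null_in_prob :: "'w measure \<Rightarrow> (nat \<Rightarrow> 'w \<Rightarrow> ennreal) \<Rightarrow> bool"
  where "null_in_prob M Z \<longleftrightarrow> (\<forall>k. Z k \<in> borel_measurable M) \<and>
    (\<forall>\<delta>>0. (\<lambda>k. emeasure M {\<omega> \<in> space M. ennreal \<delta> < Z k \<omega>}) \<longlonglongrightarrow> 0)"

definition progressive :: "(real \<Rightarrow> 'w measure) \<Rightarrow> (real \<Rightarrow> 'w \<Rightarrow> 'b::euclidean_space) \<Rightarrow> bool"
  where "progressive F X \<longleftrightarrow> (\<forall>t\<ge>0.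
    (\<lambda>(s, \<omega>). X s \<omega>) \<in> borel_measurable (restrict_space borel {0..t} \<Otimes>\<^sub>M F t))"

text \<open>\<open>J\<close> is (a version of) the Ito integral of \<open>X\<close> over \<open>{0..t}\<close>, for progressive integrands
  that are merely almost surely square integrable in time: simple processes approximate \<open>X\<close> in
  \<open>L\<^sup>2({0..t})\<close> in probability and their integrals converge to \<open>J\<close> in probability.\<close>

definition has_ito_integral ::
    "'w measure \<Rightarrow> (real \<Rightarrow> 'w measure) \<Rightarrow> (real \<Rightarrow> 'w \<Rightarrow> real) \<Rightarrow>
     (real \<Rightarrow> 'w \<Rightarrow> 'b::euclidean_space) \<Rightarrow> real \<Rightarrow> ('w \<Rightarrow> 'b) \<Rightarrow> bool"
  where "has_ito_integral M F W X t J \<longleftrightarrow>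
    progressive F X \<and>
    (AE \<omega> in M. (\<integral>\<^sup>+s\<in>{0..t}. ennreal ((norm (X s \<omega>))\<^sup>2) \<partial>lborel) < \<infinity>) \<and>
    J \<in> borel_measurable M \<and>
    (\<exists>m p \<xi>. (\<forall>k. simple_process F (m k) (p k) (\<xi> k)) \<and>
      null_in_prob M (\<lambda>k \<omega>. \<integral>\<^sup>+s\<in>{0..t}.
        ennreal ((norm (simple_value (m k) (p k) (\<xi> k) s \<omega> - X s \<omega>))\<^sup>2) \<partial>lborel) \<and>
      null_in_prob M (\<lambda>k \<omega>. ennreal (norm (simple_integral W (m k) (p k) (\<xi> k) t \<omega> - J \<omega>))))"


section \<open>Switched linear stochastic systems\<close>

text \<open>The modes are the elements of the finite type \<open>'k\<close>, so \<open>N = CARD('k)\<close>. No convention is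
  imposed on the value of a signal at a switching instant itself.\<close>

definition switching_instants :: "(real \<Rightarrow> 'k) \<Rightarrow> real set"
  where "switching_instants \<sigma> = {t. 0 < t \<and> \<not> (\<forall>\<^sub>F s in nhds t. \<sigma> s = \<sigma> t)}"

definition piecewise_constant :: "(real \<Rightarrow> 'k) \<Rightarrow> bool"
  where "piecewise_constant \<sigma> \<longleftrightarrow> (\<forall>b. finite (switching_instants \<sigma> \<inter> {..b}))"

definition min_dwell_time :: "real \<Rightarrow> (real \<Rightarrow> 'k) \<Rightarrow> bool"
  where "min_dwell_time T \<sigma> \<longleftrightarrow>
    (\<forall>s \<in> insert 0 (switching_instants \<sigma>). \<forall>t \<in> switching_instants \<sigma>. s < t \<longrightarrow> T \<le> t - s)"

definition switched_solution ::
    "'w measure \<Rightarrow> (real \<Rightarrow> 'w measure) \<Rightarrow> (real \<Rightarrow> 'w \<Rightarrow> real) \<Rightarrow>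
     ('k \<Rightarrow> real^'n^'n) \<Rightarrow> ('k \<Rightarrow> real^'n^'n) \<Rightarrow> (real \<Rightarrow> 'k) \<Rightarrow> real^'n \<Rightarrow>
     (real \<Rightarrow> 'w \<Rightarrow> real^'n) \<Rightarrow> bool"
  where "switched_solution M F W G H \<sigma> y0 y \<longleftrightarrow>
    (\<forall>t\<ge>0. y t \<in> borel_measurable (F t)) \<and>
    (\<forall>\<omega>\<in>space M. continuous_on {0..} (\<lambda>t. y t \<omega>)) \<and>
    (\<forall>t\<ge>0. \<exists>J. has_ito_integral M F W (\<lambda>s \<omega>. H (\<sigma> s) *v y s \<omega>) t J \<and>
      (AE \<omega> in M. y t \<omega> = y0 + (LINT s:{0..t}|lborel. G (\<sigma> s) *v y s \<omega>) + J \<omega>))"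

text \<open>The second moment is a nonnegative Lebesgue integral, so that a non-integrable
  \<open>(norm (y t))\<^sup>2\<close> has expectation \<open>\<infinity>\<close>, not 0.\<close>

definition mean_square_stable_min_dwell ::
    "'w measure \<Rightarrow> (real \<Rightarrow> 'w measure) \<Rightarrow> (real \<Rightarrow> 'w \<Rightarrow> real) \<Rightarrow>
     ('k::finite \<Rightarrow> real^'n^'n) \<Rightarrow> ('k \<Rightarrow> real^'n^'n) \<Rightarrow> real \<Rightarrow> bool"
  where "mean_square_stable_min_dwell M F W G H T \<longleftrightarrow>
    (\<forall>\<sigma> y0 y. piecewise_constant \<sigma> \<longrightarrow> min_dwell_time T \<sigma> \<longrightarrow>
      switched_solution M F W G H \<sigma> y0 y \<longrightarrow>
      ((\<lambda>t. \<integral>\<^sup>+\<omega>. ennreal ((norm (y t \<omega>))\<^sup>2) \<partial>M) \<longlongrightarrow> 0) at_top)"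

end

theory Submission
  imports Defs
begin

text \<open>With \<open>L\<^sub>i Q = G\<^sub>i\<^sup>T Q + Q G\<^sub>i + H\<^sub>i\<^sup>T Q H\<^sub>i\<close>, the second moments of a solution satisfy
  \<open>d/dt E[y \<bullet> Q y] = E[y \<bullet> L\<^sub>i Q y]\<close> while mode \<open>i\<close> is active. Hence \<open>E[y \<bullet> R\<^sub>i(\<tau>) y]\<close> does not increase
  during the first \<open>T\<close> time units after a switch, \<open>E[y \<bullet> R\<^sub>i(T) y]\<close> decays exponentially from then on, and
  at the next switch the jump condition provides a contraction factor below 1, which compensates for
  the dwell phase. So the second moment decays exponentially.

  The moment equation holds because the Ito integral, defined only by approximation in probability,
  agrees with an \<open>L\<^sup>2\<close> limit of elementary integrals: an elementary integral is small with high
  probability on the event that its integrand has small energy. Applied on the event that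
  the path stays below \<open>n\<close> up to time \<open>t\<close>, this replaces stopping times and yields, by a Gronwall
  argument, a finite second moment; after that no truncation is necessary. Expanding
  \<open>E[y \<bullet> Q y]\<close> over a short interval \<open>[s, t]\<close> leaves an error of order \<open>(t - s)\<^bsup>3/2\<^esup>\<close>, so that the
  derivative can be read off without an Ito formula.\<close>


section \<open>Square-integrable functions\<close>

text \<open>The Ito integral of a solution is given separately for each time \<open>t\<close>, by a
  variable \<open>J\<close> that is only a limit in probability. No common version with continuous
  paths is supplied, and the filtration need not be complete or right-continuous, so stopping the
  equation at an exit time is not directly available. Estimates are localised instead to events that
  are decided at time \<open>t\<close>. The price is that moments of \<open>J\<close> have to be
  recovered from probabilities: an elementary integrand is switched off when its energy is spent,
  and the limit is taken along an almost surely convergent subsequence with Fatou's lemma.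

  The exponent 3/2 in the expansion error is what the derivative needs, since the error still
  vanishes after division by \<open>t - s\<close>. It is reached because the term linear in the
  noise has mean zero.

  The decay argument measures the state by two quantities, the second moment and the moment of
  \<open>R i T\<close>, which are comparable at every time. The matrices \<open>R i \<tau>\<close>
  with \<open>\<tau> < T\<close> serve only to relate the two ends of a dwell phase.\<close>

definition square_integrable :: "'w measure \<Rightarrow> ('w \<Rightarrow> 'b::euclidean_space) \<Rightarrow> bool"
  where "square_integrable M f \<longleftrightarrow> f \<in> borel_measurable M \<and> integrable M (\<lambda>\<omega>. (norm (f \<omega>))\<^sup>2)"

lemma square_integrable_measurable: "square_integrable M f \<Longrightarrow> f \<in> borel_measurable M"
  by (simp add: square_integrable_def)

lemma square_integrable_norm: "square_integrable M f \<Longrightarrow> integrable M (\<lambda>\<omega>. (norm (f \<omega>))\<^sup>2)"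
  by (simp add: square_integrable_def)

lemma square_integrable_bound:
  assumes "square_integrable M f" "g \<in> borel_measurable M"
    "\<And>\<omega>. \<omega> \<in> space M \<Longrightarrow> norm (g \<omega>) \<le> c * norm (f \<omega>)"
  shows "square_integrable M g"
  unfolding square_integrable_def
proof
  have [measurable]: "g \<in> borel_measurable M" by fact
  have "norm ((norm (g \<omega>))\<^sup>2) \<le> norm (c\<^sup>2 * (norm (f \<omega>))\<^sup>2)" if "\<omega> \<in> space M" for \<omega>
    using power_mono[OF assms(3)[OF that] norm_ge_zero, of 2] by (simp add: power_mult_distrib)
  then have ae: "AE \<omega> in M. norm ((norm (g \<omega>))\<^sup>2) \<le> norm (c\<^sup>2 * (norm (f \<omega>))\<^sup>2)"
    by (rule AE_I2)
  have "integrable M (\<lambda>\<omega>. c\<^sup>2 * (norm (f \<omega>))\<^sup>2)"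
    using square_integrable_norm[OF assms(1)] by (rule integrable_mult_right)
  then show "integrable M (\<lambda>\<omega>. (norm (g \<omega>))\<^sup>2)"
    by (rule Bochner_Integration.integrable_bound[OF _ _ ae]) measurable
qed fact

lemma norm_add_square_le: "(norm (a + b :: 'b::real_inner))\<^sup>2 \<le> 2 * (norm a)\<^sup>2 + 2 * (norm b)\<^sup>2"
proof -
  have "0 \<le> (norm (a - b))\<^sup>2" by simp
  then show ?thesis by (simp add: power2_norm_eq_inner inner_simps inner_commute)
qed

lemma norm_diff_square_le: "(norm (a - b :: 'b::real_inner))\<^sup>2 \<le> 2 * (norm a)\<^sup>2 + 2 * (norm b)\<^sup>2"
  using norm_add_square_le[of a "- b"] by simp

lemma square_integrable_add:
  assumes "square_integrable M f" "square_integrable M g"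
  shows "square_integrable M (\<lambda>\<omega>. f \<omega> + g \<omega>)"
proof -
  note [measurable] = assms[THEN square_integrable_measurable]
  have "integrable M (\<lambda>\<omega>. 2 * (norm (f \<omega>))\<^sup>2 + 2 * (norm (g \<omega>))\<^sup>2)"
    using assms by (auto simp: square_integrable_def)
  then have "integrable M (\<lambda>\<omega>. (norm (f \<omega> + g \<omega>))\<^sup>2)"
    by (rule Bochner_Integration.integrable_bound) (auto intro!: norm_add_square_le AE_I2)
  then show ?thesis by (auto simp: square_integrable_def)
qed

lemma square_integrable_scaleR:
  "square_integrable M f \<Longrightarrow> square_integrable M (\<lambda>\<omega>. c *\<^sub>R f \<omega>)"
  by (rule square_integrable_bound[where c="\<bar>c\<bar>"]) (auto dest: square_integrable_measurable)

lemma square_integrable_minus: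
  "square_integrable M f \<Longrightarrow> square_integrable M (\<lambda>\<omega>. - f \<omega>)"
  using square_integrable_scaleR[of M f "-1"] by simp

lemma square_integrable_diff:
  "square_integrable M f \<Longrightarrow> square_integrable M g \<Longrightarrow> square_integrable M (\<lambda>\<omega>. f \<omega> - g \<omega>)"
  using square_integrable_add[OF _ square_integrable_minus, of M f g] by simp

lemma square_integrable_0: "square_integrable M (\<lambda>_. 0)"
  by (simp add: square_integrable_def)

lemma (in finite_measure) square_integrable_const: "square_integrable M (\<lambda>_. c)"
  by (simp add: square_integrable_def)

lemma abs_inner_le_squares: "\<bar>x \<bullet> y\<bar> \<le> (norm x)\<^sup>2 / 2 + (norm y)\<^sup>2 / 2"
proof -
  have "0 \<le> (norm x - norm y)\<^sup>2" by simp
  then show ?thesis using Cauchy_Schwarz_ineq2[of x y] by (simp add: power2_diff)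
qed

lemma square_integrable_inner:
  assumes "square_integrable M f" "square_integrable M g"
  shows "integrable M (\<lambda>\<omega>. f \<omega> \<bullet> g \<omega>)"
proof -
  note [measurable] = assms[THEN square_integrable_measurable]
  have "integrable M (\<lambda>\<omega>. (norm (f \<omega>))\<^sup>2 / 2 + (norm (g \<omega>))\<^sup>2 / 2)"
    using assms by (auto simp: square_integrable_def)
  then show ?thesis
    by (rule Bochner_Integration.integrable_bound) (auto intro!: AE_I2 abs_inner_le_squares)
qed

lemma square_integrable_nn:
  "square_integrable M f \<longleftrightarrow> f \<in> borel_measurable M \<and> (\<integral>\<^sup>+\<omega>. ennreal ((norm (f \<omega>))\<^sup>2) \<partial>M) < \<infinity>"
  by (auto simp: square_integrable_def integrable_iff_bounded)

lemma nn_integral_square_integrable: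
  "square_integrable M f \<Longrightarrow>
    (\<integral>\<^sup>+\<omega>. ennreal ((norm (f \<omega>))\<^sup>2) \<partial>M) = ennreal (\<integral>\<omega>. (norm (f \<omega>))\<^sup>2 \<partial>M)"
  by (simp add: square_integrable_def nn_integral_eq_integral)

section \<open>Increments of the Wiener process\<close>

context wiener_process
begin

lemma space_Ft [simp]: "space (F t) = space M"
  by (rule space_F)

lemma F_measurable: "f \<in> borel_measurable (F t) \<Longrightarrow> f \<in> borel_measurable M"
  by (rule measurable_from_subalg[of _ "F t"]) (auto simp: subalgebra_def subalg)

lemma F_measurable_mono: "s \<le> t \<Longrightarrow> f \<in> borel_measurable (F s) \<Longrightarrow> f \<in> borel_measurable (F t)"
  by (rule measurable_from_subalg[of _ "F s"]) (use sets_F_mono in \<open>auto simp: subalgebra_def\<close>)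

lemma W_measurable: "0 \<le> t \<Longrightarrow> W t \<in> borel_measurable M"
  by (rule F_measurable[OF adapted])

lemma increment_moments:
  assumes "0 \<le> s" "s \<le> t"
  shows "integrable M (\<lambda>\<omega>. W t \<omega> - W s \<omega>)" "expectation (\<lambda>\<omega>. W t \<omega> - W s \<omega>) = 0"
    "integrable M (\<lambda>\<omega>. (W t \<omega> - W s \<omega>)\<^sup>2)" "expectation (\<lambda>\<omega>. (W t \<omega> - W s \<omega>)\<^sup>2) = t - s"
proof -
  have "integrable M (\<lambda>\<omega>. W t \<omega> - W s \<omega>) \<and> expectation (\<lambda>\<omega>. W t \<omega> - W s \<omega>) = 0 \<and>
    integrable M (\<lambda>\<omega>. (W t \<omega> - W s \<omega>)\<^sup>2) \<and> expectation (\<lambda>\<omega>. (W t \<omega> - W s \<omega>)\<^sup>2) = t - s"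
  proof (cases "s = t")
    case False
    then have st: "s < t" using assms by simp
    note D = increments[OF assms(1) st]
    have \<sigma>: "0 < sqrt (t - s)" using st by simp
    have 1: "integrable M (\<lambda>\<omega>. W t \<omega> - W s \<omega>)"
      using distributed_integrable[OF D, of "\<lambda>x. x"] integrable_normal_moment_nz_1[OF \<sigma>, of 0] by simp
    have 2: "expectation (\<lambda>\<omega>. W t \<omega> - W s \<omega>) = 0"
      by (rule normal_distributed_expectation[OF \<sigma> D])
    have 3: "integrable M (\<lambda>\<omega>. (W t \<omega> - W s \<omega>)\<^sup>2)"
      using distributed_integrable[OF D, of "\<lambda>x. x\<^sup>2"] integrable_normal_moment[OF \<sigma>, of 0 2] by simp
    have 4: "expectation (\<lambda>\<omega>. (W t \<omega> - W s \<omega>)\<^sup>2) = t - s"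
      using normal_distributed_variance[OF \<sigma> D] 2 st by simp
    from 1 2 3 4 show ?thesis by simp
  qed simp
  then show "integrable M (\<lambda>\<omega>. W t \<omega> - W s \<omega>)" "expectation (\<lambda>\<omega>. W t \<omega> - W s \<omega>) = 0"
    "integrable M (\<lambda>\<omega>. (W t \<omega> - W s \<omega>)\<^sup>2)" "expectation (\<lambda>\<omega>. (W t \<omega> - W s \<omega>)\<^sup>2) = t - s"
    by auto
qed

lemma Int_stable_vimage: "Int_stable {U -` A \<inter> \<Omega> |A. A \<in> sets N}"
proof (rule Int_stableI, clarsimp)
  fix A B assume "A \<in> sets N" "B \<in> sets N"
  then show "\<exists>C. U -` A \<inter> \<Omega> \<inter> (U -` B \<inter> \<Omega>) = U -` C \<inter> \<Omega> \<and> C \<in> sets N"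
    by (intro exI[of _ "A \<inter> B"]) auto
qed

text \<open>\<open>indep_increments\<close> speaks about families of events,
  \<open>indep_var\<close> about the sigma-algebras generated by them; the passage works because
  preimage families are closed under intersection. The function \<open>g\<close> covers the
  increment and its square at once.\<close>

lemma indep_var_increment:
  assumes "0 \<le> s" "s < t" and U: "U \<in> borel_measurable (F s)" and g: "g \<in> borel_measurable borel"
  shows "indep_var borel U borel (\<lambda>\<omega>. g (W t \<omega> - W s \<omega>) :: real)"
proof -
  have [measurable]: "W t \<in> borel_measurable M" "W s \<in> borel_measurable M" "U \<in> borel_measurable M"
    using assms by (auto intro: W_measurable F_measurable)
  note [measurable] = g
  have "indep_set {U -` A \<inter> space M |A. A \<in> sets borel}
    {(\<lambda>\<omega>. g (W t \<omega> - W s \<omega>)) -` A \<inter> space M |A. A \<in> sets borel}" (is "indep_set ?X ?Y")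
  proof -
    have "?X \<subseteq> sets (F s)" using measurable_sets[OF U] by auto
    moreover have "?Y \<subseteq> {(\<lambda>\<omega>. W t \<omega> - W s \<omega>) -` B \<inter> space M | B. B \<in> sets borel}" (is "_ \<subseteq> ?B")
    proof
      fix C assume "C \<in> ?Y"
      then obtain A where A: "C = (\<lambda>\<omega>. g (W t \<omega> - W s \<omega>)) -` A \<inter> space M" "A \<in> sets borel" by auto
      have "g -` A \<in> sets borel" using measurable_sets[OF g A(2)] by simp
      then show "C \<in> ?B" using A by (intro CollectI exI[of _ "g -` A"]) auto
    qed
    ultimately show ?thesis
      using indep_increments[OF assms(1,2)] unfolding indep_sets2_eq by (meson subset_eq)
  qed
  then show ?thesis
    unfolding indep_var_eq by (intro conjI indep_set_sigma_sets Int_stable_vimage) auto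
qed

text \<open>\<open>U\<close> is known at time \<open>s\<close>, so the increment after
  \<open>s\<close> is independent of it and expectations factor. The degenerate case
  \<open>s = t\<close> is separate because the locale describes increments only for
  \<open>s < t\<close>.\<close>

lemma expectation_mult_increment:
  assumes "0 \<le> s" "s \<le> t" and U: "U \<in> borel_measurable (F s)" "integrable M U"
  shows "integrable M (\<lambda>\<omega>. U \<omega> * (W t \<omega> - W s \<omega>))"
    "expectation (\<lambda>\<omega>. U \<omega> * (W t \<omega> - W s \<omega>)) = 0"
    "integrable M (\<lambda>\<omega>. U \<omega> * (W t \<omega> - W s \<omega>)\<^sup>2)"
    "expectation (\<lambda>\<omega>. U \<omega> * (W t \<omega> - W s \<omega>)\<^sup>2) = expectation U * (t - s)"
proof -
  have "integrable M (\<lambda>\<omega>. U \<omega> * (W t \<omega> - W s \<omega>)) \<and> expectation (\<lambda>\<omega>. U \<omega> * (W t \<omega> - W s \<omega>)) = 0 \<and>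
    integrable M (\<lambda>\<omega>. U \<omega> * (W t \<omega> - W s \<omega>)\<^sup>2) \<and>
    expectation (\<lambda>\<omega>. U \<omega> * (W t \<omega> - W s \<omega>)\<^sup>2) = expectation U * (t - s)"
  proof (cases "s = t")
    case False
    then have st: "s < t" using assms by simp
    note m = increment_moments[OF assms(1,2)]
    note i1 = indep_var_increment[OF assms(1) st U(1), of "\<lambda>x. x"]
    note i2 = indep_var_increment[OF assms(1) st U(1), of "\<lambda>x. x\<^sup>2"]
    show ?thesis
      using indep_var_integrable[OF i1 U(2)] indep_var_integrable[OF i2 U(2)]
        indep_var_lebesgue_integral[OF i1 U(2)] indep_var_lebesgue_integral[OF i2 U(2)] m
      by simp
  qed simp
  then show "integrable M (\<lambda>\<omega>. U \<omega> * (W t \<omega> - W s \<omega>))"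
    "expectation (\<lambda>\<omega>. U \<omega> * (W t \<omega> - W s \<omega>)) = 0"
    "integrable M (\<lambda>\<omega>. U \<omega> * (W t \<omega> - W s \<omega>)\<^sup>2)"
    "expectation (\<lambda>\<omega>. U \<omega> * (W t \<omega> - W s \<omega>)\<^sup>2) = expectation U * (t - s)"
    by auto
qed

text \<open>Square integrability, in contrast to the boundedness in \<open>simple_process\<close>,
  survives multiplication by a Wiener increment, so integrals of such coefficients belong to the
  same class again.\<close>

definition adapted_sq :: "real \<Rightarrow> ('w \<Rightarrow> 'b::euclidean_space) \<Rightarrow> bool"
  where "adapted_sq s \<xi> \<longleftrightarrow> \<xi> \<in> borel_measurable (F s) \<and> square_integrable M \<xi>"

lemma adapted_sq_increment:
  assumes "0 \<le> s" "s \<le> t" "adapted_sq s \<xi>"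
  shows "adapted_sq t (\<lambda>\<omega>. (W t \<omega> - W s \<omega>) *\<^sub>R \<xi> \<omega>)"
proof -
  have \<xi>: "\<xi> \<in> borel_measurable (F s)" "integrable M (\<lambda>\<omega>. (norm (\<xi> \<omega>))\<^sup>2)"
    using assms by (auto simp: adapted_sq_def square_integrable_def)
  have [measurable]: "W t \<in> borel_measurable (F t)" "W s \<in> borel_measurable (F t)" "\<xi> \<in> borel_measurable (F t)"
    using assms \<xi> by (auto intro: adapted F_measurable_mono[of s t])
  have m: "(\<lambda>\<omega>. (W t \<omega> - W s \<omega>) *\<^sub>R \<xi> \<omega>) \<in> borel_measurable (F t)" by measurable
  have "(\<lambda>\<omega>. (norm (\<xi> \<omega>))\<^sup>2) \<in> borel_measurable (F s)" using \<xi> by measurable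
  from expectation_mult_increment(3)[OF assms(1,2) this \<xi>(2)] m F_measurable[OF m] show ?thesis
    by (auto simp: adapted_sq_def square_integrable_def power_mult_distrib mult.commute)
qed

lemma adapted_sq_mono: "s \<le> t \<Longrightarrow> adapted_sq s \<xi> \<Longrightarrow> adapted_sq t \<xi>"
  by (auto simp: adapted_sq_def intro: F_measurable_mono)

lemma expectation_inner_increment:
  assumes "0 \<le> s" "s \<le> t" "adapted_sq s \<xi>" "adapted_sq s \<eta>"
  shows "expectation (\<lambda>\<omega>. \<xi> \<omega> \<bullet> ((W t \<omega> - W s \<omega>) *\<^sub>R \<eta> \<omega>)) = 0"
proof -
  have "\<xi> \<in> borel_measurable (F s)" "\<eta> \<in> borel_measurable (F s)" using assms by (auto simp: adapted_sq_def)
  then have "(\<lambda>\<omega>. \<xi> \<omega> \<bullet> \<eta> \<omega>) \<in> borel_measurable (F s)" by measurable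
  from expectation_mult_increment(2)[OF assms(1,2) this] show ?thesis
    using assms square_integrable_inner by (auto simp: adapted_sq_def mult.commute)
qed

lemma expectation_increment_increment:
  assumes "0 \<le> s" "s \<le> t" "adapted_sq s \<xi>" "adapted_sq s \<eta>"
  shows "expectation (\<lambda>\<omega>. ((W t \<omega> - W s \<omega>) *\<^sub>R \<xi> \<omega>) \<bullet> ((W t \<omega> - W s \<omega>) *\<^sub>R \<eta> \<omega>))
    = (t - s) * expectation (\<lambda>\<omega>. \<xi> \<omega> \<bullet> \<eta> \<omega>)"
proof -
  have "\<xi> \<in> borel_measurable (F s)" "\<eta> \<in> borel_measurable (F s)" using assms by (auto simp: adapted_sq_def)
  then have "(\<lambda>\<omega>. \<xi> \<omega> \<bullet> \<eta> \<omega>) \<in> borel_measurable (F s)" by measurable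
  from expectation_mult_increment(4)[OF assms(1,2) this] show ?thesis
    using assms square_integrable_inner
    by (auto simp: adapted_sq_def mult.commute mult.left_commute power2_eq_square)
qed

lemma adapted_sq_square_integrable: "adapted_sq s \<xi> \<Longrightarrow> square_integrable M \<xi>"
  by (simp add: adapted_sq_def)

text \<open>Only the overlap of the two time intervals contributes. The increments are split at
  \<open>c\<close> and at \<open>e\<close>, the smaller of \<open>b\<close> and \<open>d\<close>; in
  each other nontrivial product one increment begins when all remaining factors are already known,
  so the mean vanishes.\<close>

lemma expectation_increments_inner_le:
  assumes "0 \<le> a" "a \<le> b" "a \<le> c" "c \<le> d" and \<xi>: "adapted_sq a \<xi>" and \<eta>: "adapted_sq c \<eta>"
  shows "expectation (\<lambda>\<omega>. ((W b \<omega> - W a \<omega>) *\<^sub>R \<xi> \<omega>) \<bullet> ((W d \<omega> - W c \<omega>) *\<^sub>R \<eta> \<omega>))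
    = max 0 (min b d - c) * expectation (\<lambda>\<omega>. \<xi> \<omega> \<bullet> \<eta> \<omega>)"
proof (cases "b \<le> c")
  case True
  have "adapted_sq c (\<lambda>\<omega>. (W b \<omega> - W a \<omega>) *\<^sub>R \<xi> \<omega>)"
    using adapted_sq_mono[OF True] adapted_sq_increment assms by blast
  from expectation_inner_increment[OF _ _ this \<eta>] show ?thesis using assms True by simp
next
  case False
  define e where "e = min b d"
  have e: "c \<le> e" "e \<le> b" "e \<le> d" "e = b \<or> e = d" using False assms by (auto simp: e_def)
  have c: "0 \<le> c" "0 \<le> e" using assms e by auto
  have \<xi>c: "adapted_sq c \<xi>" by (rule adapted_sq_mono[OF \<open>a \<le> c\<close> \<xi>])
  have \<xi>e: "adapted_sq e \<xi>" by (rule adapted_sq_mono[OF \<open>c \<le> e\<close> \<xi>c])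
  have \<eta>e: "adapted_sq e \<eta>" by (rule adapted_sq_mono[OF \<open>c \<le> e\<close> \<eta>])
  define X1 where "X1 = (\<lambda>\<omega>. (W c \<omega> - W a \<omega>) *\<^sub>R \<xi> \<omega>)"
  define X2 where "X2 = (\<lambda>\<omega>. (W e \<omega> - W c \<omega>) *\<^sub>R \<xi> \<omega>)"
  define X3 where "X3 = (\<lambda>\<omega>. (W b \<omega> - W e \<omega>) *\<^sub>R \<xi> \<omega>)"
  define Y0 where "Y0 = (\<lambda>\<omega>. (W d \<omega> - W c \<omega>) *\<^sub>R \<eta> \<omega>)"
  define Y1 where "Y1 = (\<lambda>\<omega>. (W e \<omega> - W c \<omega>) *\<^sub>R \<eta> \<omega>)"
  define Y2 where "Y2 = (\<lambda>\<omega>. (W d \<omega> - W e \<omega>) *\<^sub>R \<eta> \<omega>)"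
  have ad: "adapted_sq c X1" "adapted_sq e X2" "adapted_sq b X3" "adapted_sq d Y0" "adapted_sq e Y1" "adapted_sq d Y2"
    unfolding X1_def X2_def X3_def Y0_def Y1_def Y2_def
    by (rule adapted_sq_increment; use assms c e \<xi>c \<xi>e \<eta>e in auto)+
  note si = ad[THEN adapted_sq_square_integrable]
  have int: "integrable M (\<lambda>\<omega>. X \<omega> \<bullet> Y \<omega>)" if "X \<in> {X1, X2, X3}" "Y \<in> {Y0, Y1, Y2}" for X Y
    using that si by (auto intro: square_integrable_inner)
  have "expectation (\<lambda>\<omega>. X1 \<omega> \<bullet> Y0 \<omega>) = 0"
    unfolding Y0_def by (rule expectation_inner_increment) (use assms c ad in auto)
  moreover have "expectation (\<lambda>\<omega>. X2 \<omega> \<bullet> Y1 \<omega>) = (e - c) * expectation (\<lambda>\<omega>. \<xi> \<omega> \<bullet> \<eta> \<omega>)"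
    unfolding X2_def Y1_def by (rule expectation_increment_increment) (use c e \<xi>c \<eta> in auto)
  moreover have "expectation (\<lambda>\<omega>. X2 \<omega> \<bullet> Y2 \<omega>) = 0"
    unfolding Y2_def by (rule expectation_inner_increment) (use c e ad \<eta>e in auto)
  moreover have "expectation (\<lambda>\<omega>. X3 \<omega> \<bullet> Y1 \<omega>) = 0"
    using expectation_inner_increment[OF c(2) e(2) ad(5) \<xi>e] by (simp add: X3_def inner_commute)
  \<comment> \<open>Since \<open>e\<close> is \<open>b\<close> or \<open>d\<close>, one of the two
    increments is over an interval of length zero.\<close>
  moreover have "expectation (\<lambda>\<omega>. X3 \<omega> \<bullet> Y2 \<omega>) = 0"
    using e(4) by (auto simp: X3_def Y2_def)
  moreover have "expectation (\<lambda>\<omega>. ((W b \<omega> - W a \<omega>) *\<^sub>R \<xi> \<omega>) \<bullet> ((W d \<omega> - W c \<omega>) *\<^sub>R \<eta> \<omega>)) =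
    expectation (\<lambda>\<omega>. X1 \<omega> \<bullet> Y0 \<omega> + (X2 \<omega> \<bullet> Y1 \<omega> + X2 \<omega> \<bullet> Y2 \<omega>) + (X3 \<omega> \<bullet> Y1 \<omega> + X3 \<omega> \<bullet> Y2 \<omega>))"
    by (intro arg_cong[where f=expectation] ext)
      (simp add: X1_def X2_def X3_def Y0_def Y1_def Y2_def algebra_simps)
  moreover have "\<dots> = expectation (\<lambda>\<omega>. X1 \<omega> \<bullet> Y0 \<omega>) + (expectation (\<lambda>\<omega>. X2 \<omega> \<bullet> Y1 \<omega>) + expectation (\<lambda>\<omega>. X2 \<omega> \<bullet> Y2 \<omega>))
      + (expectation (\<lambda>\<omega>. X3 \<omega> \<bullet> Y1 \<omega>) + expectation (\<lambda>\<omega>. X3 \<omega> \<bullet> Y2 \<omega>))"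
    by (simp add: int)
  ultimately show ?thesis using e by (simp add: e_def)
qed

lemma expectation_increments_inner:
  assumes "0 \<le> a" "a \<le> b" "0 \<le> c" "c \<le> d" and \<xi>: "adapted_sq a \<xi>" and \<eta>: "adapted_sq c \<eta>"
  shows "expectation (\<lambda>\<omega>. ((W b \<omega> - W a \<omega>) *\<^sub>R \<xi> \<omega>) \<bullet> ((W d \<omega> - W c \<omega>) *\<^sub>R \<eta> \<omega>))
    = max 0 (min b d - max a c) * expectation (\<lambda>\<omega>. \<xi> \<omega> \<bullet> \<eta> \<omega>)"
proof (cases "a \<le> c")
  case True
  then show ?thesis using expectation_increments_inner_le[OF assms(1,2) _ assms(4) \<xi> \<eta>] by (simp add: max_def)
next
  case False
  then show ?thesis using expectation_increments_inner_le[OF assms(3,4) _ assms(2) \<eta> \<xi>] assms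
    by (simp add: inner_commute max_def min.commute)
qed

section \<open>Elementary integrands\<close>

definition block_integral :: "real \<Rightarrow> real \<Rightarrow> ('w \<Rightarrow> 'b::euclidean_space) \<Rightarrow> real \<Rightarrow> 'w \<Rightarrow> 'b"
  where "block_integral a b \<xi> t \<omega> = (W (min t b) \<omega> - W (min t a) \<omega>) *\<^sub>R \<xi> \<omega>"

lemma adapted_sq_0: "adapted_sq t (\<lambda>_. 0)"
  by (simp add: adapted_sq_def square_integrable_0)

lemma adapted_sq_add: "adapted_sq t X \<Longrightarrow> adapted_sq t Y \<Longrightarrow> adapted_sq t (\<lambda>\<omega>. X \<omega> + Y \<omega>)"
  by (auto simp: adapted_sq_def square_integrable_add)

lemma adapted_sq_block_integral:
  assumes "0 \<le> a" "a \<le> b" "adapted_sq a \<xi>" "0 \<le> t"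
  shows "adapted_sq t (block_integral a b \<xi> t)"
proof (cases "a \<le> t")
  case True
  then have "adapted_sq (min t b) (\<lambda>\<omega>. (W (min t b) \<omega> - W a \<omega>) *\<^sub>R \<xi> \<omega>)"
    by (intro adapted_sq_increment) (use assms in auto)
  then show ?thesis using True adapted_sq_mono[of "min t b" t]
    by (simp add: block_integral_def[abs_def] min_absorb2)
next
  case False
  then have "min t a = t" "min t b = t" using assms by auto
  then show ?thesis by (simp add: block_integral_def[abs_def] adapted_sq_0)
qed

lemma lebesgue_integral_indicators:
  assumes "0 \<le> a" "a \<le> b" "0 \<le> c" "c \<le> d" "0 \<le> t"
  shows "(LINT s:{0..t}|lborel. indicator {a<..b} s * (indicator {c<..d} s :: real))
    = max 0 (min (min t b) (min t d) - max (min t a) (min t c))"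
proof -
  have "(LINT s:{0..t}|lborel. indicator {a<..b} s * (indicator {c<..d} s :: real)) =
     (LINT s|lborel. indicator ({max a c<..min t (min b d)}) s)"
    unfolding set_lebesgue_integral_def
    by (intro Bochner_Integration.integral_cong) (use assms in \<open>auto simp: indicator_def\<close>)
  also have "\<dots> = max 0 (min t (min b d) - max a c)"
    by (auto simp: max_def)
  also have "\<dots> = max 0 (min (min t b) (min t d) - max (min t a) (min t c))"
    using assms by (auto simp: min_def max_def)
  finally show ?thesis .
qed

lemma block_isometry:
  assumes "0 \<le> a" "a \<le> b" "0 \<le> c" "c \<le> d" and \<xi>: "adapted_sq a \<xi>" and \<eta>: "adapted_sq c \<eta>" and t: "0 \<le> t"
  shows "expectation (\<lambda>\<omega>. block_integral a b \<xi> t \<omega> \<bullet> block_integral c d \<eta> t \<omega>)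
    = (LINT s:{0..t}|lborel. indicator {a<..b} s * (indicator {c<..d} s :: real)) * expectation (\<lambda>\<omega>. \<xi> \<omega> \<bullet> \<eta> \<omega>)"
proof (cases "a \<le> t \<and> c \<le> t")
  case True
  then show ?thesis
    unfolding lebesgue_integral_indicators[OF assms(1-4) t]
    using expectation_increments_inner[of a "min t b" c "min t d" \<xi> \<eta>] assms
    by (simp add: block_integral_def min_absorb2)
next
  case False
  \<comment> \<open>A block that begins after \<open>t\<close> has integral 0 and does not meet
    \<open>{0..t}\<close>, so both sides vanish.\<close>
  then have "block_integral a b \<xi> t = (\<lambda>_. 0) \<or> block_integral c d \<eta> t = (\<lambda>_. 0)"
    using assms by (auto simp: block_integral_def[abs_def] min_absorb1)
  moreover have "max 0 (min (min t b) (min t d) - max (min t a) (min t c)) = 0"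
    using False assms by (auto simp: min_def max_def)
  ultimately show ?thesis
    unfolding lebesgue_integral_indicators[OF assms(1-4) t] by auto
qed

text \<open>The blocks of an elementary integrand may overlap, so that sums and products of integrands need
  no common refinement of partitions.\<close>

inductive elem :: "(real \<Rightarrow> 'w \<Rightarrow> 'b::euclidean_space) \<Rightarrow> (real \<Rightarrow> 'w \<Rightarrow> 'b) \<Rightarrow> bool"
  where
    elem_zero: "elem (\<lambda>_ _. 0) (\<lambda>_ _. 0)"
  | elem_block: "elem Z I \<Longrightarrow> 0 \<le> a \<Longrightarrow> a \<le> b \<Longrightarrow> adapted_sq a \<xi> \<Longrightarrow>
      elem (\<lambda>s \<omega>. Z s \<omega> + indicator {a<..b} s *\<^sub>R \<xi> \<omega>) (\<lambda>t \<omega>. I t \<omega> + block_integral a b \<xi> t \<omega>)"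

lemma elem_single:
  assumes "0 \<le> a" "a \<le> b" "adapted_sq a \<xi>"
  shows "elem (\<lambda>s \<omega>. indicator {a<..b} s *\<^sub>R \<xi> \<omega>) (block_integral a b \<xi>)"
  using elem_block[OF elem_zero assms] by simp

lemma elem_add:
  assumes "elem Z I" "elem Z' I'"
  shows "elem (\<lambda>s \<omega>. Z s \<omega> + Z' s \<omega>) (\<lambda>t \<omega>. I t \<omega> + I' t \<omega>)"
  using assms(2)
proof induction
  case elem_zero
  then show ?case using assms(1) by simp
next
  case (elem_block Z' I' a b \<xi>)
  from wiener_process.elem_block[OF wiener_process_axioms elem_block.IH elem_block.hyps(2-4)]
  show ?case by (simp add: add.assoc)
qed

lemma elem_sum:
  assumes "\<And>i. i \<in> A \<Longrightarrow> elem (Z i) (I i)"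
  shows "elem (\<lambda>s \<omega>. \<Sum>i\<in>A. Z i s \<omega>) (\<lambda>t \<omega>. \<Sum>i\<in>A. I i t \<omega>)"
  using assms by (induction A rule: infinite_finite_induct) (auto intro: elem_zero elem_add)

lemma elem_scaleR:
  assumes "elem Z I"
  shows "elem (\<lambda>s \<omega>. c *\<^sub>R Z s \<omega>) (\<lambda>t \<omega>. c *\<^sub>R I t \<omega>)"
  using assms
proof induction
  case elem_zero
  then show ?case using wiener_process.elem_zero[OF wiener_process_axioms] by simp
next
  case (elem_block Z I a b \<xi>)
  have "adapted_sq a (\<lambda>\<omega>. c *\<^sub>R \<xi> \<omega>)"
    using elem_block.hyps(4) by (auto simp: adapted_sq_def square_integrable_scaleR)
  from wiener_process.elem_block[OF wiener_process_axioms elem_block.IH elem_block.hyps(2-3) this]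
  show ?case by (simp add: scaleR_add_right block_integral_def mult.commute)
qed

lemma elem_diff:
  assumes "elem Z I" "elem Z' I'"
  shows "elem (\<lambda>s \<omega>. Z s \<omega> - Z' s \<omega>) (\<lambda>t \<omega>. I t \<omega> - I' t \<omega>)"
  using elem_add[OF assms(1) elem_scaleR[OF assms(2), of "-1"]] by simp

lemma elem_adapted:
  assumes "elem Z I" "0 \<le> t"
  shows "adapted_sq t (I t)"
  using assms(1)
  by induction (use assms(2) in \<open>auto intro!: adapted_sq_0 adapted_sq_add adapted_sq_block_integral\<close>)

lemma elem_path:
  assumes "elem Z I"
  shows "(\<lambda>s. Z s \<omega>) \<in> borel_measurable borel \<and> bounded (range (\<lambda>s. Z s \<omega>))"
  using assms
proof induction
  case (elem_block Z I a b \<xi>)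
  have "bounded (range (\<lambda>s. indicator {a<..b} s *\<^sub>R \<xi> \<omega>))"
    by (rule boundedI[where B="norm (\<xi> \<omega>)"]) (auto simp: indicator_def)
  with elem_block.IH show ?case by (auto intro: bounded_plus_comp)
qed auto

lemma elem_set_integrable:
  assumes "elem Z I" "elem Z' I'"
  shows "set_integrable lborel {0..t} (\<lambda>s. Z s \<omega> \<bullet> Z' s \<omega>)"
proof -
  obtain K where K: "\<And>s. norm (Z s \<omega>) \<le> K" using elem_path[OF assms(1), of \<omega>] by (auto simp: bounded_iff)
  obtain K' where K': "\<And>s. norm (Z' s \<omega>) \<le> K'" using elem_path[OF assms(2), of \<omega>] by (auto simp: bounded_iff)
  have [measurable]: "(\<lambda>s. Z s \<omega>) \<in> borel_measurable borel" "(\<lambda>s. Z' s \<omega>) \<in> borel_measurable borel"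
    using elem_path assms by blast+
  have "norm (Z s \<omega> \<bullet> Z' s \<omega>) \<le> K * K'" for s
    using Cauchy_Schwarz_ineq2[of "Z s \<omega>" "Z' s \<omega>"] mult_mono[OF K K' order_trans[OF norm_ge_zero K] norm_ge_zero, of s s]
    by (simp)
  then show ?thesis
    unfolding set_integrable_def
    by (intro integrableI_bounded_set_indicator[where B="K * K'"]) (auto simp: emeasure_lborel_Icc_eq)
qed

end

section \<open>Energy of integrands and the Ito isometry\<close>

definition energy :: "real set \<Rightarrow> (real \<Rightarrow> 'w \<Rightarrow> 'b::euclidean_space) \<Rightarrow> 'w \<Rightarrow> ennreal"
  where "energy A Z \<omega> = (\<integral>\<^sup>+s\<in>A. ennreal ((norm (Z s \<omega>))\<^sup>2) \<partial>lborel)"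

lemma sum_indicator_piece:
  fixes g :: "nat \<Rightarrow> real" and f :: "nat \<Rightarrow> 'b::real_vector"
  assumes "mono g" "k < N" "s \<in> {g k<..g (Suc k)}"
  shows "(\<Sum>j<N. indicator {g j<..g (Suc j)} s *\<^sub>R f j) = f k"
proof -
  have "indicator {g j<..g (Suc j)} s *\<^sub>R f j = (if j = k then f k else 0)" for j
  proof -
    consider "j < k" | "j = k" | "k < j" by linarith
    then show ?thesis
    proof cases
      case 1
      then have "g (Suc j) \<le> g k" using assms(1) by (intro monoD[of g]) auto
      then show ?thesis using 1 assms(3) by auto
    next
      case 3
      then have "g (Suc k) \<le> g j" using assms(1) by (intro monoD[of g]) auto
      then show ?thesis using 3 assms(3) by auto
    qed (use assms(3) in auto)
  qed
  then show ?thesis using assms(2) by simp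
qed

lemma sum_indicator_outside:
  fixes g :: "nat \<Rightarrow> real" and f :: "nat \<Rightarrow> 'b::real_vector"
  assumes "\<And>k. k < N \<Longrightarrow> s \<notin> {g k<..g (Suc k)}"
  shows "(\<Sum>j<N. indicator {g j<..g (Suc j)} s *\<^sub>R f j) = 0"
  using assms by (intro sum.neutral) auto

text \<open>Chebyshev's inequality for the second moment; in \<open>elem_truncation\<close> it turns
  a bound on the energy into a bound on a probability.\<close>

lemma emeasure_norm_gt_le:
  assumes [measurable]: "f \<in> borel_measurable M" and \<delta>: "0 < \<delta>"
    and le: "(\<integral>\<^sup>+\<omega>. ennreal ((norm (f \<omega>))\<^sup>2) \<partial>M) \<le> ennreal c" and c: "0 \<le> c"
  shows "emeasure M {\<omega> \<in> space M. \<delta> < norm (f \<omega>)} \<le> ennreal (c / \<delta>\<^sup>2)"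
proof -
  have "emeasure M {\<omega> \<in> space M. \<delta> < norm (f \<omega>)} = (\<integral>\<^sup>+\<omega>. indicator {\<omega> \<in> space M. \<delta> < norm (f \<omega>)} \<omega> \<partial>M)"
    by (rule nn_integral_indicator[symmetric]) measurable
  also have "\<dots> \<le> (\<integral>\<^sup>+\<omega>. ennreal (1 / \<delta>\<^sup>2) * ennreal ((norm (f \<omega>))\<^sup>2) \<partial>M)"
  proof (rule nn_integral_mono)
    fix \<omega> assume "\<omega> \<in> space M"
    have "1 \<le> 1 / \<delta>\<^sup>2 * (norm (f \<omega>))\<^sup>2" if "\<delta> < norm (f \<omega>)"
      using power_strict_mono[OF that, of 2] \<delta> that by simp
    then have "1 \<le> ennreal (1 / \<delta>\<^sup>2) * ennreal ((norm (f \<omega>))\<^sup>2)" if "\<delta> < norm (f \<omega>)"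
      using that by (metis ennreal_1 ennreal_leI ennreal_mult' zero_le_divide_1_iff zero_le_power2)
    then show "indicator {\<omega> \<in> space M. \<delta> < norm (f \<omega>)} \<omega> \<le> ennreal (1 / \<delta>\<^sup>2) * ennreal ((norm (f \<omega>))\<^sup>2)"
      by (auto simp: indicator_def)
  qed
  also have "\<dots> = ennreal (1 / \<delta>\<^sup>2) * (\<integral>\<^sup>+\<omega>. ennreal ((norm (f \<omega>))\<^sup>2) \<partial>M)"
    by (rule nn_integral_cmult) measurable
  also have "\<dots> \<le> ennreal (1 / \<delta>\<^sup>2) * ennreal c" by (rule mult_left_mono[OF le]) simp
  also have "\<dots> = ennreal (c / \<delta>\<^sup>2)" using c \<delta> by (simp add: ennreal_mult[symmetric])
  finally show ?thesis .
qed

lemma energy_measurable: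
  assumes [measurable]: "(\<lambda>(s, \<omega>). Z s \<omega>) \<in> borel_measurable (borel \<Otimes>\<^sub>M N)" "A \<in> sets borel"
  shows "energy A Z \<in> borel_measurable N"
  unfolding energy_def by measurable

context wiener_process
begin

text \<open>Both sides are bilinear, so the isometry reduces to pairs of single blocks. This
  induction takes the first argument apart, \<open>elem_inner_isometry\<close> the second.
  Integrability is carried along because additivity of the expectation depends on it.\<close>

lemma elem_block_isometry:
  assumes "elem Z I" and \<eta>: "0 \<le> c" "c \<le> d" "adapted_sq c \<eta>" and t: "0 \<le> t"
  shows "integrable M (\<lambda>\<omega>. LINT s:{0..t}|lborel. Z s \<omega> \<bullet> (indicator {c<..d} s *\<^sub>R \<eta> \<omega>)) \<and>
    expectation (\<lambda>\<omega>. I t \<omega> \<bullet> block_integral c d \<eta> t \<omega>) =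
    expectation (\<lambda>\<omega>. LINT s:{0..t}|lborel. Z s \<omega> \<bullet> (indicator {c<..d} s *\<^sub>R \<eta> \<omega>))"
  using assms(1)
proof induction
  case elem_zero
  show ?case by (simp add: set_lebesgue_integral_def)
next
  case (elem_block Z I a b \<xi>)
  note h = elem_block.hyps
  note \<eta>e = elem_single[OF \<eta>]
  let ?L = "LINT s:{0..t}|lborel. indicator {a<..b} s * (indicator {c<..d} s :: real)"
  have 1: "(LINT s:{0..t}|lborel. (Z s \<omega> + indicator {a<..b} s *\<^sub>R \<xi> \<omega>) \<bullet> (indicator {c<..d} s *\<^sub>R \<eta> \<omega>)) =
    (LINT s:{0..t}|lborel. Z s \<omega> \<bullet> (indicator {c<..d} s *\<^sub>R \<eta> \<omega>)) + ?L * (\<xi> \<omega> \<bullet> \<eta> \<omega>)" for \<omega>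
  proof -
    have "(LINT s:{0..t}|lborel. (Z s \<omega> + indicator {a<..b} s *\<^sub>R \<xi> \<omega>) \<bullet> (indicator {c<..d} s *\<^sub>R \<eta> \<omega>)) =
      (LINT s:{0..t}|lborel. Z s \<omega> \<bullet> (indicator {c<..d} s *\<^sub>R \<eta> \<omega>)) +
      (LINT s:{0..t}|lborel. (indicator {a<..b} s *\<^sub>R \<xi> \<omega>) \<bullet> (indicator {c<..d} s *\<^sub>R \<eta> \<omega>))"
      unfolding inner_add_left
      by (rule set_integral_add(2)[OF elem_set_integrable[OF h(1) \<eta>e] elem_set_integrable[OF elem_single[OF h(2-4)] \<eta>e]])
    also have "(LINT s:{0..t}|lborel. (indicator {a<..b} s *\<^sub>R \<xi> \<omega>) \<bullet> (indicator {c<..d} s *\<^sub>R \<eta> \<omega>)) =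
      (LINT s:{0..t}|lborel. (indicator {a<..b} s * indicator {c<..d} s) * (\<xi> \<omega> \<bullet> \<eta> \<omega>))"
      by (simp add: mult.assoc mult.left_commute)
    finally show ?thesis by (simp only: set_integral_mult_left)
  qed
  have si: "square_integrable M \<xi>" "square_integrable M \<eta>" "square_integrable M (I t)"
    "square_integrable M (block_integral a b \<xi> t)" "square_integrable M (block_integral c d \<eta> t)"
    using h \<eta> t elem_adapted[OF h(1) t] adapted_sq_block_integral adapted_sq_square_integrable by blast+
  show ?case
    unfolding 1 unfolding inner_add_left
    using elem_block.IH si square_integrable_inner block_isometry[OF h(2,3) \<eta>(1,2) h(4) \<eta>(3) t]
    by (simp add: square_integrable_inner)
qed

lemma elem_inner_isometry:
  assumes Z: "elem Z I" and "elem Z' I'" and t: "0 \<le> t"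
  shows "integrable M (\<lambda>\<omega>. LINT s:{0..t}|lborel. Z s \<omega> \<bullet> Z' s \<omega>) \<and>
    expectation (\<lambda>\<omega>. I t \<omega> \<bullet> I' t \<omega>) = expectation (\<lambda>\<omega>. LINT s:{0..t}|lborel. Z s \<omega> \<bullet> Z' s \<omega>)"
  using assms(2)
proof induction
  case elem_zero
  show ?case by (simp add: set_lebesgue_integral_def)
next
  case (elem_block Z' I' a b \<xi>)
  note h = elem_block.hyps
  have 1: "(LINT s:{0..t}|lborel. Z s \<omega> \<bullet> (Z' s \<omega> + indicator {a<..b} s *\<^sub>R \<xi> \<omega>)) =
    (LINT s:{0..t}|lborel. Z s \<omega> \<bullet> Z' s \<omega>) + (LINT s:{0..t}|lborel. Z s \<omega> \<bullet> (indicator {a<..b} s *\<^sub>R \<xi> \<omega>))" for \<omega>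
    unfolding inner_add_right
    by (rule set_integral_add(2)[OF elem_set_integrable[OF Z h(1)] elem_set_integrable[OF Z elem_single[OF h(2-4)]]])
  have si: "square_integrable M (I t)" "square_integrable M (I' t)"
    "square_integrable M (block_integral a b \<xi> t)"
    using h t Z elem_adapted adapted_sq_block_integral adapted_sq_square_integrable by blast+
  show ?case
    unfolding 1 unfolding inner_add_right
    using elem_block.IH si elem_block_isometry[OF Z h(2-4) t]
    by (simp add: square_integrable_inner)
qed

lemma elem_joint_measurable:
  assumes "elem Z I"
  shows "(\<lambda>(s, \<omega>). Z s \<omega>) \<in> borel_measurable (borel \<Otimes>\<^sub>M M)"
  using assms
proof induction
  case (elem_block Z I a b \<xi>)
  have [measurable]: "\<xi> \<in> borel_measurable M" "(\<lambda>(s, \<omega>). Z s \<omega>) \<in> borel_measurable (borel \<Otimes>\<^sub>M M)"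
    using elem_block by (auto simp: adapted_sq_def intro: F_measurable)
  show ?case by measurable
qed simp

text \<open>A block is visible on \<open>{..t}\<close> only if it starts before \<open>t\<close>,
  and then its coefficient is measurable with respect to \<open>F t\<close>. Consequently the energy
  spent up to \<open>t\<close> is known at time \<open>t\<close>, which keeps a truncation by energy
  adapted.\<close>

lemma elem_progressive:
  assumes "elem Z I"
  shows "(\<lambda>(s, \<omega>). indicator {..t} s *\<^sub>R Z s \<omega>) \<in> borel_measurable (borel \<Otimes>\<^sub>M F t)"
  using assms
proof induction
  case (elem_block Z I a b \<xi>)
  have IH[measurable]: "(\<lambda>(s, \<omega>). indicator {..t} s *\<^sub>R Z s \<omega>) \<in> borel_measurable (borel \<Otimes>\<^sub>M F t)"
    by (rule elem_block)
  show ?case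
  proof (cases "a < t")
    case True
    then have [measurable]: "\<xi> \<in> borel_measurable (F t)"
      using elem_block.hyps(4) by (auto simp: adapted_sq_def intro: F_measurable_mono[OF less_imp_le])
    have "(\<lambda>(s, \<omega>). indicator {..t} s *\<^sub>R Z s \<omega> + (indicator {..t} s * indicator {a<..b} s) *\<^sub>R \<xi> \<omega>)
      \<in> borel_measurable (borel \<Otimes>\<^sub>M F t)"
      by measurable
    then show ?thesis by (simp add: scaleR_add_right)
  next
    case False
    then have "(\<lambda>(s, \<omega>). indicator {..t} s *\<^sub>R (Z s \<omega> + indicator {a<..b} s *\<^sub>R \<xi> \<omega>)) =
      (\<lambda>(s, \<omega>). indicator {..t} s *\<^sub>R Z s \<omega>)"
      by (auto simp: indicator_def)
    then show ?thesis using IH by simp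
  qed
qed simp

lemma energy_adapted:
  assumes "elem Z I" and A: "A \<in> sets borel" "A \<subseteq> {..t}"
  shows "energy A Z \<in> borel_measurable (F t)"
proof -
  have "energy A Z = energy A (\<lambda>s \<omega>. indicator {..t} s *\<^sub>R Z s \<omega>)"
    unfolding energy_def by (intro ext nn_integral_cong) (use A in \<open>auto simp: indicator_def\<close>)
  then show ?thesis
    using energy_measurable[OF elem_progressive[OF assms(1)] A(1)] by simp
qed

lemma elem_energy:
  assumes "elem Z I"
  shows "energy {0..t} Z \<omega> = ennreal (LINT s:{0..t}|lborel. Z s \<omega> \<bullet> Z s \<omega>)"
proof -
  have "energy {0..t} Z \<omega> = (\<integral>\<^sup>+s. ennreal (indicator {0..t} s *\<^sub>R (Z s \<omega> \<bullet> Z s \<omega>)) \<partial>lborel)"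
    unfolding energy_def by (intro nn_integral_cong) (auto simp: indicator_def power2_norm_eq_inner)
  also have "\<dots> = ennreal (LINT s:{0..t}|lborel. Z s \<omega> \<bullet> Z s \<omega>)"
    unfolding set_lebesgue_integral_def
    using elem_set_integrable[OF assms assms, of t \<omega>]
    by (intro nn_integral_eq_integral) (auto simp: set_integrable_def)
  finally show ?thesis .
qed

lemma elem_isometry:
  assumes "elem Z I" "0 \<le> t"
  shows "(\<integral>\<^sup>+\<omega>. ennreal ((norm (I t \<omega>))\<^sup>2) \<partial>M) = (\<integral>\<^sup>+\<omega>. energy {0..t} Z \<omega> \<partial>M)"
proof -
  have "(\<integral>\<^sup>+\<omega>. ennreal ((norm (I t \<omega>))\<^sup>2) \<partial>M) = ennreal (expectation (\<lambda>\<omega>. I t \<omega> \<bullet> I t \<omega>))"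
    using elem_adapted[OF assms]
    by (subst nn_integral_square_integrable) (auto simp: adapted_sq_def power2_norm_eq_inner)
  also have "\<dots> = ennreal (expectation (\<lambda>\<omega>. LINT s:{0..t}|lborel. Z s \<omega> \<bullet> Z s \<omega>))"
    using elem_inner_isometry[OF assms(1,1,2)] by simp
  also have "\<dots> = (\<integral>\<^sup>+\<omega>. ennreal (LINT s:{0..t}|lborel. Z s \<omega> \<bullet> Z s \<omega>) \<partial>M)"
    using elem_inner_isometry[OF assms(1,1,2)]
    by (intro nn_integral_eq_integral[symmetric] AE_I2)
      (auto simp: set_lebesgue_integral_def intro!: integral_nonneg_AE)
  also have "\<dots> = (\<integral>\<^sup>+\<omega>. energy {0..t} Z \<omega> \<partial>M)"
    by (simp add: elem_energy[OF assms(1)])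
  finally show ?thesis .
qed

lemma block_integral_min:
  assumes "max a c \<le> min b d" "0 \<le> a" "a \<le> b" "0 \<le> c" "c \<le> d"
  shows "block_integral (max a c) (min b d) (\<lambda>\<omega>. r \<omega> *\<^sub>R \<xi> \<omega>) t \<omega> =
    r \<omega> *\<^sub>R (block_integral a b \<xi> (min t d) \<omega> - block_integral a b \<xi> (min t c) \<omega>)"
proof -
  have "W (min t (min b d)) \<omega> - W (min t (max a c)) \<omega> =
    (W (min (min t d) b) \<omega> - W (min (min t d) a) \<omega>) - (W (min (min t c) b) \<omega> - W (min (min t c) a) \<omega>)"
    using assms by (smt (verit) max_def min_def)
  then show ?thesis
    by (simp add: block_integral_def scaleR_diff_left[symmetric] mult.commute
        del: scaleR_left_diff_distrib)
qed

text \<open>The integral over \<open>{c<..d}\<close> is an increment of the full integral, and a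
  bounded factor known at time \<open>c\<close> can be pulled out of it. Truncation by energy and
  gluing of two integrands at an intermediate time both rest on this.\<close>

lemma elem_cutoff:
  assumes "elem Z I" and c: "0 \<le> c" "c \<le> d" and r: "r \<in> borel_measurable (F c)" "\<And>\<omega>. \<omega> \<in> space M \<Longrightarrow> \<bar>r \<omega>\<bar> \<le> B"
  shows "elem (\<lambda>s \<omega>. indicator {c<..d} s *\<^sub>R r \<omega> *\<^sub>R Z s \<omega>) (\<lambda>t \<omega>. r \<omega> *\<^sub>R (I (min t d) \<omega> - I (min t c) \<omega>))"
  using assms(1)
proof induction
  case elem_zero
  show ?case using wiener_process.elem_zero[OF wiener_process_axioms] by simp
next
  case (elem_block Z I a b \<xi>)
  note h = elem_block.hyps
  show ?case
  proof (cases "max a c \<le> min b d")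
    case True
    \<comment> \<open>The restricted block has to begin at the later of the two times, where
      \<open>\<xi>\<close> and \<open>r\<close> are both measurable.\<close>
    let ?m = "max a c"
    have m: "\<xi> \<in> borel_measurable (F ?m)" "r \<in> borel_measurable (F ?m)"
      using h(4) r by (auto simp: adapted_sq_def intro: F_measurable_mono[of a ?m] F_measurable_mono[of c ?m])
    then have rm: "(\<lambda>\<omega>. r \<omega> *\<^sub>R \<xi> \<omega>) \<in> borel_measurable (F ?m)" by measurable
    have "square_integrable M (\<lambda>\<omega>. r \<omega> *\<^sub>R \<xi> \<omega>)"
      using adapted_sq_square_integrable[OF h(4)] F_measurable[OF rm]
    proof (rule square_integrable_bound[where c=B])
      fix \<omega> assume "\<omega> \<in> space M"
      with r(2) show "norm (r \<omega> *\<^sub>R \<xi> \<omega>) \<le> B * norm (\<xi> \<omega>)" by (simp add: mult_right_mono)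
    qed
    with rm have "adapted_sq ?m (\<lambda>\<omega>. r \<omega> *\<^sub>R \<xi> \<omega>)" by (simp add: adapted_sq_def)
    from wiener_process.elem_block[OF wiener_process_axioms elem_block.IH _ True this] h(2)
    have "elem (\<lambda>s \<omega>. indicator {c<..d} s *\<^sub>R r \<omega> *\<^sub>R Z s \<omega> + indicator {?m<..min b d} s *\<^sub>R r \<omega> *\<^sub>R \<xi> \<omega>)
      (\<lambda>t \<omega>. r \<omega> *\<^sub>R (I (min t d) \<omega> - I (min t c) \<omega>) +
        r \<omega> *\<^sub>R (block_integral a b \<xi> (min t d) \<omega> - block_integral a b \<xi> (min t c) \<omega>))"
      unfolding block_integral_min[OF True h(2,3) c] by simp
    moreover have "(\<lambda>s \<omega>. indicator {c<..d} s *\<^sub>R r \<omega> *\<^sub>R Z s \<omega> + indicator {?m<..min b d} s *\<^sub>R r \<omega> *\<^sub>R \<xi> \<omega>) =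
      (\<lambda>s \<omega>. indicator {c<..d} s *\<^sub>R r \<omega> *\<^sub>R (Z s \<omega> + indicator {a<..b} s *\<^sub>R \<xi> \<omega>))"
      by (intro ext) (auto simp: indicator_def scaleR_add_right)
    moreover have "(\<lambda>t \<omega>. r \<omega> *\<^sub>R (I (min t d) \<omega> - I (min t c) \<omega>) +
        r \<omega> *\<^sub>R (block_integral a b \<xi> (min t d) \<omega> - block_integral a b \<xi> (min t c) \<omega>)) =
      (\<lambda>t \<omega>. r \<omega> *\<^sub>R (I (min t d) \<omega> + block_integral a b \<xi> (min t d) \<omega> -
        (I (min t c) \<omega> + block_integral a b \<xi> (min t c) \<omega>)))"
      by (intro ext) (simp add: algebra_simps)
    ultimately show ?thesis by simp
  next
    case False
    then have "(\<lambda>s \<omega>. indicator {c<..d} s *\<^sub>R r \<omega> *\<^sub>R (Z s \<omega> + indicator {a<..b} s *\<^sub>R \<xi> \<omega>)) =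
      (\<lambda>s \<omega>. indicator {c<..d} s *\<^sub>R r \<omega> *\<^sub>R Z s \<omega>)"
      by (intro ext) (auto simp: indicator_def)
    moreover have "W (min (min t d) b) \<omega> - W (min (min t d) a) \<omega> = W (min (min t c) b) \<omega> - W (min (min t c) a) \<omega>" for t \<omega>
      using False h(2,3) c by (smt (verit) max_def min_def)
    then have "block_integral a b \<xi> (min t d) \<omega> = block_integral a b \<xi> (min t c) \<omega>" for t \<omega>
      by (simp add: block_integral_def)
    ultimately show ?thesis using elem_block.IH by simp
  qed
qed

lemma elem_at_0: "elem Z I \<Longrightarrow> I 0 \<omega> = 0"
  by (induction rule: elem.induct) (auto simp: block_integral_def min_absorb1)

end

section \<open>Truncation of elementary integrals by their energy\<close>

lemma energy_split_le:
  fixes g :: "nat \<Rightarrow> real"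
  assumes g: "mono g" "0 \<le> g 0" "g N \<le> t" and [measurable]: "(\<lambda>s. Z s \<omega>) \<in> borel_measurable borel"
  shows "(\<Sum>j<N. energy {g j<..g (Suc j)} Z \<omega>) \<le> energy {0..t} Z \<omega>"
proof -
  have "(\<Sum>j<N. energy {g j<..g (Suc j)} Z \<omega>) =
    (\<integral>\<^sup>+s. (\<Sum>j<N. ennreal ((norm (Z s \<omega>))\<^sup>2) * indicator {g j<..g (Suc j)} s) \<partial>lborel)"
    unfolding energy_def by (intro nn_integral_sum[symmetric]) measurable
  also have "\<dots> \<le> energy {0..t} Z \<omega>"
    unfolding energy_def
  proof (rule nn_integral_mono)
    fix s
    have eq: "(\<Sum>j<N. ennreal ((norm (Z s \<omega>))\<^sup>2) * indicator {g j<..g (Suc j)} s) =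
      ennreal (\<Sum>j<N. indicator {g j<..g (Suc j)} s *\<^sub>R (norm (Z s \<omega>))\<^sup>2)"
      by (subst sum_ennreal[symmetric], simp, rule sum.cong) (auto simp: indicator_def)
    show "(\<Sum>j<N. ennreal ((norm (Z s \<omega>))\<^sup>2) * indicator {g j<..g (Suc j)} s) \<le>
        ennreal ((norm (Z s \<omega>))\<^sup>2) * indicator {0..t} s"
    proof (cases "\<exists>k<N. s \<in> {g k<..g (Suc k)}")
      case True
      then obtain k where k: "k < N" "s \<in> {g k<..g (Suc k)}" by auto
      have "g 0 \<le> g k" "g (Suc k) \<le> g N" using g k by (auto intro: monoD)
      then have "s \<in> {0..t}" using k g by auto
      then show ?thesis unfolding eq sum_indicator_piece[OF g(1) k] by simp
    next
      case False
      then show ?thesis unfolding eq by (subst sum_indicator_outside) auto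
    qed
  qed
  finally show ?thesis .
qed

context wiener_process
begin

text \<open>Multiplying by the indicators \<open>r j\<close> switches the integrand off once its energy exceeds \<open>\<epsilon>\<close>;
  on the event in question nothing is switched off.\<close>

lemma elem_truncation:
  fixes Z :: "real \<Rightarrow> 'w \<Rightarrow> 'b::euclidean_space"
  assumes Z: "elem Z I" and K: "\<And>s \<omega>. \<omega> \<in> space M \<Longrightarrow> norm (Z s \<omega>) \<le> K"
    and t: "0 \<le> t" and \<epsilon>: "0 < \<epsilon>" and \<delta>: "0 < \<delta>"
  shows "emeasure M {\<omega> \<in> space M. \<delta> < norm (I t \<omega>) \<and> energy {0..t} Z \<omega> \<le> ennreal \<epsilon>} \<le> ennreal (2 * \<epsilon> / \<delta>\<^sup>2)"
proof -
  obtain N :: nat where N: "K\<^sup>2 * t / \<epsilon> < N" using reals_Archimedean2 by blast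
  moreover have "0 \<le> K\<^sup>2 * t / \<epsilon>" using t \<epsilon> by simp
  ultimately have N0: "0 < N" by (metis of_nat_0_less_iff le_less_trans)
  define g where "g j = t * real j / real N" for j
  have g: "mono g" "g 0 = 0" "g N = t" "\<And>j. 0 \<le> g j" "\<And>j. g (Suc j) - g j = t / N"
    using t N0 by (auto simp: g_def mono_def divide_right_mono mult_left_mono field_simps)
  have gS: "g j \<le> g (Suc j)" for j using g(1) by (simp add: mono_iff_le_Suc)
  define B where "B j = energy {g j<..g (Suc j)} Z" for j
  define A where "A j \<omega> = (\<Sum>i<j. B i \<omega>)" for j \<omega>
  \<comment> \<open>\<open>A j\<close> counts only the energy spent before cell \<open>j\<close>,
    hence \<open>r j\<close> is known at the left end of the cell and is an admissible factor
    there.\<close>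
  define r where "r j \<omega> = (if A j \<omega> \<le> ennreal \<epsilon> then 1 else 0 :: real)" for j \<omega>
  define Z' where "Z' s \<omega> = (\<Sum>j<N. indicator {g j<..g (Suc j)} s *\<^sub>R r j \<omega> *\<^sub>R Z s \<omega>)" for s \<omega>
  define I' where "I' u \<omega> = (\<Sum>j<N. r j \<omega> *\<^sub>R (I (min u (g (Suc j))) \<omega> - I (min u (g j)) \<omega>))" for u \<omega>
  have Zp[measurable]: "(\<lambda>s. Z s \<omega>) \<in> borel_measurable borel" for \<omega> using elem_path[OF Z] by blast
  have "B i \<in> borel_measurable (F (g j))" if "i < j" for i j
  proof -
    have "g (Suc i) \<le> g j" using that g(1) by (auto intro: monoD)
    then show ?thesis unfolding B_def by (intro energy_adapted[OF Z]) auto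
  qed
  then have A[measurable]: "A j \<in> borel_measurable (F (g j))" for j unfolding A_def by auto
  have r: "r j \<in> borel_measurable (F (g j))" for j unfolding r_def by measurable
  have e': "elem Z' I'"
    unfolding Z'_def[abs_def] I'_def[abs_def]
    by (intro elem_sum elem_cutoff[OF Z _ _ r, where B=1]) (use g gS in \<open>auto simp: r_def\<close>)
  have en: "energy {0..t} Z' \<omega> \<le> (\<Sum>j<N. ennreal (r j \<omega>) * B j \<omega>)" for \<omega>
  proof -
    have "energy {0..t} Z' \<omega> \<le> (\<integral>\<^sup>+s. (\<Sum>j<N. ennreal (r j \<omega>) * (ennreal ((norm (Z s \<omega>))\<^sup>2) * indicator {g j<..g (Suc j)} s)) \<partial>lborel)"
      unfolding energy_def
    proof (rule nn_integral_mono)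
      fix s
      show "ennreal ((norm (Z' s \<omega>))\<^sup>2) * indicator {0..t} s \<le>
        (\<Sum>j<N. ennreal (r j \<omega>) * (ennreal ((norm (Z s \<omega>))\<^sup>2) * indicator {g j<..g (Suc j)} s))"
      proof (cases "\<exists>k<N. s \<in> {g k<..g (Suc k)}")
        case True
        then obtain k where k: "k < N" "s \<in> {g k<..g (Suc k)}" by auto
        have "ennreal ((norm (Z' s \<omega>))\<^sup>2) * indicator {0..t} s \<le>
          ennreal (r k \<omega>) * (ennreal ((norm (Z s \<omega>))\<^sup>2) * indicator {g k<..g (Suc k)} s)"
          unfolding Z'_def sum_indicator_piece[OF g(1) k] using k(2) by (auto simp: r_def indicator_def)
        also have "\<dots> \<le> (\<Sum>j<N. ennreal (r j \<omega>) * (ennreal ((norm (Z s \<omega>))\<^sup>2) * indicator {g j<..g (Suc j)} s))"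
          by (rule member_le_sum) (use k in auto)
        finally show ?thesis .
      next
        case False
        then show ?thesis unfolding Z'_def by (subst sum_indicator_outside) auto
      qed
    qed
    also have "\<dots> = (\<Sum>j<N. ennreal (r j \<omega>) * B j \<omega>)"
      unfolding B_def energy_def
      by (subst nn_integral_sum) (auto intro!: sum.cong nn_integral_cmult)
    finally show ?thesis .
  qed
  have B_le: "B j \<omega> \<le> ennreal \<epsilon>" if "\<omega> \<in> space M" for j \<omega>
  proof -
    have "B j \<omega> \<le> (\<integral>\<^sup>+s. ennreal (K\<^sup>2) * indicator {g j<..g (Suc j)} s \<partial>lborel)"
      unfolding B_def energy_def
      by (intro nn_integral_mono mult_right_mono ennreal_leI power_mono) (use K[OF that] in auto)
    also have "\<dots> = ennreal (K\<^sup>2 * (t / N))"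
      using gS[of j] g(5)[of j] by (subst nn_integral_cmult) (auto simp: ennreal_mult'[symmetric])
    also have "\<dots> \<le> ennreal \<epsilon>"
      using N N0 \<epsilon> by (intro ennreal_leI) (simp add: field_simps)
    finally show ?thesis .
  qed
  have sum_le: "(\<Sum>j<J. ennreal (r j \<omega>) * B j \<omega>) \<le> A J \<omega> \<and> (\<Sum>j<J. ennreal (r j \<omega>) * B j \<omega>) \<le> ennreal (2 * \<epsilon>)"
    if "\<omega> \<in> space M" for J \<omega>
  proof (induction J)
    case (Suc J)
    show ?case
    proof (cases "A J \<omega> \<le> ennreal \<epsilon>")
      case True
      have "(\<Sum>j<J. ennreal (r j \<omega>) * B j \<omega>) + B J \<omega> \<le> ennreal \<epsilon> + ennreal \<epsilon>"
        using Suc True B_le[OF that, of J] by (intro add_mono) auto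
      also have "\<dots> = ennreal (2 * \<epsilon>)" using \<epsilon> by (simp add: ennreal_plus[symmetric] del: ennreal_plus)
      finally show ?thesis using Suc True by (auto simp: r_def A_def intro: add_mono)
    next
      case False
      moreover have "A J \<omega> \<le> A (Suc J) \<omega>" by (simp add: A_def)
      ultimately show ?thesis using Suc by (auto simp: r_def)
    qed
  qed (simp add: A_def)
  have "(\<integral>\<^sup>+\<omega>. ennreal ((norm (I' t \<omega>))\<^sup>2) \<partial>M) = (\<integral>\<^sup>+\<omega>. energy {0..t} Z' \<omega> \<partial>M)"
    by (rule elem_isometry[OF e' t])
  also have "\<dots> \<le> (\<integral>\<^sup>+\<omega>. ennreal (2 * \<epsilon>) \<partial>M)"
    using en sum_le by (intro nn_integral_mono) (meson order_trans)
  also have "\<dots> = ennreal (2 * \<epsilon>)" by (simp add: emeasure_space_1)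
  finally have I'2: "(\<integral>\<^sup>+\<omega>. ennreal ((norm (I' t \<omega>))\<^sup>2) \<partial>M) \<le> ennreal (2 * \<epsilon>)" .
  have I'm: "I' t \<in> borel_measurable M"
    using elem_adapted[OF e' t] adapted_sq_square_integrable square_integrable_measurable by blast
  have eqI: "I' t \<omega> = I t \<omega>" if "energy {0..t} Z \<omega> \<le> ennreal \<epsilon>" for \<omega>
  proof -
    have "A j \<omega> \<le> ennreal \<epsilon>" if "j < N" for j
    proof -
      have "g j \<le> t" using g(1,3) that by (metis less_imp_le monoD)
      then have "A j \<omega> \<le> energy {0..t} Z \<omega>"
        unfolding A_def B_def by (intro energy_split_le) (use g in auto)
      with \<open>energy {0..t} Z \<omega> \<le> ennreal \<epsilon>\<close> show ?thesis by simp
    qed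
    then have "I' t \<omega> = (\<Sum>j<N. I (min t (g (Suc j))) \<omega> - I (min t (g j)) \<omega>)"
      unfolding I'_def by (intro sum.cong) (auto simp: r_def)
    also have "\<dots> = I (min t (g N)) \<omega> - I (min t (g 0)) \<omega>"
      by (rule sum_lessThan_telescope)
    finally show ?thesis using g t elem_at_0[OF Z] by (simp add: min_absorb2)
  qed
  have "emeasure M {\<omega> \<in> space M. \<delta> < norm (I t \<omega>) \<and> energy {0..t} Z \<omega> \<le> ennreal \<epsilon>}
    \<le> emeasure M {\<omega> \<in> space M. \<delta> < norm (I' t \<omega>)}"
    by (rule emeasure_mono) (use I'm eqI in auto)
  also have "\<dots> \<le> ennreal (2 * \<epsilon> / \<delta>\<^sup>2)"
    by (rule emeasure_norm_gt_le[OF I'm \<delta> I'2]) (use \<epsilon> in simp)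
  finally show ?thesis .
qed

lemma simple_process_elem:
  fixes \<xi> :: "nat \<Rightarrow> 'w \<Rightarrow> 'b::euclidean_space"
  assumes "simple_process F m p \<xi>"
  shows "elem (simple_value m p \<xi>) (simple_integral W m p \<xi>)"
    "\<exists>K. \<forall>s. \<forall>\<omega>\<in>space M. norm (simple_value m p \<xi> s \<omega>) \<le> K"
proof -
  have p0: "0 \<le> p 0" and p: "\<And>i. i < m \<Longrightarrow> p i \<le> p (Suc i)" and
    \<xi>: "\<And>i. i < m \<Longrightarrow> \<xi> i \<in> borel_measurable (F (p i))" and
    bd: "\<And>i. i < m \<Longrightarrow> bounded (\<xi> i ` space M)"
    using assms by (auto simp: simple_process_def)
  have p_nonneg: "0 \<le> p i" if "i < m" for i
    using that
  proof (induction i)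
    case (Suc i)
    then show ?case using p[of i] by (auto intro: order_trans)
  qed (simp add: p0)
  have "\<exists>B. \<forall>i<m. \<forall>\<omega>\<in>space M. norm (\<xi> i \<omega>) \<le> B i"
    using bd unfolding bounded_iff by (intro choice_iff[THEN iffD1, rule_format]) auto
  then obtain B where B: "\<And>i \<omega>. i < m \<Longrightarrow> \<omega> \<in> space M \<Longrightarrow> norm (\<xi> i \<omega>) \<le> B i" by blast
  have sq: "adapted_sq (p i) (\<xi> i)" if "i < m" for i
    using \<xi>[OF that] F_measurable[OF \<xi>[OF that]] B[OF that]
      square_integrable_bound[OF square_integrable_const[of "B i"] F_measurable[OF \<xi>[OF that]], of 1]
    by (fastforce simp: adapted_sq_def)
  have "elem (\<lambda>s \<omega>. \<Sum>i<m. indicator {p i<..p (Suc i)} s *\<^sub>R \<xi> i \<omega>)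
    (\<lambda>t \<omega>. \<Sum>i<m. block_integral (p i) (p (Suc i)) (\<xi> i) t \<omega>)"
    by (intro elem_sum elem_single) (use p_nonneg p sq in auto)
  then show "elem (simple_value m p \<xi>) (simple_integral W m p \<xi>)"
    by (simp add: simple_value_def[abs_def] simple_integral_def[abs_def] block_integral_def)
  have "norm (simple_value m p \<xi> s \<omega>) \<le> (\<Sum>i<m. \<bar>B i\<bar>)" if "\<omega> \<in> space M" for s \<omega>
    unfolding simple_value_def
  proof (rule sum_norm_le)
    fix i assume "i \<in> {..<m}"
    then show "norm (indicator {p i<..p (Suc i)} s *\<^sub>R \<xi> i \<omega>) \<le> \<bar>B i\<bar>"
      using B[OF _ that, of i] by (auto simp: indicator_def)
  qed
  then show "\<exists>K. \<forall>s. \<forall>\<omega>\<in>space M. norm (simple_value m p \<xi> s \<omega>) \<le> K" by blast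
qed

end

section \<open>Approximation of left-continuous integrands\<close>

text \<open>Sampling at left endpoints keeps the step process adapted, and makes left-continuity the
  natural condition for convergence.\<close>

definition riemann_step :: "real \<Rightarrow> nat \<Rightarrow> (real \<Rightarrow> 'w \<Rightarrow> 'b::real_vector) \<Rightarrow> real \<Rightarrow> 'w \<Rightarrow> 'b"
  where "riemann_step t N X s \<omega> =
    (\<Sum>j<N. indicator {t * real j / real N<..t * real (Suc j) / real N} s *\<^sub>R X (t * real j / real N) \<omega>)"

lemma mono_grid: "0 \<le> t \<Longrightarrow> mono (\<lambda>j::nat. t * real j / real N)"
  by (auto simp: mono_def intro!: divide_right_mono mult_left_mono)

lemma grid_mem: "0 \<le> t \<Longrightarrow> j \<le> N \<Longrightarrow> t * real j / real N \<in> {0..t}"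
  by (cases "N = 0") (auto simp: field_simps intro: mult_left_mono)

lemma riemann_step_point:
  assumes t: "0 < s" "s \<le> t" and N: "0 < N"
  obtains u where "0 \<le> u" "s - t / real N \<le> u" "u < s" "riemann_step t N X s \<omega> = X u \<omega>"
proof -
  \<comment> \<open>Cells are open on the left, so the cell of \<open>s\<close> is found with a
    ceiling: a grid point belongs to the cell that ends there, and the sampling time stays strictly
    below \<open>s\<close>.\<close>
  define k where "k = nat (\<lceil>s * real N / t\<rceil> - 1)"
  have t0: "0 < t" using t by simp
  have pos: "0 < s * real N / t" using t N by simp
  then have c1: "1 \<le> \<lceil>s * real N / t\<rceil>" by simp
  then have k: "real k = of_int \<lceil>s * real N / t\<rceil> - 1" unfolding k_def by simp
  have 1: "real k < s * real N / t" "s * real N / t \<le> real k + 1" unfolding k by linarith+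
  have "s * real N / t \<le> real N" using t t0 N by (simp add: field_simps)
  with 1 have kN: "k < N" by linarith
  have mem: "s \<in> {t * real k / real N<..t * real (Suc k) / real N}"
    using 1 t0 N by (auto simp: field_simps)
  have "riemann_step t N X s \<omega> = X (t * real k / real N) \<omega>"
    unfolding riemann_step_def
    using sum_indicator_piece[where g="\<lambda>j. t * real j / real N", OF mono_grid kN mem] t0 by simp
  moreover have "s - t / real N \<le> t * real k / real N"
  proof -
    have "s \<le> (t + t * real k) / real N" using mem by (simp add: algebra_simps)
    then show ?thesis by (simp add: add_divide_distrib)
  qed
  ultimately show ?thesis using that[of "t * real k / real N"] mem t0 by auto
qed

lemma riemann_step_0_or_point:
  assumes t: "0 \<le> t"
  shows "riemann_step t N X s \<omega> = 0 \<or> (\<exists>u\<in>{0..t}. riemann_step t N X s \<omega> = X u \<omega>)"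
proof (cases "\<exists>k<N. s \<in> {t * real k / real N<..t * real (Suc k) / real N}")
  case True
  then obtain k where k: "k < N" "s \<in> {t * real k / real N<..t * real (Suc k) / real N}" by auto
  then have "riemann_step t N X s \<omega> = X (t * real k / real N) \<omega>"
    unfolding riemann_step_def
    using sum_indicator_piece[where g="\<lambda>j. t * real j / real N", OF mono_grid k] t by simp
  moreover have "t * real k / real N \<in> {0..t}" using k by (intro grid_mem t) auto
  ultimately show ?thesis by blast
next
  case False
  then show ?thesis unfolding riemann_step_def by (intro disjI1 sum_indicator_outside) auto
qed

lemma riemann_step_tendsto:
  assumes t: "0 < s" "s \<le> t" and lim: "((\<lambda>u. X u \<omega>) \<longlongrightarrow> X s \<omega>) (at_left s)"
  shows "(\<lambda>N. riemann_step t N X s \<omega>) \<longlonglongrightarrow> X s \<omega>"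
proof -
  have "\<exists>u. s - t / real (Suc N) \<le> u \<and> u < s \<and> riemann_step t (Suc N) X s \<omega> = X u \<omega>" for N
    by (rule riemann_step_point[OF t, of "Suc N" X \<omega>]) auto
  then obtain u where u: "\<And>N. s - t / real (Suc N) \<le> u N" "\<And>N. u N < s"
    "\<And>N. riemann_step t (Suc N) X s \<omega> = X (u N) \<omega>" by metis
  have "u \<longlonglongrightarrow> s"
  proof (rule tendsto_sandwich[where f="\<lambda>N. s - t / real (Suc N)" and h="\<lambda>_. s"])
    have "(\<lambda>N. s - t * inverse (real (Suc N))) \<longlonglongrightarrow> s - t * 0"
      by (intro tendsto_intros LIMSEQ_inverse_real_of_nat)
    then show "(\<lambda>N. s - t / real (Suc N)) \<longlonglongrightarrow> s" by (simp add: field_simps)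
  qed (use u in \<open>auto intro!: always_eventually less_imp_le\<close>)
  then have "filterlim u (at_left s) sequentially"
    by (rule tendsto_imp_filterlim_at_left) (use u in auto)
  then have "(\<lambda>N. riemann_step t (Suc N) X s \<omega>) \<longlonglongrightarrow> X s \<omega>"
    unfolding u(3) by (rule filterlim_compose[OF lim])
  then show ?thesis by (rule LIMSEQ_imp_Suc)
qed

lemma riemann_step_measurable:
  assumes "0 \<le> t" "\<And>s. s \<in> {0..t} \<Longrightarrow> X s \<in> borel_measurable M"
  shows "(\<lambda>(s, \<omega>). riemann_step t N X s \<omega> :: 'b::euclidean_space) \<in> borel_measurable (borel \<Otimes>\<^sub>M M)"
proof -
  have "(\<lambda>p. indicator {t * real j / real N<..t * real (Suc j) / real N} (fst p) *\<^sub>R X (t * real j / real N) (snd p))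
    \<in> borel_measurable (borel \<Otimes>\<^sub>M M)" if "j < N" for j
  proof -
    have [measurable]: "X (t * real j / real N) \<in> borel_measurable M" using assms grid_mem[of t j N] that by auto
    show ?thesis by measurable
  qed
  then show ?thesis unfolding riemann_step_def case_prod_unfold by (intro borel_measurable_sum) auto
qed

definition left_continuous_except :: "real set \<Rightarrow> real \<Rightarrow> (real \<Rightarrow> 'b::topological_space) \<Rightarrow> bool"
  where "left_continuous_except S t f \<longleftrightarrow> (\<forall>s\<in>{0<..t} - S. (f \<longlongrightarrow> f s) (at_left s))"

text \<open>Discarding the null set \<open>S\<close>, on which left-continuity may fail, makes the process jointly
  measurable.\<close>

definition off :: "real set \<Rightarrow> real \<Rightarrow> (real \<Rightarrow> 'w \<Rightarrow> 'b::real_vector) \<Rightarrow> real \<Rightarrow> 'w \<Rightarrow> 'b"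
  where "off S t X s \<omega> = indicator ({0<..t} - S) s *\<^sub>R X s \<omega>"

text \<open>Measurability at each single time does not give joint measurability. It comes from
  left-continuity: off \<open>S\<close> the process is the pointwise limit of step processes, each
  of which is a finite sum of products of a function of time and a function of
  \<open>\<omega>\<close>.\<close>

lemma off_measurable:
  fixes X :: "real \<Rightarrow> 'w \<Rightarrow> 'b::euclidean_space" and M :: "'w measure"
  assumes t: "0 \<le> t" and X: "\<And>s. s \<in> {0..t} \<Longrightarrow> X s \<in> borel_measurable M" and S: "S \<in> sets borel"
    and lc: "\<And>\<omega>. \<omega> \<in> space M \<Longrightarrow> left_continuous_except S t (\<lambda>s. X s \<omega>)"
  shows "(\<lambda>(s, \<omega>). off S t X s \<omega>) \<in> borel_measurable (borel \<Otimes>\<^sub>M M)"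
proof (rule borel_measurable_LIMSEQ_metric)
  note [measurable] = riemann_step_measurable[OF t X] S
  show "(\<lambda>(s, \<omega>). indicator ({0<..t} - S) s *\<^sub>R riemann_step t N X s \<omega>) \<in> borel_measurable (borel \<Otimes>\<^sub>M M)" for N
    by measurable
next
  fix p :: "real \<times> 'w" assume "p \<in> space (borel \<Otimes>\<^sub>M M)"
  then obtain s \<omega> where p: "p = (s, \<omega>)" "\<omega> \<in> space M" by (auto simp: space_pair_measure)
  have "(\<lambda>N. indicator ({0<..t} - S) s *\<^sub>R riemann_step t N X s \<omega>) \<longlonglongrightarrow> off S t X s \<omega>"
  proof (cases "s \<in> {0<..t} - S")
    case True
    then have "(\<lambda>N. riemann_step t N X s \<omega>) \<longlonglongrightarrow> X s \<omega>"
      using lc[OF p(2)] by (intro riemann_step_tendsto) (auto simp: left_continuous_except_def)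
    then show ?thesis using True by (simp add: off_def)
  qed (simp add: off_def)
  then show "(\<lambda>N. case p of (s, \<omega>) \<Rightarrow> indicator ({0<..t} - S) s *\<^sub>R riemann_step t N X s \<omega>)
      \<longlonglongrightarrow> (case p of (s, \<omega>) \<Rightarrow> off S t X s \<omega>)"
    by (simp add: p)
qed

definition mean_energy :: "'w measure \<Rightarrow> real set \<Rightarrow> (real \<Rightarrow> 'w \<Rightarrow> 'b::euclidean_space) \<Rightarrow> ennreal"
  where "mean_energy M A Z = (\<integral>\<^sup>+\<omega>. energy A Z \<omega> \<partial>M)"

lemma AE_not_in_finite: "finite S \<Longrightarrow> AE s in lborel. (s::real) \<notin> S"
  by (rule AE_not_in) (rule finite_imp_null_set_lborel)

lemma AE_off: "finite S \<Longrightarrow> AE s in lborel. s \<in> {0..t} \<longrightarrow> off S t X s \<omega> = X s \<omega>"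
proof -
  assume "finite S"
  then have "AE s in lborel. s \<notin> insert 0 S" by (intro AE_not_in_finite) simp
  then show ?thesis by eventually_elim (auto simp: off_def)
qed

lemma energy_AE_cong:
  assumes "AE s in lborel. s \<in> A \<longrightarrow> Z s \<omega> = Z' s \<omega>"
  shows "energy A Z \<omega> = energy A Z' \<omega>"
  unfolding energy_def by (rule nn_integral_cong_AE) (use assms in eventually_elim, auto simp: indicator_def)

lemma energy_Icc_eq: "energy {0..t::real} Z \<omega> = energy {0<..t} Z \<omega>"
  unfolding energy_def
  by (rule nn_integral_cong_AE, use AE_lborel_singleton[of 0] in eventually_elim) (auto simp: indicator_def)

lemma mean_energy_Icc_eq: "mean_energy M {0..t} Z = mean_energy M {0<..t} Z"
  by (simp add: mean_energy_def energy_Icc_eq)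

lemma energy_add_le:
  assumes [measurable]: "(\<lambda>s. Z s \<omega>) \<in> borel_measurable borel" "(\<lambda>s. Z' s \<omega>) \<in> borel_measurable borel" "A \<in> sets borel"
  shows "energy A (\<lambda>s \<omega>. Z s \<omega> + Z' s \<omega>) \<omega> \<le> 2 * energy A Z \<omega> + 2 * energy A Z' \<omega>"
proof -
  have "energy A (\<lambda>s \<omega>. Z s \<omega> + Z' s \<omega>) \<omega> \<le>
    (\<integral>\<^sup>+s. 2 * (ennreal ((norm (Z s \<omega>))\<^sup>2) * indicator A s) + 2 * (ennreal ((norm (Z' s \<omega>))\<^sup>2) * indicator A s) \<partial>lborel)"
    unfolding energy_def
  proof (rule nn_integral_mono)
    fix s
    have "ennreal ((norm (Z s \<omega> + Z' s \<omega>))\<^sup>2) \<le> ennreal (2 * (norm (Z s \<omega>))\<^sup>2 + 2 * (norm (Z' s \<omega>))\<^sup>2)"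
      by (intro ennreal_leI norm_add_square_le)
    also have "\<dots> = 2 * ennreal ((norm (Z s \<omega>))\<^sup>2) + 2 * ennreal ((norm (Z' s \<omega>))\<^sup>2)"
      by (simp add: ennreal_mult')
    finally show "ennreal ((norm (Z s \<omega> + Z' s \<omega>))\<^sup>2) * indicator A s \<le>
      2 * (ennreal ((norm (Z s \<omega>))\<^sup>2) * indicator A s) + 2 * (ennreal ((norm (Z' s \<omega>))\<^sup>2) * indicator A s)"
      by (auto simp: indicator_def)
  qed
  also have "\<dots> = 2 * energy A Z \<omega> + 2 * energy A Z' \<omega>"
    unfolding energy_def by (subst nn_integral_add) (auto simp: nn_integral_cmult)
  finally show ?thesis .
qed

lemma joint_measurable_section:
  "(\<lambda>(s, \<omega>). Z s \<omega>) \<in> borel_measurable (borel \<Otimes>\<^sub>M M) \<Longrightarrow> \<omega> \<in> space M \<Longrightarrow> (\<lambda>s. Z s \<omega>) \<in> borel_measurable borel"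
  using measurable_Pair1[of "\<lambda>(s, \<omega>). Z s \<omega>" borel M borel \<omega>] by simp

lemma mean_energy_add_le:
  assumes Z: "(\<lambda>(s, \<omega>). Z s \<omega>) \<in> borel_measurable (borel \<Otimes>\<^sub>M M)" "(\<lambda>(s, \<omega>). Z' s \<omega>) \<in> borel_measurable (borel \<Otimes>\<^sub>M M)"
    and A: "A \<in> sets borel"
  shows "mean_energy M A (\<lambda>s \<omega>. Z s \<omega> + Z' s \<omega>) \<le> 2 * mean_energy M A Z + 2 * mean_energy M A Z'"
proof -
  note [measurable] = energy_measurable[OF Z(1) A] energy_measurable[OF Z(2) A]
  have "mean_energy M A (\<lambda>s \<omega>. Z s \<omega> + Z' s \<omega>) \<le> (\<integral>\<^sup>+\<omega>. 2 * energy A Z \<omega> + 2 * energy A Z' \<omega> \<partial>M)"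
    unfolding mean_energy_def
    by (intro nn_integral_mono energy_add_le joint_measurable_section[OF Z(1)] joint_measurable_section[OF Z(2)] A)
  also have "\<dots> = 2 * mean_energy M A Z + 2 * mean_energy M A Z'"
    unfolding mean_energy_def by (subst nn_integral_add) (auto simp: nn_integral_cmult)
  finally show ?thesis .
qed

lemma borel_lborel_pair: "borel_measurable (lborel \<Otimes>\<^sub>M M) = borel_measurable (borel \<Otimes>\<^sub>M M)"
  by (rule measurable_cong_sets[OF sets_pair_measure_cong[OF sets_lborel refl] refl])

lemma (in prob_space) mean_energy_Tonelli:
  assumes Z[unfolded borel_lborel_pair[symmetric], measurable]: "(\<lambda>(s, \<omega>). Z s \<omega>) \<in> borel_measurable (borel \<Otimes>\<^sub>M M)"
    and [measurable]: "A \<in> sets borel"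
  shows "mean_energy M A Z = (\<integral>\<^sup>+s\<in>A. (\<integral>\<^sup>+\<omega>. ennreal ((norm (Z s \<omega>))\<^sup>2) \<partial>M) \<partial>lborel)"
proof -
  interpret P: pair_sigma_finite lborel M ..
  have "mean_energy M A Z = (\<integral>\<^sup>+s. (\<integral>\<^sup>+\<omega>. ennreal ((norm (Z s \<omega>))\<^sup>2) * indicator A s \<partial>M) \<partial>lborel)"
    unfolding mean_energy_def energy_def
    by (rule P.Fubini'[of "\<lambda>s \<omega>. ennreal ((norm (Z s \<omega>))\<^sup>2) * indicator A s"]) measurable
  also have "\<dots> = (\<integral>\<^sup>+s\<in>A. (\<integral>\<^sup>+\<omega>. ennreal ((norm (Z s \<omega>))\<^sup>2) \<partial>M) \<partial>lborel)"
    by (intro nn_integral_cong) (auto simp: indicator_def)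
  finally show ?thesis .
qed

text \<open>Dominated convergence on the product of time and probability space. The dominating
  function is given through its iterated integral, the form in which it can be estimated.\<close>

lemma (in prob_space) mean_energy_tendsto_0:
  fixes U :: "nat \<Rightarrow> real \<Rightarrow> 'a \<Rightarrow> 'b::euclidean_space" and D :: "real \<Rightarrow> 'a \<Rightarrow> ennreal"
  assumes U[unfolded borel_lborel_pair[symmetric], measurable]: "\<And>N. (\<lambda>(s, \<omega>). U N s \<omega>) \<in> borel_measurable (borel \<Otimes>\<^sub>M M)"
    and D[unfolded borel_lborel_pair[symmetric], measurable]: "(\<lambda>(s, \<omega>). D s \<omega>) \<in> borel_measurable (borel \<Otimes>\<^sub>M M)"
    and [measurable]: "A \<in> sets borel"
    and fin: "(\<integral>\<^sup>+\<omega>. (\<integral>\<^sup>+s\<in>A. D s \<omega> \<partial>lborel) \<partial>M) < \<infinity>"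
    and lim: "\<And>s \<omega>. s \<in> A \<Longrightarrow> \<omega> \<in> space M \<Longrightarrow> (\<lambda>N. U N s \<omega>) \<longlonglongrightarrow> 0"
    and le: "\<And>N s \<omega>. s \<in> A \<Longrightarrow> \<omega> \<in> space M \<Longrightarrow> ennreal ((norm (U N s \<omega>))\<^sup>2) \<le> D s \<omega>"
  shows "(\<lambda>N. mean_energy M A (U N)) \<longlonglongrightarrow> 0"
proof -
  interpret P: pair_sigma_finite lborel M ..
  let ?u = "\<lambda>N p. ennreal ((norm (U N (fst p) (snd p)))\<^sup>2) * indicator A (fst p)"
  have eq: "mean_energy M A (U N) = (\<integral>\<^sup>+p. ?u N p \<partial>(lborel \<Otimes>\<^sub>M M))" for N
    unfolding mean_energy_def energy_def by (subst P.nn_integral_snd[symmetric]) auto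
  have "(\<lambda>N. \<integral>\<^sup>+p. ?u N p \<partial>(lborel \<Otimes>\<^sub>M M)) \<longlonglongrightarrow> (\<integral>\<^sup>+p. 0 \<partial>((lborel :: real measure) \<Otimes>\<^sub>M M))"
  proof (rule nn_integral_dominated_convergence[where u="?u" and u'="\<lambda>_. 0" and w="\<lambda>p. D (fst p) (snd p) * indicator A (fst p)"])
    show "(\<integral>\<^sup>+p. D (fst p) (snd p) * indicator A (fst p) \<partial>(lborel \<Otimes>\<^sub>M M)) < \<infinity>"
      using fin by (subst P.nn_integral_snd[symmetric]) auto
    show "AE p in lborel \<Otimes>\<^sub>M M. ?u N p \<le> D (fst p) (snd p) * indicator A (fst p)" for N
      by (rule AE_I2) (auto simp: space_pair_measure indicator_def le)
    show "AE p in lborel \<Otimes>\<^sub>M M. (\<lambda>N. ?u N p) \<longlonglongrightarrow> 0"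
    proof (rule AE_I2)
      fix p :: "real \<times> 'a" assume "p \<in> space (lborel \<Otimes>\<^sub>M M)"
      then have "snd p \<in> space M" by (auto simp: space_pair_measure)
      have "(\<lambda>N. ennreal ((norm (U N (fst p) (snd p)))\<^sup>2)) \<longlonglongrightarrow> ennreal ((norm (0::'b))\<^sup>2)" if "fst p \<in> A"
        by (intro tendsto_intros lim that \<open>snd p \<in> space M\<close>)
      then show "(\<lambda>N. ?u N p) \<longlonglongrightarrow> 0" by (auto simp: indicator_def)
    qed
  qed auto
  then show ?thesis by (simp add: eq)
qed

context wiener_process
begin

lemma riemann_energy_tendsto:
  fixes X :: "real \<Rightarrow> 'w \<Rightarrow> 'b::euclidean_space"
  assumes t: "0 \<le> t" and X: "\<And>s. s \<in> {0..t} \<Longrightarrow> X s \<in> borel_measurable M" and S: "finite S"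
    and lc: "\<And>\<omega>. \<omega> \<in> space M \<Longrightarrow> left_continuous_except S t (\<lambda>s. X s \<omega>)"
    and C: "\<And>s \<omega>. s \<in> {0..t} \<Longrightarrow> \<omega> \<in> space M \<Longrightarrow> norm (X s \<omega>) \<le> C" "0 \<le> C"
  shows "(\<lambda>N. mean_energy M {0..t} (\<lambda>s \<omega>. riemann_step t N X s \<omega> - off S t X s \<omega>)) \<longlonglongrightarrow> 0"
proof -
  have [measurable]: "S \<in> sets borel" using S by (simp add: finite_imp_closed borel_closed)
  note [measurable] = riemann_step_measurable[OF t X] off_measurable[OF t X \<open>S \<in> sets borel\<close> lc]
  \<comment> \<open>The indicator removes the times at which the steps need not converge; they form
    a null set, so the mean energy does not change.\<close>
  let ?U = "\<lambda>N s \<omega>. indicator ({0<..t} - S) s *\<^sub>R (riemann_step t N X s \<omega> - off S t X s \<omega>)"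
  have rb: "norm (riemann_step t N X s \<omega>) \<le> C" if "\<omega> \<in> space M" for N s \<omega>
    using riemann_step_0_or_point[OF t, of N X s \<omega>] C that by auto
  have "(\<lambda>N. mean_energy M {0..t} (?U N)) \<longlonglongrightarrow> 0"
  proof (rule mean_energy_tendsto_0[where D="\<lambda>s \<omega>. ennreal ((2 * C)\<^sup>2)"])
    show "(\<lambda>(s, \<omega>). ?U N s \<omega>) \<in> borel_measurable (borel \<Otimes>\<^sub>M M)" for N by measurable
    show "(\<integral>\<^sup>+\<omega>. (\<integral>\<^sup>+s\<in>{0..t}. ennreal ((2 * C)\<^sup>2) \<partial>lborel) \<partial>M) < \<infinity>"
      using t by (simp add: nn_integral_cmult ennreal_mult[symmetric] emeasure_space_1 del: ennreal_mult)
  next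
    fix s \<omega> assume s: "s \<in> {0..t}" and \<omega>: "\<omega> \<in> space M"
    show "(\<lambda>N. ?U N s \<omega>) \<longlonglongrightarrow> 0"
    proof (cases "s \<in> {0<..t} - S")
      case True
      then have "(\<lambda>N. riemann_step t N X s \<omega>) \<longlonglongrightarrow> X s \<omega>"
        using lc[OF \<omega>] by (intro riemann_step_tendsto) (auto simp: left_continuous_except_def)
      then have "(\<lambda>N. riemann_step t N X s \<omega> - X s \<omega>) \<longlonglongrightarrow> X s \<omega> - X s \<omega>" by (intro tendsto_intros)
      then show ?thesis using True by (simp add: off_def)
    qed simp
    fix N
    have "norm (?U N s \<omega>) \<le> 2 * C"
      using norm_triangle_ineq4[of "riemann_step t N X s \<omega>" "X s \<omega>"] rb[OF \<omega>, of N s] C(1)[OF s \<omega>] C(2)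
      by (auto simp: off_def indicator_def)
    then show "ennreal ((norm (?U N s \<omega>))\<^sup>2) \<le> ennreal ((2 * C)\<^sup>2)"
      by (intro ennreal_leI power_mono) auto
  qed auto
  moreover have "mean_energy M {0..t} (?U N) =
    mean_energy M {0..t} (\<lambda>s \<omega>. riemann_step t N X s \<omega> - off S t X s \<omega>)" for N
    unfolding mean_energy_def
  proof (intro nn_integral_cong energy_AE_cong)
    fix \<omega>
    have "AE s in lborel. s \<notin> insert 0 S" by (rule AE_not_in_finite) (use S in simp)
    then show "AE s in lborel. s \<in> {0..t} \<longrightarrow> ?U N s \<omega> = riemann_step t N X s \<omega> - off S t X s \<omega>"
      by eventually_elim auto
  qed
  ultimately show ?thesis by simp
qed

lemma elem_riemann_step:
  assumes "0 \<le> t" "\<And>s. s \<in> {0..t} \<Longrightarrow> adapted_sq s (X s)"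
  shows "\<exists>I. elem (riemann_step t N X) I"
proof -
  have "elem (\<lambda>s \<omega>. \<Sum>j<N. indicator {t * real j / real N<..t * real (Suc j) / real N} s *\<^sub>R X (t * real j / real N) \<omega>)
    (\<lambda>u \<omega>. \<Sum>j<N. block_integral (t * real j / real N) (t * real (Suc j) / real N) (X (t * real j / real N)) u \<omega>)"
    using grid_mem[OF assms(1)] assms
    by (intro elem_sum elem_single assms(2)) (auto intro!: divide_right_mono mult_left_mono)
  then show ?thesis unfolding riemann_step_def[abs_def] by blast
qed

lemma elem_mean_energy:
  "elem Z I \<Longrightarrow> 0 \<le> t \<Longrightarrow> (\<integral>\<^sup>+\<omega>. ennreal ((norm (I t \<omega>))\<^sup>2) \<partial>M) = mean_energy M {0..t} Z"
  by (simp add: elem_isometry mean_energy_def)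

text \<open>Cutting at 1 turns convergence in probability into convergence in mean, which has an
  almost surely convergent subsequence; a limit 0 lies below the cut, so the cut has no effect in
  the end.\<close>

lemma AE_subsequence:
  fixes f :: "nat \<Rightarrow> 'w \<Rightarrow> real"
  assumes [measurable]: "\<And>k. f k \<in> borel_measurable M" and nn: "\<And>k \<omega>. 0 \<le> f k \<omega>"
    and lim: "\<And>\<delta>. 0 < \<delta> \<Longrightarrow> (\<lambda>k. emeasure M {\<omega> \<in> space M. \<delta> < f k \<omega>}) \<longlonglongrightarrow> 0"
  obtains r :: "nat \<Rightarrow> nat" where "strict_mono r" "AE \<omega> in M. (\<lambda>k. f (r k) \<omega>) \<longlonglongrightarrow> 0"
proof -
  let ?g = "\<lambda>k \<omega>. min 1 (f k \<omega>)"
  have int: "integrable M (?g k)" for k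
    by (rule integrable_const_bound[where B=1]) (auto simp: nn)
  have "(\<lambda>k. \<integral>\<omega>. norm (?g k \<omega>) \<partial>M) \<longlonglongrightarrow> 0"
  proof (rule LIMSEQ_I)
    fix e :: real assume e: "0 < e"
    from lim[of "e/2"] e have "(\<lambda>k. emeasure M {\<omega> \<in> space M. e/2 < f k \<omega>}) \<longlonglongrightarrow> 0" by simp
    then have "\<forall>\<^sub>F k in sequentially. emeasure M {\<omega> \<in> space M. e/2 < f k \<omega>} < ennreal (e/2)"
      by (rule order_tendstoD) (use e in auto)
    then obtain k0 where k0: "\<And>k. k0 \<le> k \<Longrightarrow> emeasure M {\<omega> \<in> space M. e/2 < f k \<omega>} < ennreal (e/2)"
      by (auto simp: eventually_sequentially)
    have "norm ((\<integral>\<omega>. norm (?g k \<omega>) \<partial>M) - 0) < e" if "k0 \<le> k" for k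
    proof -
      let ?E = "{\<omega> \<in> space M. e/2 < f k \<omega>}"
      have "prob ?E < e/2"
        using k0[OF that] e by (simp add: emeasure_eq_measure ennreal_less_iff)
      have intE: "integrable M (\<lambda>\<omega>. e/2 + indicator ?E \<omega>)"
        by (intro Bochner_Integration.integrable_add integrable_real_indicator) (auto simp: less_top[symmetric])
      have "(\<integral>\<omega>. norm (?g k \<omega>) \<partial>M) \<le> (\<integral>\<omega>. e/2 + indicator ?E \<omega> \<partial>M)"
        using e nn[of k] by (intro integral_mono intE) (auto simp: int indicator_def)
      also have "\<dots> = e/2 + prob ?E" by (simp add: prob_space less_top[symmetric])
      also have "\<dots> < e" using \<open>prob ?E < e/2\<close> by simp
      finally show ?thesis by (simp add: nn)
    qed
    then show "\<exists>k0. \<forall>k\<ge>k0. norm ((\<integral>\<omega>. norm (?g k \<omega>) \<partial>M) - 0) < e" by blast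
  qed
  from tendsto_L1_AE_subseq[OF int this] obtain r where r: "strict_mono r" "AE \<omega> in M. (\<lambda>k. ?g (r k) \<omega>) \<longlonglongrightarrow> 0"
    by blast
  have "AE \<omega> in M. (\<lambda>k. f (r k) \<omega>) \<longlonglongrightarrow> 0"
    using r(2)
  proof eventually_elim
    case (elim \<omega>)
    have "\<forall>\<^sub>F k in sequentially. ?g (r k) \<omega> < 1" using elim by (rule order_tendstoD) simp
    then have "\<forall>\<^sub>F k in sequentially. ?g (r k) \<omega> = f (r k) \<omega>" by eventually_elim auto
    then show ?case using elim by (rule Lim_transform_eventually[rotated])
  qed
  with r(1) show ?thesis by (rule that)
qed

end


section \<open>Comparison with the Ito integral\<close>

context wiener_process
begin

text \<open>The simple processes behind \<open>has_ito_integral\<close> are merely known to exist,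
  so a convenient approximation \<open>Z\<close> has to be compared with them. Their difference is
  again elementary and has small energy with high probability on \<open>A\<close>, and
  \<open>elem_truncation\<close> passes this on to the integrals. Since only probabilities are
  involved, \<open>Xc\<close> has to agree with \<open>X\<close> on the event \<open>A\<close>
  alone; this is how the integral is localised.\<close>

lemma ito_integral_in_probability:
  fixes X Xc :: "real \<Rightarrow> 'w \<Rightarrow> 'b::euclidean_space"
  assumes ito: "has_ito_integral M F W X t J" and t: "0 \<le> t" and A[measurable]: "A \<in> sets M"
    and Xc: "(\<lambda>(s, \<omega>). Xc s \<omega>) \<in> borel_measurable (borel \<Otimes>\<^sub>M M)"
    and eq: "\<And>\<omega>. \<omega> \<in> A \<Longrightarrow> AE s in lborel. s \<in> {0..t} \<longrightarrow> Xc s \<omega> = X s \<omega>"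
    and Z: "\<And>k. elem (Z k) (I k)" and Zb: "\<And>k s \<omega>. \<omega> \<in> space M \<Longrightarrow> norm (Z k s \<omega>) \<le> K k"
    and lim: "(\<lambda>k. mean_energy M {0..t} (\<lambda>s \<omega>. Z k s \<omega> - Xc s \<omega>)) \<longlonglongrightarrow> 0"
    and \<delta>: "0 < \<delta>"
  shows "(\<lambda>k. emeasure M {\<omega> \<in> space M. \<delta> < indicator A \<omega> * norm (I k t \<omega> - J \<omega>)}) \<longlonglongrightarrow> 0"
proof -
  obtain m p \<xi> where J[measurable]: "J \<in> borel_measurable M"
    and sp: "\<And>k. simple_process F (m k) (p k) (\<xi> k)"
    and n1: "null_in_prob M (\<lambda>k \<omega>. energy {0..t} (\<lambda>s \<omega>. simple_value (m k) (p k) (\<xi> k) s \<omega> - X s \<omega>) \<omega>)"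
    and n2: "null_in_prob M (\<lambda>k \<omega>. ennreal (norm (simple_integral W (m k) (p k) (\<xi> k) t \<omega> - J \<omega>)))"
    using ito unfolding has_ito_integral_def energy_def by blast
  define Y where "Y k = simple_value (m k) (p k) (\<xi> k)" for k
  define Q where "Q k = simple_integral W (m k) (p k) (\<xi> k)" for k
  have Y: "elem (Y k) (Q k)" for k unfolding Y_def Q_def by (rule simple_process_elem[OF sp])
  obtain B where B: "\<And>k s \<omega>. \<omega> \<in> space M \<Longrightarrow> norm (Y k s \<omega>) \<le> B k"
    using simple_process_elem(2)[OF sp] unfolding Y_def by metis
  have [measurable]: "I k t \<in> borel_measurable M" "Q k t \<in> borel_measurable M" for k
    using elem_adapted[OF Z t] elem_adapted[OF Y t] adapted_sq_square_integrable square_integrable_measurable by blast+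
  define eZ where "eZ k = energy {0..t} (\<lambda>s \<omega>. Z k s \<omega> - Xc s \<omega>)" for k
  define eY where "eY k = energy {0..t} (\<lambda>s \<omega>. Y k s \<omega> - X s \<omega>)" for k
  have [measurable]: "eZ k \<in> borel_measurable M" for k
    unfolding eZ_def using elem_joint_measurable[OF Z, of k] Xc
    by (intro energy_measurable) (auto simp: case_prod_unfold)
  have [measurable]: "eY k \<in> borel_measurable M" for k
    using n1 unfolding eY_def null_in_prob_def Y_def by auto
  show ?thesis
  proof (rule tendsto_zero_ennreal)
    fix \<eta> :: real assume \<eta>: "0 < \<eta>"
    \<comment> \<open>Chosen such that \<open>elem_truncation\<close> with threshold
      \<open>\<delta>/2\<close> gives exactly \<open>\<eta>/4\<close>.\<close>
    define \<epsilon> where "\<epsilon> = \<eta> * \<delta>\<^sup>2 / 32"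
    have \<epsilon>: "0 < \<epsilon>" using \<eta> \<delta> by (simp add: \<epsilon>_def)
    have le: "emeasure M {\<omega> \<in> space M. \<delta> < indicator A \<omega> * norm (I k t \<omega> - J \<omega>)} \<le>
      ennreal (\<eta> / 4) + emeasure M {\<omega> \<in> space M. ennreal (\<epsilon>/4) < eZ k \<omega>} +
      emeasure M {\<omega> \<in> space M. ennreal (\<epsilon>/4) < eY k \<omega>} +
      emeasure M {\<omega> \<in> space M. ennreal (\<delta>/2) < ennreal (norm (Q k t \<omega> - J \<omega>))}" (is "_ \<le> _ + emeasure M ?B + emeasure M ?C + emeasure M ?D") for k
    proof -
      let ?A = "{\<omega> \<in> space M. \<delta>/2 < norm (I k t \<omega> - Q k t \<omega>) \<and> energy {0..t} (\<lambda>s \<omega>. Z k s \<omega> - Y k s \<omega>) \<omega> \<le> ennreal \<epsilon>}"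
      have el: "elem (\<lambda>s \<omega>. Z k s \<omega> - Y k s \<omega>) (\<lambda>t \<omega>. I k t \<omega> - Q k t \<omega>)"
        by (rule elem_diff[OF Z Y])
      have [measurable]: "energy {0..t} (\<lambda>s \<omega>. Z k s \<omega> - Y k s \<omega>) \<in> borel_measurable M"
        using elem_joint_measurable[OF el] by (intro energy_measurable) auto
      have "emeasure M ?A \<le> ennreal (2 * \<epsilon> / (\<delta>/2)\<^sup>2)"
      proof (rule elem_truncation[OF el _ t \<epsilon>])
        fix s \<omega> assume "\<omega> \<in> space M"
        then show "norm (Z k s \<omega> - Y k s \<omega>) \<le> K k + B k"
          using norm_triangle_ineq4[of "Z k s \<omega>" "Y k s \<omega>"] Zb[of \<omega> k s] B[of \<omega> k s] by simp
      qed (use \<delta> in simp)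
      also have "2 * \<epsilon> / (\<delta>/2)\<^sup>2 = \<eta> / 4" using \<delta> by (simp add: \<epsilon>_def field_simps power2_eq_square)
      finally have PA: "emeasure M ?A \<le> ennreal (\<eta> / 4)" .
      \<comment> \<open>A deviation above \<open>\<delta>\<close> on \<open>A\<close> has one of
        four causes: \<open>Q k t\<close> is far from \<open>J\<close>, one of the two energies
        exceeds \<open>\<epsilon>/4\<close>, or the elementary integrals are far apart although the
        energy of their difference is small. The quarters are due to \<open>energy_add_le\<close>,
        which doubles both energies.\<close>
      have sub: "{\<omega> \<in> space M. \<delta> < indicator A \<omega> * norm (I k t \<omega> - J \<omega>)} \<subseteq> ?A \<union> ?B \<union> ?C \<union> ?D"
      proof (rule subsetI, rule ccontr)
        fix \<omega> assume w: "\<omega> \<in> {\<omega> \<in> space M. \<delta> < indicator A \<omega> * norm (I k t \<omega> - J \<omega>)}"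
          and nw: "\<omega> \<notin> ?A \<union> ?B \<union> ?C \<union> ?D"
        from w \<delta> have \<omega>: "\<omega> \<in> space M" "\<omega> \<in> A" and d: "\<delta> < norm (I k t \<omega> - J \<omega>)"
          by (cases "\<omega> \<in> A"; simp)+
        have q: "norm (Q k t \<omega> - J \<omega>) \<le> \<delta>/2" using nw \<omega> \<delta> by (auto simp: ennreal_less_iff)
        have "I k t \<omega> - J \<omega> = (I k t \<omega> - Q k t \<omega>) + (Q k t \<omega> - J \<omega>)" by simp
        then have "norm (I k t \<omega> - J \<omega>) \<le> norm (I k t \<omega> - Q k t \<omega>) + norm (Q k t \<omega> - J \<omega>)"
          by (metis norm_triangle_ineq)
        with d q have d2: "\<delta>/2 < norm (I k t \<omega> - Q k t \<omega>)" by simp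
        note [measurable] = joint_measurable_section[OF Xc \<omega>(1)]
        have [measurable]: "(\<lambda>s. Z k s \<omega>) \<in> borel_measurable borel" "(\<lambda>s. Y k s \<omega>) \<in> borel_measurable borel"
          using elem_path[OF Z] elem_path[OF Y] by blast+
        have "energy {0..t} (\<lambda>s \<omega>. Xc s \<omega> - Y k s \<omega>) \<omega> = eY k \<omega>"
          unfolding eY_def energy_def
          by (intro nn_integral_cong_AE, use eq[OF \<omega>(2)] in eventually_elim)
            (auto simp: indicator_def norm_minus_commute)
        then have e2: "energy {0..t} (\<lambda>s \<omega>. Xc s \<omega> - Y k s \<omega>) \<omega> \<le> ennreal (\<epsilon>/4)"
          using nw \<omega> by (auto simp: not_less)
        have e1: "energy {0..t} (\<lambda>s \<omega>. Z k s \<omega> - Xc s \<omega>) \<omega> \<le> ennreal (\<epsilon>/4)"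
          using nw \<omega> by (auto simp: not_less eZ_def)
        have "energy {0..t} (\<lambda>s \<omega>. (Z k s \<omega> - Xc s \<omega>) + (Xc s \<omega> - Y k s \<omega>)) \<omega> \<le>
          2 * energy {0..t} (\<lambda>s \<omega>. Z k s \<omega> - Xc s \<omega>) \<omega> + 2 * energy {0..t} (\<lambda>s \<omega>. Xc s \<omega> - Y k s \<omega>) \<omega>"
          by (rule energy_add_le) measurable
        also have "\<dots> \<le> 2 * ennreal (\<epsilon>/4) + 2 * ennreal (\<epsilon>/4)"
          by (intro add_mono mult_left_mono e1 e2) auto
        also have "\<dots> = ennreal \<epsilon>"
        proof -
          have "2 * ennreal (\<epsilon>/4) = ennreal (\<epsilon>/2)" using ennreal_mult'[of 2 "\<epsilon>/4"] by simp
          then show ?thesis using \<epsilon> by (simp add: ennreal_plus[symmetric] del: ennreal_plus)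
        qed
        finally have "energy {0..t} (\<lambda>s \<omega>. Z k s \<omega> - Y k s \<omega>) \<omega> \<le> ennreal \<epsilon>" by simp
        with d2 \<omega> nw show False by auto
      qed
      have "emeasure M {\<omega> \<in> space M. \<delta> < indicator A \<omega> * norm (I k t \<omega> - J \<omega>)} \<le> emeasure M (?A \<union> ?B \<union> ?C \<union> ?D)"
        by (rule emeasure_mono[OF sub]) measurable
      also have "\<dots> \<le> emeasure M ?A + emeasure M ?B + emeasure M ?C + emeasure M ?D"
        by (intro order_trans[OF emeasure_subadditive] add_mono order_refl; measurable)
      also have "\<dots> \<le> ennreal (\<eta>/4) + emeasure M ?B + emeasure M ?C + emeasure M ?D"
        by (intro add_mono PA order_refl)
      finally show ?thesis .
    qed
    \<comment> \<open>Markov's inequality turns convergence of the mean energy into convergence in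
      probability.\<close>
    have l1: "(\<lambda>k. emeasure M {\<omega> \<in> space M. ennreal (\<epsilon>/4) < eZ k \<omega>}) \<longlonglongrightarrow> 0"
    proof (rule tendsto_sandwich[where f="\<lambda>_. 0" and h="\<lambda>k. ennreal (4/\<epsilon>) * mean_energy M {0..t} (\<lambda>s \<omega>. Z k s \<omega> - Xc s \<omega>)"])
      have "(\<lambda>k. ennreal (4/\<epsilon>) * mean_energy M {0..t} (\<lambda>s \<omega>. Z k s \<omega> - Xc s \<omega>)) \<longlonglongrightarrow> ennreal (4/\<epsilon>) * 0"
        by (rule ennreal_tendsto_cmult[OF _ lim]) simp
      then show "(\<lambda>k. ennreal (4/\<epsilon>) * mean_energy M {0..t} (\<lambda>s \<omega>. Z k s \<omega> - Xc s \<omega>)) \<longlonglongrightarrow> 0" by simp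
      have "emeasure M {\<omega> \<in> space M. ennreal (\<epsilon>/4) < eZ k \<omega>} \<le> ennreal (4/\<epsilon>) * mean_energy M {0..t} (\<lambda>s \<omega>. Z k s \<omega> - Xc s \<omega>)" for k
      proof -
        have "emeasure M {\<omega> \<in> space M. ennreal (\<epsilon>/4) < eZ k \<omega>} = (\<integral>\<^sup>+\<omega>. indicator {\<omega> \<in> space M. ennreal (\<epsilon>/4) < eZ k \<omega>} \<omega> \<partial>M)"
          by (rule nn_integral_indicator[symmetric]) measurable
        also have "\<dots> \<le> (\<integral>\<^sup>+\<omega>. ennreal (4/\<epsilon>) * eZ k \<omega> \<partial>M)"
        proof (rule nn_integral_mono)
          fix \<omega>
          have "1 = ennreal (4/\<epsilon>) * ennreal (\<epsilon>/4)" using \<epsilon> by (simp add: ennreal_mult'[symmetric])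
          then have "1 \<le> ennreal (4/\<epsilon>) * eZ k \<omega>" if "ennreal (\<epsilon>/4) < eZ k \<omega>"
            using mult_left_mono[OF less_imp_le[OF that], of "ennreal (4/\<epsilon>)"] by simp
          then show "indicator {\<omega> \<in> space M. ennreal (\<epsilon>/4) < eZ k \<omega>} \<omega> \<le> ennreal (4/\<epsilon>) * eZ k \<omega>"
            by (auto simp: indicator_def)
        qed
        also have "\<dots> = ennreal (4/\<epsilon>) * mean_energy M {0..t} (\<lambda>s \<omega>. Z k s \<omega> - Xc s \<omega>)"
          unfolding mean_energy_def eZ_def[symmetric] by (rule nn_integral_cmult) measurable
        finally show ?thesis .
      qed
      then show "\<forall>\<^sub>F k in sequentially. emeasure M {\<omega> \<in> space M. ennreal (\<epsilon>/4) < eZ k \<omega>} \<le>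
        ennreal (4/\<epsilon>) * mean_energy M {0..t} (\<lambda>s \<omega>. Z k s \<omega> - Xc s \<omega>)" by simp
    qed auto
    have l2: "(\<lambda>k. emeasure M {\<omega> \<in> space M. ennreal (\<epsilon>/4) < eY k \<omega>}) \<longlonglongrightarrow> 0"
      using n1 \<epsilon> unfolding null_in_prob_def eY_def Y_def by simp
    have l3: "(\<lambda>k. emeasure M {\<omega> \<in> space M. ennreal (\<delta>/2) < ennreal (norm (Q k t \<omega> - J \<omega>))}) \<longlonglongrightarrow> 0"
      using n2 \<delta> unfolding null_in_prob_def Q_def by simp
    have "(\<lambda>k. ennreal (\<eta> / 4) + emeasure M {\<omega> \<in> space M. ennreal (\<epsilon>/4) < eZ k \<omega>} +
      emeasure M {\<omega> \<in> space M. ennreal (\<epsilon>/4) < eY k \<omega>} +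
      emeasure M {\<omega> \<in> space M. ennreal (\<delta>/2) < ennreal (norm (Q k t \<omega> - J \<omega>))}) \<longlonglongrightarrow> ennreal (\<eta>/4) + 0 + 0 + 0"
      by (intro tendsto_add tendsto_const l1 l2 l3)
    then have "\<forall>\<^sub>F k in sequentially. ennreal (\<eta> / 4) + emeasure M {\<omega> \<in> space M. ennreal (\<epsilon>/4) < eZ k \<omega>} +
      emeasure M {\<omega> \<in> space M. ennreal (\<epsilon>/4) < eY k \<omega>} +
      emeasure M {\<omega> \<in> space M. ennreal (\<delta>/2) < ennreal (norm (Q k t \<omega> - J \<omega>))} < ennreal \<eta>"
      by (rule order_tendstoD) (use \<eta> in \<open>simp add: ennreal_less_iff\<close>)
    then show "\<forall>\<^sub>F k in sequentially. emeasure M {\<omega> \<in> space M. \<delta> < indicator A \<omega> * norm (I k t \<omega> - J \<omega>)} < ennreal \<eta>"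
      by eventually_elim (rule le_less_trans[OF le])
  qed
qed

text \<open>The constants in this and the following estimates are not sharp.\<close>

lemma ito_integral_estimate:
  fixes X Xc :: "real \<Rightarrow> 'w \<Rightarrow> 'b::euclidean_space"
  assumes ito: "has_ito_integral M F W X t J" and t: "0 \<le> t" and A[measurable]: "A \<in> sets M"
    and Xc: "(\<lambda>(s, \<omega>). Xc s \<omega>) \<in> borel_measurable (borel \<Otimes>\<^sub>M M)"
    and eq: "\<And>\<omega>. \<omega> \<in> A \<Longrightarrow> AE s in lborel. s \<in> {0..t} \<longrightarrow> Xc s \<omega> = X s \<omega>"
    and Z: "\<And>k. elem (Z k) (I k)" and Zb: "\<And>k s \<omega>. \<omega> \<in> space M \<Longrightarrow> norm (Z k s \<omega>) \<le> K k"
    and lim: "(\<lambda>k. mean_energy M {0..t} (\<lambda>s \<omega>. Z k s \<omega> - Xc s \<omega>)) \<longlonglongrightarrow> 0"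
    and Z0: "elem Z0 I0"
  shows "(\<integral>\<^sup>+\<omega>\<in>A. ennreal ((norm (J \<omega> - I0 t \<omega>))\<^sup>2) \<partial>M) \<le> 2 * mean_energy M {0..t} (\<lambda>s \<omega>. Xc s \<omega> - Z0 s \<omega>)"
proof -
  have [measurable]: "J \<in> borel_measurable M" using ito unfolding has_ito_integral_def by blast
  have [measurable]: "I k t \<in> borel_measurable M" "I0 t \<in> borel_measurable M" for k
    using elem_adapted[OF Z t] elem_adapted[OF Z0 t] adapted_sq_square_integrable square_integrable_measurable by blast+
  note prob0 = ito_integral_in_probability[OF ito t A Xc eq Z Zb lim]
  \<comment> \<open>\<open>J\<close> is approximated in probability only. Along an almost surely
    convergent subsequence Fatou's lemma transfers the isometry bound, so square integrability of
    \<open>J\<close> on \<open>A\<close> is a result and not a premise.\<close>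
  obtain r :: "nat \<Rightarrow> nat" where r: "strict_mono r"
    "AE \<omega> in M. (\<lambda>k. indicator A \<omega> * norm (I (r k) t \<omega> - J \<omega>)) \<longlonglongrightarrow> 0"
    by (rule AE_subsequence[of "\<lambda>k \<omega>. indicator A \<omega> * norm (I k t \<omega> - J \<omega>)"]) (use prob0 in auto)
  let ?u = "\<lambda>k \<omega>. ennreal ((norm (I (r k) t \<omega> - I0 t \<omega>))\<^sup>2) * indicator A \<omega>"
  have "(\<integral>\<^sup>+\<omega>\<in>A. ennreal ((norm (J \<omega> - I0 t \<omega>))\<^sup>2) \<partial>M) = (\<integral>\<^sup>+\<omega>. liminf (\<lambda>k. ?u k \<omega>) \<partial>M)"
  proof (rule nn_integral_cong_AE, use r(2) in eventually_elim)
    case (elim \<omega>)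
    show ?case
    proof (cases "\<omega> \<in> A")
      case True
      then have "(\<lambda>k. I (r k) t \<omega>) \<longlonglongrightarrow> J \<omega>"
        using elim by (subst Lim_null) (simp add: tendsto_norm_zero_iff)
      then have "(\<lambda>k. ?u k \<omega>) \<longlonglongrightarrow> ennreal ((norm (J \<omega> - I0 t \<omega>))\<^sup>2) * indicator A \<omega>"
        using True by (simp, intro tendsto_intros)
      then show ?thesis by (intro lim_imp_Liminf[symmetric]) auto
    qed (simp add: Liminf_const)
  qed
  also have "\<dots> \<le> liminf (\<lambda>k. \<integral>\<^sup>+\<omega>. ?u k \<omega> \<partial>M)"
    by (rule nn_integral_liminf) measurable
  also have "\<dots> \<le> liminf (\<lambda>k. 2 * mean_energy M {0..t} (\<lambda>s \<omega>. Z (r k) s \<omega> - Xc s \<omega>) +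
      2 * mean_energy M {0..t} (\<lambda>s \<omega>. Xc s \<omega> - Z0 s \<omega>))"
  proof (rule Liminf_mono, rule always_eventually, rule allI)
    fix k
    note [measurable] = Xc elem_joint_measurable[OF Z, of "r k"] elem_joint_measurable[OF Z0]
    have "(\<integral>\<^sup>+\<omega>. ?u k \<omega> \<partial>M) \<le> (\<integral>\<^sup>+\<omega>. ennreal ((norm (I (r k) t \<omega> - I0 t \<omega>))\<^sup>2) \<partial>M)"
      by (intro nn_integral_mono) (auto simp: indicator_def)
    also have "\<dots> = mean_energy M {0..t} (\<lambda>s \<omega>. Z (r k) s \<omega> - Z0 s \<omega>)"
      by (rule elem_mean_energy[OF elem_diff[OF Z Z0] t])
    also have "\<dots> = mean_energy M {0..t} (\<lambda>s \<omega>. (Z (r k) s \<omega> - Xc s \<omega>) + (Xc s \<omega> - Z0 s \<omega>))"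
      by simp
    also have "\<dots> \<le> 2 * mean_energy M {0..t} (\<lambda>s \<omega>. Z (r k) s \<omega> - Xc s \<omega>) +
      2 * mean_energy M {0..t} (\<lambda>s \<omega>. Xc s \<omega> - Z0 s \<omega>)"
      by (rule mean_energy_add_le) measurable
    finally show "(\<integral>\<^sup>+\<omega>. ?u k \<omega> \<partial>M) \<le> \<dots>" .
  qed
  also have "\<dots> = 2 * mean_energy M {0..t} (\<lambda>s \<omega>. Xc s \<omega> - Z0 s \<omega>)"
  proof (rule lim_imp_Liminf)
    have "(\<lambda>k. mean_energy M {0..t} (\<lambda>s \<omega>. Z (r k) s \<omega> - Xc s \<omega>)) \<longlonglongrightarrow> 0"
      using LIMSEQ_subseq_LIMSEQ[OF lim r(1)] by (simp add: o_def)
    then have "(\<lambda>k. 2 * mean_energy M {0..t} (\<lambda>s \<omega>. Z (r k) s \<omega> - Xc s \<omega>) +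
      2 * mean_energy M {0..t} (\<lambda>s \<omega>. Xc s \<omega> - Z0 s \<omega>)) \<longlonglongrightarrow> 2 * 0 + 2 * mean_energy M {0..t} (\<lambda>s \<omega>. Xc s \<omega> - Z0 s \<omega>)"
      by (intro tendsto_add tendsto_const ennreal_tendsto_cmult) auto
    then show "(\<lambda>k. 2 * mean_energy M {0..t} (\<lambda>s \<omega>. Z (r k) s \<omega> - Xc s \<omega>) +
      2 * mean_energy M {0..t} (\<lambda>s \<omega>. Xc s \<omega> - Z0 s \<omega>)) \<longlonglongrightarrow> 2 * mean_energy M {0..t} (\<lambda>s \<omega>. Xc s \<omega> - Z0 s \<omega>)"
      by simp
  qed simp
  finally show ?thesis .
qed

end

section \<open>Second moments of solutions are finite\<close>

lemma matrix_family_bound: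
  fixes A :: "'k::finite \<Rightarrow> real^'n^'m"
  obtains c where "0 < c" "\<And>i x. norm (A i *v x) \<le> c * norm x"
proof -
  have "\<forall>i. \<exists>c>0. \<forall>x. norm (A i *v x) \<le> norm x * c"
    by (intro allI bounded_linear.pos_bounded) simp
  then obtain c where c: "\<And>i. 0 < c i" "\<And>i x. norm (A i *v x) \<le> norm x * c i" by metis
  define C where "C = (\<Sum>i\<in>UNIV. c i)"
  have "c i \<le> C" for i unfolding C_def using c(1) by (intro member_le_sum) (auto intro: less_imp_le)
  then have "norm (A i *v x) \<le> C * norm x" for i x
    using c(2)[of i x] by (metis mult.commute mult_left_mono norm_ge_zero order_trans)
  moreover have "0 < C" unfolding C_def using c(1) by (intro sum_pos) auto
  ultimately show ?thesis by (rule that[rotated])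
qed

lemma matrix_vector_measurable [measurable (raw)]:
  fixes A :: "real^'m^'l" shows "f \<in> borel_measurable N \<Longrightarrow> (\<lambda>x. A *v f x) \<in> borel_measurable N"
  by (rule borel_measurable_continuous_on[OF linear_continuous_on[OF matrix_vector_mul_bounded_linear]])

text \<open>Cauchy-Schwarz against the indicator of \<open>A\<close>. The factor
  \<open>emeasure lborel A\<close> is what later makes the drift smaller than the noise on short
  intervals.\<close>

lemma norm_set_integral_square_le:
  fixes f :: "real \<Rightarrow> 'b::euclidean_space"
  assumes f: "set_integrable lborel A f" and [measurable]: "A \<in> sets borel"
  shows "ennreal ((norm (LINT s:A|lborel. f s))\<^sup>2) \<le> emeasure lborel A * (\<integral>\<^sup>+s\<in>A. ennreal ((norm (f s))\<^sup>2) \<partial>lborel)"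
proof -
  have [measurable]: "(\<lambda>s. indicator A s *\<^sub>R f s) \<in> borel_measurable lborel"
    using f unfolding set_integrable_def by (rule borel_measurable_integrable)
  have "ennreal (norm (LINT s:A|lborel. f s)) \<le> (\<integral>\<^sup>+s. ennreal (norm (indicator A s *\<^sub>R f s)) \<partial>lborel)"
    unfolding set_lebesgue_integral_def using f unfolding set_integrable_def by (rule integral_norm_bound_ennreal)
  also have "\<dots> = (\<integral>\<^sup>+s. ennreal (norm (indicator A s *\<^sub>R f s)) * indicator A s \<partial>lborel)"
    by (intro nn_integral_cong) (auto simp: indicator_def)
  finally have "(ennreal (norm (LINT s:A|lborel. f s)))\<^sup>2 \<le>
    (\<integral>\<^sup>+s. ennreal (norm (indicator A s *\<^sub>R f s)) * indicator A s \<partial>lborel)\<^sup>2"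
    by (rule power_mono) simp
  also have "\<dots> \<le> (\<integral>\<^sup>+s. (ennreal (norm (indicator A s *\<^sub>R f s)))\<^sup>2 \<partial>lborel) * (\<integral>\<^sup>+s. (indicator A s)\<^sup>2 \<partial>lborel)"
    by (rule Cauchy_Schwarz_nn_integral) measurable
  also have "(\<integral>\<^sup>+s. (ennreal (norm (indicator A s *\<^sub>R f s)))\<^sup>2 \<partial>lborel) = (\<integral>\<^sup>+s\<in>A. ennreal ((norm (f s))\<^sup>2) \<partial>lborel)"
    by (intro nn_integral_cong) (auto simp: indicator_def ennreal_power)
  also have "(\<integral>\<^sup>+s. (indicator A s)\<^sup>2 \<partial>lborel) = emeasure lborel A"
  proof -
    have "(\<integral>\<^sup>+s. (indicator A s)\<^sup>2 \<partial>lborel) = (\<integral>\<^sup>+s. indicator A s \<partial>lborel)"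
      by (intro nn_integral_cong) (simp split: split_indicator)
    then show ?thesis by simp
  qed
  finally show ?thesis by (simp add: ennreal_power mult.commute)
qed

lemma energy_bound:
  assumes [measurable]: "(\<lambda>s. Z s \<omega>) \<in> borel_measurable borel" "A \<in> sets borel"
    and "\<And>s. s \<in> A \<Longrightarrow> norm (X s \<omega>) \<le> c * norm (Z s \<omega>)"
  shows "energy A X \<omega> \<le> ennreal (c\<^sup>2) * energy A Z \<omega>"
proof -
  have "energy A X \<omega> \<le> (\<integral>\<^sup>+s. ennreal (c\<^sup>2) * (ennreal ((norm (Z s \<omega>))\<^sup>2) * indicator A s) \<partial>lborel)"
    unfolding energy_def
  proof (rule nn_integral_mono)
    fix s
    have "(norm (X s \<omega>))\<^sup>2 \<le> c\<^sup>2 * (norm (Z s \<omega>))\<^sup>2" if "s \<in> A"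
      using power_mono[OF assms(3)[OF that] norm_ge_zero, of 2] by (simp add: power_mult_distrib)
    then show "ennreal ((norm (X s \<omega>))\<^sup>2) * indicator A s \<le> ennreal (c\<^sup>2) * (ennreal ((norm (Z s \<omega>))\<^sup>2) * indicator A s)"
      by (auto simp: indicator_def ennreal_mult'[symmetric] intro!: ennreal_leI)
  qed
  also have "\<dots> = ennreal (c\<^sup>2) * energy A Z \<omega>" unfolding energy_def by (rule nn_integral_cmult) measurable
  finally show ?thesis .
qed

lemma mean_energy_bound:
  assumes Z: "(\<lambda>(s, \<omega>). Z s \<omega>) \<in> borel_measurable (borel \<Otimes>\<^sub>M M)" and A: "A \<in> sets borel"
    and "\<And>s \<omega>. s \<in> A \<Longrightarrow> \<omega> \<in> space M \<Longrightarrow> norm (X s \<omega>) \<le> c * norm (Z s \<omega>)"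
  shows "mean_energy M A X \<le> ennreal (c\<^sup>2) * mean_energy M A Z"
proof -
  note [measurable] = energy_measurable[OF Z A]
  have "mean_energy M A X \<le> (\<integral>\<^sup>+\<omega>. ennreal (c\<^sup>2) * energy A Z \<omega> \<partial>M)"
    unfolding mean_energy_def
    by (intro nn_integral_mono energy_bound joint_measurable_section[OF Z] A assms(3))
  also have "\<dots> = ennreal (c\<^sup>2) * mean_energy M A Z" unfolding mean_energy_def by (rule nn_integral_cmult) measurable
  finally show ?thesis .
qed

locale switched_sde = wiener_process M F W
  for M :: "'w measure" and F :: "real \<Rightarrow> 'w measure" and W :: "real \<Rightarrow> 'w \<Rightarrow> real" +
  fixes G H :: "'k::finite \<Rightarrow> real^'n^'n" and \<sigma> :: "real \<Rightarrow> 'k" and y0 :: "real^'n" and y :: "real \<Rightarrow> 'w \<Rightarrow> real^'n"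
  assumes pc: "piecewise_constant \<sigma>" and sol: "switched_solution M F W G H \<sigma> y0 y"
begin

definition sw :: "real \<Rightarrow> real set"
  where "sw b = switching_instants \<sigma> \<inter> {..b}"

lemma finite_sw: "finite (sw b)"
  using pc by (simp add: piecewise_constant_def sw_def)

lemma sw_borel: "sw b \<in> sets borel"
  using finite_sw[of b] by (simp add: finite_imp_closed borel_closed)

lemma y_adapted: "0 \<le> t \<Longrightarrow> y t \<in> borel_measurable (F t)"
  and y_continuous: "\<omega> \<in> space M \<Longrightarrow> continuous_on {0..} (\<lambda>t. y t \<omega>)"
  using sol by (auto simp: switched_solution_def)

lemma y_measurable: "0 \<le> t \<Longrightarrow> y t \<in> borel_measurable M"
  by (rule F_measurable[OF y_adapted])

lemma y_tendsto_left:
  assumes "\<omega> \<in> space M" "0 < s"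
  shows "((\<lambda>u. y u \<omega>) \<longlongrightarrow> y s \<omega>) (at_left s)"
proof -
  have "continuous_on {0<..} (\<lambda>t. y t \<omega>)"
    by (rule continuous_on_subset[OF y_continuous[OF assms(1)]]) auto
  then have "isCont (\<lambda>t. y t \<omega>) s"
    using assms(2) by (simp add: continuous_on_eq_continuous_at)
  then show ?thesis by (auto simp: isCont_def intro: tendsto_within_subset)
qed

lemma mode_left_eventually:
  assumes "s \<in> {0<..t} - sw t"
  shows "\<forall>\<^sub>F u in at_left s. \<sigma> u = \<sigma> s"
proof -
  have "\<forall>\<^sub>F u in nhds s. \<sigma> u = \<sigma> s"
    using assms by (auto simp: sw_def switching_instants_def)
  then show ?thesis by (auto simp: eventually_at_filter elim: eventually_mono)
qed

lemma left_continuous_mode: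
  fixes Y :: "real \<Rightarrow> real^'n"
  assumes "\<And>s. 0 < s \<Longrightarrow> (Y \<longlongrightarrow> Y s) (at_left s)"
  shows "left_continuous_except (sw t) t (\<lambda>s. A (\<sigma> s) *v Y s)"
  unfolding left_continuous_except_def
proof
  fix s assume s: "s \<in> {0<..t} - sw t"
  have "((\<lambda>u. A (\<sigma> s) *v Y u) \<longlongrightarrow> A (\<sigma> s) *v Y s) (at_left s)"
    using assms[of s] s by (intro bounded_linear.tendsto[OF matrix_vector_mul_bounded_linear]) auto
  moreover have "\<forall>\<^sub>F u in at_left s. A (\<sigma> s) *v Y u = A (\<sigma> u) *v Y u"
    using mode_left_eventually[OF s] by eventually_elim simp
  ultimately show "((\<lambda>u. A (\<sigma> u) *v Y u) \<longlongrightarrow> A (\<sigma> s) *v Y s) (at_left s)"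
    by (rule Lim_transform_eventually)
qed

lemma path_bounded:
  assumes "\<omega> \<in> space M"
  obtains B where "\<And>u. u \<in> {0..t} \<Longrightarrow> norm (y u \<omega>) \<le> B"
proof -
  have "compact ((\<lambda>u. y u \<omega>) ` {0..t})"
    by (rule compact_continuous_image[OF continuous_on_subset[OF y_continuous[OF assms]]]) auto
  then have "bounded ((\<lambda>u. y u \<omega>) ` {0..t})" by (rule compact_imp_bounded)
  then obtain B where "\<forall>u\<in>{0..t}. norm (y u \<omega>) \<le> B" by (auto simp: bounded_iff)
  then show ?thesis using that by blast
qed

lemma mode_joint_measurable:
  "0 \<le> t \<Longrightarrow> (\<lambda>(s, \<omega>). off (sw t) t (\<lambda>s \<omega>. A (\<sigma> s) *v y s \<omega>) s \<omega>) \<in> borel_measurable (borel \<Otimes>\<^sub>M M)"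
  by (intro off_measurable sw_borel left_continuous_mode y_tendsto_left matrix_vector_measurable y_measurable) auto

lemma mode_set_integrable:
  assumes "\<omega> \<in> space M" "0 \<le> a" "a \<le> b"
  shows "set_integrable lborel {a..b} (\<lambda>s. A (\<sigma> s) *v y s \<omega>)" "set_integrable lborel {a<..b} (\<lambda>s. A (\<sigma> s) *v y s \<omega>)"
proof -
  have b: "0 \<le> b" using assms by simp
  have [measurable]: "(\<lambda>s. off (sw b) b (\<lambda>s \<omega>. A (\<sigma> s) *v y s \<omega>) s \<omega>) \<in> borel_measurable borel"
    by (rule joint_measurable_section[OF mode_joint_measurable[OF b] assms(1)])
  obtain B where B: "\<And>u. u \<in> {0..b} \<Longrightarrow> norm (y u \<omega>) \<le> B" using path_bounded[OF assms(1)] by blast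
  obtain c where c: "0 < c" "\<And>i x. norm (A i *v x) \<le> c * norm x"
    using matrix_family_bound[of A] by blast
  \<comment> \<open>On \<open>{a..b}\<close> the integrand and its jointly measurable version differ
    at finitely many times only.\<close>
  have m: "(\<lambda>s. indicator {a..b} s *\<^sub>R (A (\<sigma> s) *v y s \<omega>)) \<in> borel_measurable lborel"
  proof (rule measurable_discrete_difference[where X="insert 0 (sw b)" and f="\<lambda>s. indicator {a..b} s *\<^sub>R off (sw b) b (\<lambda>s \<omega>. A (\<sigma> s) *v y s \<omega>) s \<omega>"])
    show "countable (insert 0 (sw b))" using finite_sw by (simp add: countable_finite)
    show "(\<lambda>s. indicator {a..b} s *\<^sub>R off (sw b) b (\<lambda>s \<omega>. A (\<sigma> s) *v y s \<omega>) s \<omega>) \<in> borel_measurable lborel"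
      by measurable
  qed (use assms in \<open>auto simp: off_def indicator_def\<close>)
  have le: "norm (A (\<sigma> s) *v y s \<omega>) \<le> c * B" if "s \<in> {a..b}" for s
    using order_trans[OF c(2) mult_left_mono[OF B[of s], of c]] that assms c(1) by auto
  show 1: "set_integrable lborel {a..b} (\<lambda>s. A (\<sigma> s) *v y s \<omega>)"
    unfolding set_integrable_def
  proof (rule Bochner_Integration.integrable_bound[where f="\<lambda>s. indicator {a..b} s *\<^sub>R (c * B)"])
    show "integrable lborel (\<lambda>s. indicator {a..b} s *\<^sub>R (c * B))"
      by (intro integrable_scaleR_left integrable_real_indicator) (auto simp: emeasure_lborel_Icc_eq)
    show "AE s in lborel. norm (indicator {a..b} s *\<^sub>R (A (\<sigma> s) *v y s \<omega>)) \<le> norm (indicator {a..b} s *\<^sub>R (c * B))"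
    proof (rule AE_I2)
      fix s
      show "norm (indicator {a..b} s *\<^sub>R (A (\<sigma> s) *v y s \<omega>)) \<le> norm (indicator {a..b} s *\<^sub>R (c * B))"
        using order_trans[OF le abs_ge_self] by (cases "s \<in> {a..b}") auto
    qed
  qed (rule m)
  then show "set_integrable lborel {a<..b} (\<lambda>s. A (\<sigma> s) *v y s \<omega>)"
    by (rule set_integrable_subset) auto
qed

definition drift :: "real \<Rightarrow> 'w \<Rightarrow> real^'n"
  where "drift t \<omega> = (LINT s:{0..t}|lborel. G (\<sigma> s) *v y s \<omega>)"

lemma solution:
  assumes "0 \<le> t"
  obtains J where "has_ito_integral M F W (\<lambda>s \<omega>. H (\<sigma> s) *v y s \<omega>) t J" "AE \<omega> in M. y t \<omega> = y0 + drift t \<omega> + J \<omega>"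
  using sol assms by (auto simp: switched_solution_def drift_def)

definition below :: "nat \<Rightarrow> real \<Rightarrow> 'w set"
  where "below n t = {\<omega> \<in> space M. \<forall>u\<in>{0..t}. norm (y u \<omega>) \<le> real n}"

lemma below_mono: "s \<le> t \<Longrightarrow> below n t \<subseteq> below n s"
  by (auto simp: below_def)

text \<open>Continuity of every path reduces the condition to countably many times, so no completion
  of the filtration is involved. The times are rational fractions of \<open>t\<close>, not rational
  numbers, which keeps them in \<open>{0..t}\<close> and dense there up to the endpoint
  \<open>t\<close>.\<close>

lemma below_sets:
  assumes t: "0 \<le> t"
  shows "below n t \<in> sets (F t)"
proof -
  let ?Q = "(\<lambda>q. t * q) ` ({0..1} \<inter> \<rat>)"
  have Q: "countable ?Q" by (intro countable_image countable_Int2 countable_rat)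
  have meas: "{\<omega> \<in> space (F t). norm (y u \<omega>) \<le> real n} \<in> sets (F t)" if "u \<in> ?Q" for u
  proof -
    have "0 \<le> u" "u \<le> t" using that t by (auto intro: mult_left_le)
    then have [measurable]: "y u \<in> borel_measurable (F t)" using y_adapted F_measurable_mono by blast
    show ?thesis by measurable
  qed
  have "below n t = (\<Inter>u\<in>?Q. {\<omega> \<in> space (F t). norm (y u \<omega>) \<le> real n})"
  proof (intro equalityI subsetI)
    fix \<omega> assume "\<omega> \<in> below n t"
    then show "\<omega> \<in> (\<Inter>u\<in>?Q. {\<omega> \<in> space (F t). norm (y u \<omega>) \<le> real n})"
      using t by (auto simp: below_def) (meson atLeastAtMost_iff mult_left_le mult_nonneg_nonneg)
  next
    fix \<omega> assume w: "\<omega> \<in> (\<Inter>u\<in>?Q. {\<omega> \<in> space (F t). norm (y u \<omega>) \<le> real n})"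
    have "t * 0 \<in> ?Q" by (intro imageI) auto
    with w have \<omega>: "\<omega> \<in> space M" by (metis (mono_tags, lifting) INT_D mem_Collect_eq space_Ft)
    have cont: "continuous_on {0..1} (\<lambda>q. norm (y (t * q) \<omega>))"
      by (intro continuous_intros continuous_on_compose2[OF y_continuous[OF \<omega>]]) (use t in auto)
    have cl: "closure ({0<..<1} \<inter> \<rat>) = {0..(1::real)}"
      by (subst closure_open_Int_superset) (auto simp: Rats_closure_real)
    have "norm (y (t * q) \<omega>) \<le> real n" if "q \<in> {0..1}" for q
    proof (rule continuous_le_on_closure[of "{0<..<1} \<inter> \<rat>" "\<lambda>q. norm (y (t * q) \<omega>)"])
      show "continuous_on (closure ({0<..<1} \<inter> \<rat>)) (\<lambda>q. norm (y (t * q) \<omega>))" using cont cl by simp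
      show "q \<in> closure ({0<..<1} \<inter> \<rat>)" using that cl by simp
      show "norm (y (t * p) \<omega>) \<le> real n" if "p \<in> {0<..<1} \<inter> \<rat>" for p
        using w that by force
    qed
    moreover have "\<exists>q\<in>{0..1}. u = t * q" if "u \<in> {0..t}" for u
      using that t by (cases "t = 0") (auto intro!: bexI[of _ "u / t"] simp: divide_le_eq_1)
    ultimately have "norm (y u \<omega>) \<le> real n" if "u \<in> {0..t}" for u using that by blast
    then show "\<omega> \<in> below n t" using \<omega> by (auto simp: below_def)
  qed
  moreover have "(\<Inter>u\<in>?Q. {\<omega> \<in> space (F t). norm (y u \<omega>) \<le> real n}) \<in> sets (F t)"
  proof (rule sets.countable_INT'[OF Q])
    have "0 \<in> {0..1} \<inter> (\<rat> :: real set)" by simp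
    then show "?Q \<noteq> {}" by blast
  qed (use meas in auto)
  ultimately show ?thesis by simp
qed

end

lemma norm_add3_square_le: "(norm (a + b + c :: 'b::real_inner))\<^sup>2 \<le> 3 * (norm a)\<^sup>2 + 3 * (norm b)\<^sup>2 + 3 * (norm c)\<^sup>2"
proof -
  have "0 \<le> (norm (a - b))\<^sup>2 + (norm (b - c))\<^sup>2 + (norm (a - c))\<^sup>2" by simp
  then show ?thesis by (simp add: power2_norm_eq_inner inner_simps inner_commute)
qed

section \<open>Solutions cut off when the path leaves a ball\<close>

context switched_sde
begin

text \<open>The path is sent to 0 after its exit from the ball instead of being frozen there, so
  that the value at \<open>s\<close> depends only on \<open>y s\<close> and on one event in
  \<open>F s\<close>.\<close>

definition cut :: "nat \<Rightarrow> real \<Rightarrow> 'w \<Rightarrow> real^'n"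
  where "cut n s \<omega> = indicator (below n s) \<omega> *\<^sub>R y s \<omega>"

lemma cut_adapted: "0 \<le> s \<Longrightarrow> cut n s \<in> borel_measurable (F s)"
  using below_sets[of s n] y_adapted[of s] unfolding cut_def[abs_def] by measurable

lemma cut_bound: "0 \<le> s \<Longrightarrow> norm (cut n s \<omega>) \<le> real n"
  by (auto simp: cut_def below_def indicator_def)

lemma cut_eq: "\<omega> \<in> below n t \<Longrightarrow> s \<le> t \<Longrightarrow> cut n s \<omega> = y s \<omega>"
  using below_mono[of s t n] by (auto simp: cut_def)

text \<open>A jump can be seen only from the right, immediately after the exit. Because
  \<open>below\<close> has a non-strict bound, a path whose norm exceeds \<open>n\<close> at time
  \<open>s\<close> has by continuity exceeded it shortly before \<open>s\<close> as well, and the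
  cut path is already 0 there.\<close>

lemma cut_tendsto_left:
  assumes \<omega>: "\<omega> \<in> space M" and s: "0 < s"
  shows "((\<lambda>u. cut n u \<omega>) \<longlongrightarrow> cut n s \<omega>) (at_left s)"
proof (cases "\<omega> \<in> below n s")
  case True
  have "\<forall>\<^sub>F u in at_left s. y u \<omega> = cut n u \<omega>"
    unfolding eventually_at_left_field by (intro exI[of _ 0]) (use s True cut_eq in auto)
  then show ?thesis unfolding cut_eq[OF True order_refl]
    by (rule Lim_transform_eventually[OF y_tendsto_left[OF \<omega> s]])
next
  case False
  then obtain u0 where u0: "0 \<le> u0" "u0 \<le> s" "real n < norm (y u0 \<omega>)" using \<omega> by (auto simp: below_def)
  have "\<forall>\<^sub>F u in at_left s. \<omega> \<notin> below n u"
  proof (cases "u0 < s")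
    case True
    then show ?thesis
      unfolding eventually_at_left_field by (intro exI[of _ u0]) (use u0 in \<open>force simp: below_def\<close>)
  next
    case False
    then have "real n < norm (y s \<omega>)" using u0 by simp
    then have "\<forall>\<^sub>F u in at_left s. real n < norm (y u \<omega>)"
      by (rule order_tendstoD[OF tendsto_norm[OF y_tendsto_left[OF \<omega> s]]])
    moreover have "\<forall>\<^sub>F u in at_left s. 0 < u" using s by (intro eventually_at_leftI[of 0]) auto
    ultimately show ?thesis
    proof eventually_elim
      case (elim u)
      show ?case
      proof
        assume "\<omega> \<in> below n u"
        then have "norm (y u \<omega>) \<le> real n" using elim by (simp add: below_def)
        with elim show False by simp
      qed
    qed
  qed
  then have "\<forall>\<^sub>F u in at_left s. cut n s \<omega> = cut n u \<omega>"
    by eventually_elim (use False in \<open>simp add: cut_def\<close>)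
  then show ?thesis by (rule Lim_transform_eventually[OF tendsto_const])
qed

lemma cut_mode_adapted_sq:
  assumes "0 \<le> s"
  shows "adapted_sq s (\<lambda>\<omega>. A (\<sigma> s) *v cut n s \<omega>)"
proof -
  obtain c where c: "0 < c" "\<And>i x. norm (A i *v x) \<le> c * norm x"
    using matrix_family_bound[of A] by blast
  have m: "(\<lambda>\<omega>. A (\<sigma> s) *v cut n s \<omega>) \<in> borel_measurable (F s)"
    using cut_adapted[OF assms] by measurable
  have "norm (A (\<sigma> s) *v cut n s \<omega>) \<le> c * norm (real n)" for \<omega>
    using order_trans[OF c(2) mult_left_mono[OF cut_bound[OF assms]]] c(1) by auto
  then have "square_integrable M (\<lambda>\<omega>. A (\<sigma> s) *v cut n s \<omega>)"
    by (intro square_integrable_bound[OF square_integrable_const[of "real n"] F_measurable[OF m]])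
  with m show ?thesis by (simp add: adapted_sq_def)
qed

definition Xcut :: "('k \<Rightarrow> real^'n^'n) \<Rightarrow> nat \<Rightarrow> real \<Rightarrow> 'w \<Rightarrow> real^'n"
  where "Xcut A n s \<omega> = A (\<sigma> s) *v cut n s \<omega>"

lemma Xcut_off_measurable:
  assumes "0 \<le> t"
  shows "(\<lambda>(s, \<omega>). off (sw t) t (Xcut A n) s \<omega>) \<in> borel_measurable (borel \<Otimes>\<^sub>M M)"
proof -
  have "Xcut A n s \<in> borel_measurable M" if "s \<in> {0..t}" for s
    using cut_mode_adapted_sq[of s A n] that unfolding Xcut_def[abs_def]
    by (auto simp: adapted_sq_def square_integrable_def)
  then show ?thesis using assms unfolding Xcut_def
    by (intro off_measurable sw_borel left_continuous_mode cut_tendsto_left) (auto simp: Xcut_def)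
qed

lemma Xcut_approximation:
  assumes t: "0 \<le> t"
  obtains Z I K where "\<And>k::nat. elem (Z k) (I k)" "\<And>k s \<omega>. \<omega> \<in> space M \<Longrightarrow> norm (Z k s \<omega>) \<le> K"
    "(\<lambda>k. mean_energy M {0..t} (\<lambda>s \<omega>. Z k s \<omega> - off (sw t) t (Xcut A n) s \<omega>)) \<longlonglongrightarrow> 0"
proof -
  obtain c where c: "0 < c" "\<And>i x. norm (A i *v x) \<le> c * norm x"
    using matrix_family_bound[of A] by blast
  have "norm (Xcut A n s \<omega>) \<le> c * real n" if "0 \<le> s" for s \<omega>
    unfolding Xcut_def using order_trans[OF c(2) mult_left_mono[OF cut_bound[OF that]]] c(1) by auto
  note bd = this
  have ad: "adapted_sq s (Xcut A n s)" if "s \<in> {0..t}" for s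
    using cut_mode_adapted_sq[of s A n] that unfolding Xcut_def[abs_def] by auto
  obtain I where I: "\<And>k. elem (riemann_step t k (Xcut A n)) (I k)"
    using elem_riemann_step[OF t ad] by metis
  have "norm (riemann_step t k (Xcut A n) s \<omega>) \<le> c * real n" for k s \<omega>
    using riemann_step_0_or_point[OF t, of k "Xcut A n" s \<omega>] bd c(1) by auto
  moreover have "(\<lambda>k. mean_energy M {0..t} (\<lambda>s \<omega>. riemann_step t k (Xcut A n) s \<omega> - off (sw t) t (Xcut A n) s \<omega>)) \<longlonglongrightarrow> 0"
  proof (rule riemann_energy_tendsto[OF t _ finite_sw, where C="c * real n"])
    show "Xcut A n s \<in> borel_measurable M" if "s \<in> {0..t}" for s
      using ad[OF that] by (auto simp: adapted_sq_def square_integrable_def)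
    show "left_continuous_except (sw t) t (\<lambda>s. Xcut A n s \<omega>)" if "\<omega> \<in> space M" for \<omega>
      unfolding Xcut_def by (intro left_continuous_mode cut_tendsto_left that)
  qed (use bd c(1) in auto)
  ultimately show ?thesis
    by (intro that[of "\<lambda>k. riemann_step t k (Xcut A n)" I "c * real n"] I)
qed

lemma AE_Xcut:
  assumes "\<omega> \<in> below n t"
  shows "AE s in lborel. s \<in> {0..t} \<longrightarrow> off (sw t) t (Xcut A n) s \<omega> = A (\<sigma> s) *v y s \<omega>"
  using AE_off[OF finite_sw, of t t "Xcut A n" \<omega>]
  by eventually_elim (use cut_eq[OF assms] in \<open>auto simp: Xcut_def\<close>)

definition Ycut :: "nat \<Rightarrow> real \<Rightarrow> real \<Rightarrow> 'w \<Rightarrow> real^'n"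
  where "Ycut n t = off (sw t) t (cut n)"

lemma Ycut_measurable: "0 \<le> t \<Longrightarrow> (\<lambda>(s, \<omega>). Ycut n t s \<omega>) \<in> borel_measurable (borel \<Otimes>\<^sub>M M)"
  using Xcut_off_measurable[of t "\<lambda>_. mat 1" n] unfolding Ycut_def off_def Xcut_def by simp

lemma Xcut_bound:
  assumes "\<And>i x. norm (A i *v x) \<le> c * norm x"
  shows "norm (off (sw t) t (Xcut A n) s \<omega>) \<le> c * norm (Ycut n t s \<omega>)"
  using assms by (auto simp: off_def Xcut_def Ycut_def indicator_def)

lemma below_events: "0 \<le> t \<Longrightarrow> below n t \<in> sets M"
  using below_sets subalg by blast

text \<open>On \<open>below n t\<close> the solution and the cut path agree up to time
  \<open>t\<close>, so squaring the integrated equation leaves an inequality with only the cut path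
  on the right. Three summands cost a factor 3; Cauchy-Schwarz in time gives
  \<open>t * g\<^sup>2\<close> for the drift, and \<open>ito_integral_estimate\<close> compared with
  the integrand 0 gives \<open>2 * h\<^sup>2\<close> for the noise.\<close>

lemma local_moment_estimate:
  assumes t: "0 \<le> t" and g: "\<And>i x. norm (G i *v x) \<le> g * norm x" and h: "\<And>i x. norm (H i *v x) \<le> h * norm x"
  shows "(\<integral>\<^sup>+\<omega>\<in>below n t. ennreal ((norm (y t \<omega>))\<^sup>2) \<partial>M) \<le>
    ennreal (3 * (norm y0)\<^sup>2) + ennreal (3 * t * g\<^sup>2 + 6 * h\<^sup>2) * mean_energy M {0..t} (Ycut n t)"
proof -
  obtain J where J: "has_ito_integral M F W (\<lambda>s \<omega>. H (\<sigma> s) *v y s \<omega>) t J"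
    and eq: "AE \<omega> in M. y t \<omega> = y0 + drift t \<omega> + J \<omega>" by (rule solution[OF t])
  have Jm[measurable]: "J \<in> borel_measurable M" using J unfolding has_ito_integral_def by blast
  note A[measurable] = below_events[OF t, of n]
  note Ym = Ycut_measurable[OF t, of n]
  have [measurable]: "energy {0..t} (Ycut n t) \<in> borel_measurable M" by (rule energy_measurable[OF Ym]) simp
  obtain Z I K where Z: "\<And>k::nat. elem (Z k) (I k)" "\<And>k s \<omega>. \<omega> \<in> space M \<Longrightarrow> norm (Z k s \<omega>) \<le> K"
    "(\<lambda>k. mean_energy M {0..t} (\<lambda>s \<omega>. Z k s \<omega> - off (sw t) t (Xcut H n) s \<omega>)) \<longlonglongrightarrow> 0"
    by (rule Xcut_approximation[OF t, of H n]) blast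
  have "(\<integral>\<^sup>+\<omega>\<in>below n t. ennreal ((norm (J \<omega> - 0))\<^sup>2) \<partial>M) \<le>
    2 * mean_energy M {0..t} (\<lambda>s \<omega>. off (sw t) t (Xcut H n) s \<omega> - 0)"
    by (rule ito_integral_estimate[OF J t A Xcut_off_measurable[OF t] AE_Xcut Z elem_zero])
  also have "\<dots> \<le> 2 * (ennreal (h\<^sup>2) * mean_energy M {0..t} (Ycut n t))"
    by (intro mult_left_mono mean_energy_bound Ym) (use Xcut_bound[OF h] in auto)
  finally have J2: "(\<integral>\<^sup>+\<omega>\<in>below n t. ennreal ((norm (J \<omega>))\<^sup>2) \<partial>M) \<le> 2 * (ennreal (h\<^sup>2) * mean_energy M {0..t} (Ycut n t))"
    by simp
  have dr: "ennreal ((norm (drift t \<omega>))\<^sup>2) \<le> ennreal (t * g\<^sup>2) * energy {0..t} (Ycut n t) \<omega>" if "\<omega> \<in> below n t" for \<omega>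
  proof -
    have \<omega>: "\<omega> \<in> space M" using that by (simp add: below_def)
    have "ennreal ((norm (drift t \<omega>))\<^sup>2) \<le> emeasure lborel {0..t} * energy {0..t} (\<lambda>s \<omega>. G (\<sigma> s) *v y s \<omega>) \<omega>"
      unfolding drift_def energy_def by (rule norm_set_integral_square_le[OF mode_set_integrable(1)[OF \<omega> order_refl t]]) simp
    also have "energy {0..t} (\<lambda>s \<omega>. G (\<sigma> s) *v y s \<omega>) \<omega> = energy {0..t} (off (sw t) t (Xcut G n)) \<omega>"
      by (rule energy_AE_cong, use AE_Xcut[OF that, of G] in eventually_elim) simp
    also have "\<dots> \<le> ennreal (g\<^sup>2) * energy {0..t} (Ycut n t) \<omega>"
      by (rule energy_bound[where Z="Ycut n t" and \<omega>=\<omega>, OF joint_measurable_section[OF Ym \<omega>]]) (use Xcut_bound[OF g] in auto)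
    finally show ?thesis using t by (simp add: ennreal_mult mult.assoc mult_left_mono)
  qed
  have "(\<integral>\<^sup>+\<omega>\<in>below n t. ennreal ((norm (y t \<omega>))\<^sup>2) \<partial>M) \<le>
    (\<integral>\<^sup>+\<omega>. (ennreal (3 * (norm y0)\<^sup>2) + ennreal (3 * t * g\<^sup>2) * energy {0..t} (Ycut n t) \<omega>)
      + 3 * (ennreal ((norm (J \<omega>))\<^sup>2) * indicator (below n t) \<omega>) \<partial>M)"
  proof (rule nn_integral_mono_AE, use eq in eventually_elim)
    case (elim \<omega>)
    show ?case
    proof (cases "\<omega> \<in> below n t")
      case True
      have "ennreal ((norm (y t \<omega>))\<^sup>2) \<le> ennreal (3 * (norm y0)\<^sup>2 + 3 * (norm (drift t \<omega>))\<^sup>2 + 3 * (norm (J \<omega>))\<^sup>2)"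
        unfolding elim by (intro ennreal_leI norm_add3_square_le)
      also have "\<dots> = ennreal (3 * (norm y0)\<^sup>2) + 3 * ennreal ((norm (drift t \<omega>))\<^sup>2) + 3 * ennreal ((norm (J \<omega>))\<^sup>2)"
        by (simp add: ennreal_mult')
      also have "\<dots> \<le> ennreal (3 * (norm y0)\<^sup>2) + 3 * (ennreal (t * g\<^sup>2) * energy {0..t} (Ycut n t) \<omega>) + 3 * ennreal ((norm (J \<omega>))\<^sup>2)"
        by (intro add_mono mult_left_mono dr True order_refl) auto
      also have "3 * (ennreal (t * g\<^sup>2) * energy {0..t} (Ycut n t) \<omega>) = ennreal (3 * t * g\<^sup>2) * energy {0..t} (Ycut n t) \<omega>"
        using t by (simp add: mult.assoc[symmetric] ennreal_mult'[symmetric] ennreal_mult''[symmetric])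
          (simp add: ennreal_mult' mult.assoc)
      finally show ?thesis using True by simp
    qed simp
  qed
  also have "\<dots> = ennreal (3 * (norm y0)\<^sup>2) + ennreal (3 * t * g\<^sup>2) * mean_energy M {0..t} (Ycut n t) +
      3 * (\<integral>\<^sup>+\<omega>\<in>below n t. ennreal ((norm (J \<omega>))\<^sup>2) \<partial>M)"
    unfolding mean_energy_def
    by (subst nn_integral_add, measurable, subst nn_integral_add, measurable)
      (simp add: nn_integral_cmult emeasure_space_1)
  also have "\<dots> \<le> ennreal (3 * (norm y0)\<^sup>2) + ennreal (3 * t * g\<^sup>2) * mean_energy M {0..t} (Ycut n t) +
      3 * (2 * (ennreal (h\<^sup>2) * mean_energy M {0..t} (Ycut n t)))"
    by (intro add_mono mult_left_mono J2 order_refl) auto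
  also have "3 * (2 * (ennreal (h\<^sup>2) * mean_energy M {0..t} (Ycut n t))) = ennreal (6 * h\<^sup>2) * mean_energy M {0..t} (Ycut n t)"
    by (simp add: mult.assoc[symmetric] ennreal_mult')
  finally show ?thesis using t by (simp add: distrib_right add.assoc)
qed

lemma mean_energy_Ycut_le:
  assumes t: "0 \<le> t"
  shows "mean_energy M {0..t} (Ycut n t) \<le> (\<integral>\<^sup>+s\<in>{0..t}. (\<integral>\<^sup>+\<omega>\<in>below n s. ennreal ((norm (y s \<omega>))\<^sup>2) \<partial>M) \<partial>lborel)"
  unfolding mean_energy_Tonelli[OF Ycut_measurable[OF t] atLeastAtMost_borel]
  by (intro nn_integral_mono mult_right_mono) (auto simp: Ycut_def off_def cut_def indicator_def)

text \<open>Gronwall's inequality in the form of a bound on the supremum of \<open>exp (-2Cs) * p s\<close>, which needs no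
  measurability of \<open>p\<close>.\<close>

lemma truncated_moment_bound:
  assumes b: "0 \<le> b"
  obtains K where "0 \<le> K" "\<And>n t. t \<in> {0..b} \<Longrightarrow> (\<integral>\<^sup>+\<omega>\<in>below n t. ennreal ((norm (y t \<omega>))\<^sup>2) \<partial>M) \<le> ennreal K"
proof -
  obtain g where g: "0 < g" "\<And>i x. norm (G i *v x) \<le> g * norm x" using matrix_family_bound[of G] by blast
  obtain h where h: "0 < h" "\<And>i x. norm (H i *v x) \<le> h * norm x" using matrix_family_bound[of H] by blast
  \<comment> \<open>The factor from \<open>local_moment_estimate\<close> at the largest time
    \<open>b\<close>, so that it serves all times in \<open>{0..b}\<close>.\<close>
  define C where "C = 3 * b * g\<^sup>2 + 6 * h\<^sup>2"
  have C: "0 < C" using b h(1) by (auto simp: C_def intro: add_nonneg_pos)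
  \<comment> \<open>With \<open>m\<close> the supremum of the weighted moment, the integral term
    contributes at most \<open>C\<close> times the integral of \<open>m * exp (2 * C * s)\<close>,
    that is half of \<open>m\<close> after weighting. So \<open>m\<close> is at most
    \<open>3 * (norm y0)\<^sup>2 + m / 2\<close>, which gives the 6. Absorbing \<open>m / 2\<close>
    requires \<open>m\<close> to be finite; the truncation ensures this by the bound
    \<open>(real n)\<^sup>2\<close>, while \<open>K\<close> itself does not depend on
    \<open>n\<close>.\<close>
  define K where "K = 6 * (norm y0)\<^sup>2 * exp (2 * C * b)"
  have "(\<integral>\<^sup>+\<omega>\<in>below n t. ennreal ((norm (y t \<omega>))\<^sup>2) \<partial>M) \<le> ennreal K" if t: "t \<in> {0..b}" for n t
  proof -
    define \<phi> where "\<phi> s = (\<integral>\<^sup>+\<omega>\<in>below n s. ennreal ((norm (y s \<omega>))\<^sup>2) \<partial>M)" for s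
    have \<phi>_le: "\<phi> s \<le> ennreal ((real n)\<^sup>2)" if "0 \<le> s" for s
    proof -
      have "\<phi> s \<le> (\<integral>\<^sup>+\<omega>. ennreal ((real n)\<^sup>2) \<partial>M)"
        unfolding \<phi>_def
      proof (rule nn_integral_mono)
        fix \<omega>
        have "(norm (y s \<omega>))\<^sup>2 \<le> (real n)\<^sup>2" if "\<omega> \<in> below n s"
          using that \<open>0 \<le> s\<close> by (intro power_mono) (auto simp: below_def)
        then show "ennreal ((norm (y s \<omega>))\<^sup>2) * indicator (below n s) \<omega> \<le> ennreal ((real n)\<^sup>2)"
          by (auto simp: indicator_def intro: ennreal_leI)
      qed
      then show ?thesis by (simp add: emeasure_space_1)
    qed
    define p where "p s = enn2real (\<phi> s)" for s
    have \<phi>p: "\<phi> s = ennreal (p s)" if "0 \<le> s" for s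
      using \<phi>_le[OF that] unfolding p_def by (intro ennreal_enn2real[symmetric]) (auto simp: top_unique less_top[symmetric])
    have p0: "0 \<le> p s" for s by (simp add: p_def)
    have pn: "p s \<le> (real n)\<^sup>2" if "0 \<le> s" for s
      using \<phi>_le[OF that] \<phi>p[OF that] by simp
    define q where "q s = exp (- (2 * C * s)) * p s" for s
    define m where "m = (SUP s\<in>{0..b}. q s)"
    have bdd: "bdd_above (q ` {0..b})"
    proof (rule bdd_aboveI2)
      fix s assume s: "s \<in> {0..b}"
      have "q s \<le> 1 * p s" unfolding q_def by (intro mult_right_mono p0) (use s C in auto)
      then show "q s \<le> (real n)\<^sup>2" using pn[of s] s by simp
    qed
    have q_le: "q s \<le> m" if "s \<in> {0..b}" for s unfolding m_def by (rule cSUP_upper[OF that bdd])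
    have q0: "0 \<le> q s" for s by (simp add: q_def p0)
    have m0: "0 \<le> m" using q_le[of 0] q0[of 0] b by (meson atLeastAtMost_iff order_refl order_trans)
    have p_le: "p s \<le> m * exp (2 * C * s)" if "s \<in> {0..b}" for s
      using q_le[OF that] by (simp add: q_def exp_minus field_simps)
    have "q u \<le> 3 * (norm y0)\<^sup>2 + m / 2" if u: "u \<in> {0..b}" for u
    proof -
      have u0: "0 \<le> u" using u by simp
      have "mean_energy M {0..u} (Ycut n u) \<le> (\<integral>\<^sup>+s\<in>{0..u}. \<phi> s \<partial>lborel)"
        unfolding \<phi>_def by (rule mean_energy_Ycut_le[OF u0])
      also have "\<dots> \<le> (\<integral>\<^sup>+s\<in>{0..u}. ennreal (m * exp (2 * C * s)) \<partial>lborel)"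
      proof (rule nn_integral_mono)
        fix s
        show "\<phi> s * indicator {0..u} s \<le> ennreal (m * exp (2 * C * s)) * indicator {0..u} s"
          using \<phi>p[of s] p_le[of s] u by (auto simp: indicator_def intro: ennreal_leI)
      qed
      also have "\<dots> = ennreal (m * exp (2 * C * u) / (2 * C) - m * exp (2 * C * 0) / (2 * C))"
      proof (rule nn_integral_FTC_Icc[where F="\<lambda>s. m * exp (2 * C * s) / (2 * C)"])
        fix s
        show "DERIV (\<lambda>s. m * exp (2 * C * s) / (2 * C)) s :> m * exp (2 * C * s)"
          using C by (auto intro!: derivative_eq_intros)
      qed (use m0 u0 in auto)
      also have "\<dots> \<le> ennreal (m * exp (2 * C * u) / (2 * C))"
        using C m0 by (intro ennreal_leI) simp
      finally have me: "mean_energy M {0..u} (Ycut n u) \<le> ennreal (m * exp (2 * C * u) / (2 * C))" .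
      have "ennreal (p u) \<le> ennreal (3 * (norm y0)\<^sup>2) + ennreal (3 * u * g\<^sup>2 + 6 * h\<^sup>2) * mean_energy M {0..u} (Ycut n u)"
        unfolding \<phi>p[OF u0, symmetric] unfolding \<phi>_def by (rule local_moment_estimate[OF u0 g(2) h(2)])
      also have "\<dots> \<le> ennreal (3 * (norm y0)\<^sup>2) + ennreal C * ennreal (m * exp (2 * C * u) / (2 * C))"
        using u by (intro add_mono mult_mono me ennreal_leI) (auto simp: C_def intro: mult_right_mono)
      also have "\<dots> = ennreal (3 * (norm y0)\<^sup>2 + C * (m * exp (2 * C * u) / (2 * C)))"
        using C m0 by (simp add: ennreal_mult'[symmetric])
      finally have "p u \<le> 3 * (norm y0)\<^sup>2 + C * (m * exp (2 * C * u) / (2 * C))"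
        using C m0 by (subst (asm) ennreal_le_iff) auto
      then have "p u \<le> 3 * (norm y0)\<^sup>2 + (m / 2) * exp (2 * C * u)" using C by simp
      then have "q u \<le> exp (- (2 * C * u)) * (3 * (norm y0)\<^sup>2 + (m / 2) * exp (2 * C * u))"
        unfolding q_def by (rule mult_left_mono) simp
      also have "\<dots> = exp (- (2 * C * u)) * (3 * (norm y0)\<^sup>2) + m / 2"
        by (simp add: exp_minus field_simps)
      also have "\<dots> \<le> 1 * (3 * (norm y0)\<^sup>2) + m / 2"
        using u C by (intro add_mono mult_right_mono) auto
      finally show ?thesis by simp
    qed
    then have "m \<le> 3 * (norm y0)\<^sup>2 + m / 2"
      unfolding m_def using b by (intro cSUP_least) auto
    then have m6: "m \<le> 6 * (norm y0)\<^sup>2" by simp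
    have "p t \<le> m * exp (2 * C * t)" by (rule p_le[OF t])
    also have "\<dots> \<le> K" unfolding K_def using t C m0 m6 by (intro mult_mono) auto
    finally show ?thesis using \<phi>p[of t] t unfolding \<phi>_def by (auto intro: ennreal_leI)
  qed
  moreover have "0 \<le> K" by (simp add: K_def)
  ultimately show ?thesis using that by blast
qed

text \<open>The truncated bound is uniform in \<open>n\<close>, and every path lies in
  \<open>below n t\<close> for large \<open>n\<close>, so Fatou's lemma removes the
  truncation.\<close>

lemma moment_bound:
  assumes b: "0 \<le> b"
  obtains K where "0 \<le> K" "\<And>t. t \<in> {0..b} \<Longrightarrow> (\<integral>\<^sup>+\<omega>. ennreal ((norm (y t \<omega>))\<^sup>2) \<partial>M) \<le> ennreal K"
proof -
  obtain K where K: "0 \<le> K" "\<And>n t. t \<in> {0..b} \<Longrightarrow> (\<integral>\<^sup>+\<omega>\<in>below n t. ennreal ((norm (y t \<omega>))\<^sup>2) \<partial>M) \<le> ennreal K"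
    by (rule truncated_moment_bound[OF b]) blast
  have "(\<integral>\<^sup>+\<omega>. ennreal ((norm (y t \<omega>))\<^sup>2) \<partial>M) \<le> ennreal K" if t: "t \<in> {0..b}" for t
  proof -
    have t0: "0 \<le> t" using t by simp
    note [measurable] = y_measurable[OF t0] below_events[OF t0]
    have "(\<integral>\<^sup>+\<omega>. ennreal ((norm (y t \<omega>))\<^sup>2) \<partial>M) =
      (\<integral>\<^sup>+\<omega>. liminf (\<lambda>n. ennreal ((norm (y t \<omega>))\<^sup>2) * indicator (below n t) \<omega>) \<partial>M)"
    proof (rule nn_integral_cong)
      fix \<omega> assume \<omega>: "\<omega> \<in> space M"
      obtain B where B: "\<And>u. u \<in> {0..t} \<Longrightarrow> norm (y u \<omega>) \<le> B" using path_bounded[OF \<omega>] by blast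
      have "\<forall>\<^sub>F n in sequentially. \<omega> \<in> below n t"
        using eventually_ge_at_top[of "nat \<lceil>B\<rceil>"]
      proof eventually_elim
        case (elim n)
        then have "B \<le> real n" by linarith
        then show ?case using B \<omega> by (force simp: below_def)
      qed
      then have "(\<lambda>n. ennreal ((norm (y t \<omega>))\<^sup>2) * indicator (below n t) \<omega>) \<longlonglongrightarrow> ennreal ((norm (y t \<omega>))\<^sup>2)"
        by (intro tendsto_eventually) (auto elim: eventually_mono)
      then show "ennreal ((norm (y t \<omega>))\<^sup>2) = liminf (\<lambda>n. ennreal ((norm (y t \<omega>))\<^sup>2) * indicator (below n t) \<omega>)"
        by (intro lim_imp_Liminf[symmetric]) auto
    qed
    also have "\<dots> \<le> liminf (\<lambda>n. \<integral>\<^sup>+\<omega>\<in>below n t. ennreal ((norm (y t \<omega>))\<^sup>2) \<partial>M)"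
      by (rule nn_integral_liminf) measurable
    also have "\<dots> \<le> liminf (\<lambda>n. ennreal K)"
      by (intro Liminf_mono always_eventually allI K(2) t)
    finally show ?thesis by (simp add: Liminf_const)
  qed
  with K(1) show ?thesis using that by blast
qed

end

section \<open>The martingale part of a solution\<close>

lemma square_integrableI:
  assumes "X \<in> borel_measurable M" "(\<integral>\<^sup>+\<omega>. ennreal ((norm (X \<omega>))\<^sup>2) \<partial>M) \<le> ennreal c" "0 \<le> c"
  shows "square_integrable M X" "(\<integral>\<omega>. (norm (X \<omega>))\<^sup>2 \<partial>M) \<le> c"
proof -
  show si: "square_integrable M X"
    using assms(1,2) by (auto simp: square_integrable_nn intro: le_less_trans)
  show "(\<integral>\<omega>. (norm (X \<omega>))\<^sup>2 \<partial>M) \<le> c"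
    using assms(2,3) unfolding nn_integral_square_integrable[OF si] by simp
qed

text \<open>Young's inequality, without the sharp constant. The weight \<open>l\<close> is later
  chosen as a power of the step length, to balance two second moments of different order, or sent to
  0.\<close>

lemma inner_le_weighted:
  assumes "0 < l"
  shows "\<bar>x \<bullet> y\<bar> \<le> l * (norm x)\<^sup>2 + (norm y)\<^sup>2 / l"
proof -
  have "0 \<le> (l * norm x - norm y)\<^sup>2" by simp
  then have "2 * l * (norm x * norm y) \<le> (l * norm x)\<^sup>2 + (norm y)\<^sup>2" by (simp add: power2_diff mult.assoc)
  then have "2 * (norm x * norm y) \<le> ((l * norm x)\<^sup>2 + (norm y)\<^sup>2) / l"
    using assms by (simp add: pos_le_divide_eq mult_ac)
  also have "\<dots> = l * (norm x)\<^sup>2 + (norm y)\<^sup>2 / l" using assms by (simp add: field_simps power2_eq_square)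
  finally show ?thesis using Cauchy_Schwarz_ineq2[of x y] by (smt (verit) mult_nonneg_nonneg norm_ge_zero)
qed

lemma expectation_inner_le_weighted:
  assumes X: "square_integrable M X" and Y: "square_integrable M Y" and l: "0 < l"
  shows "\<bar>\<integral>\<omega>. X \<omega> \<bullet> Y \<omega> \<partial>M\<bar> \<le> l * (\<integral>\<omega>. (norm (X \<omega>))\<^sup>2 \<partial>M) + (\<integral>\<omega>. (norm (Y \<omega>))\<^sup>2 \<partial>M) / l"
proof -
  note ii = square_integrable_norm[OF X] square_integrable_norm[OF Y]
  have "\<bar>\<integral>\<omega>. X \<omega> \<bullet> Y \<omega> \<partial>M\<bar> \<le> (\<integral>\<omega>. \<bar>X \<omega> \<bullet> Y \<omega>\<bar> \<partial>M)"
    by (rule integral_abs_bound)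
  also have "\<dots> \<le> (\<integral>\<omega>. l * (norm (X \<omega>))\<^sup>2 + (norm (Y \<omega>))\<^sup>2 / l \<partial>M)"
    by (intro integral_mono integrable_abs square_integrable_inner X Y Bochner_Integration.integrable_add
        integrable_mult_right integrable_divide ii inner_le_weighted l)
  also have "\<dots> = l * (\<integral>\<omega>. (norm (X \<omega>))\<^sup>2 \<partial>M) + (\<integral>\<omega>. (norm (Y \<omega>))\<^sup>2 \<partial>M) / l"
    using ii by simp
  finally show ?thesis .
qed

context wiener_process
begin

lemma block_integral_increment_orthogonal:
  assumes a: "0 \<le> a" "a \<le> b" "adapted_sq a \<xi>" and s: "0 \<le> s" "s \<le> t" and \<eta>: "adapted_sq s \<eta>"
  shows "expectation (\<lambda>\<omega>. \<eta> \<omega> \<bullet> (block_integral a b \<xi> t \<omega> - block_integral a b \<xi> s \<omega>)) = 0"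
proof (cases "max s a \<le> min t b")
  case False
  then have "block_integral a b \<xi> t \<omega> = block_integral a b \<xi> s \<omega>" for \<omega>
    using a s by (cases "b < s") (auto simp: block_integral_def min_def max_def split: if_splits)
  then show ?thesis by simp
next
  case True
  let ?u = "max s a" and ?v = "min t b"
  have "block_integral a b \<xi> t \<omega> - block_integral a b \<xi> s \<omega> = (W ?v \<omega> - W ?u \<omega>) *\<^sub>R \<xi> \<omega>" for \<omega>
    using True a s by (cases "a \<le> s") (auto simp: block_integral_def min_def max_def algebra_simps)
  then show ?thesis
    using expectation_inner_increment[of ?u ?v \<eta> \<xi>] True a s adapted_sq_mono[OF _ \<eta>, of ?u] adapted_sq_mono[OF _ a(3), of ?u]
    by simp
qed

text \<open>The martingale property of elementary integrals. Testing against square integrable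
  variables known at time \<open>s\<close> takes the place of conditional expectations.\<close>

lemma elem_increment_orthogonal:
  assumes "elem Z I" and s: "0 \<le> s" "s \<le> t" and \<eta>: "adapted_sq s \<eta>"
  shows "expectation (\<lambda>\<omega>. \<eta> \<omega> \<bullet> (I t \<omega> - I s \<omega>)) = 0"
  using assms(1)
proof induction
  case (elem_block Z I a b \<xi>)
  note h = elem_block.hyps
  have t: "0 \<le> t" using s by simp
  have si: "square_integrable M \<eta>" "square_integrable M (\<lambda>\<omega>. I t \<omega> - I s \<omega>)"
    "square_integrable M (\<lambda>\<omega>. block_integral a b \<xi> t \<omega> - block_integral a b \<xi> s \<omega>)"
    using elem_adapted[OF h(1) t] elem_adapted[OF h(1) s(1)] adapted_sq_block_integral[OF h(2-4) t]
      adapted_sq_block_integral[OF h(2-4) s(1)] \<eta>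
    by (blast intro: square_integrable_diff adapted_sq_square_integrable)+
  have eq: "\<eta> \<omega> \<bullet> (I t \<omega> + block_integral a b \<xi> t \<omega> - (I s \<omega> + block_integral a b \<xi> s \<omega>)) =
    \<eta> \<omega> \<bullet> (I t \<omega> - I s \<omega>) + \<eta> \<omega> \<bullet> (block_integral a b \<xi> t \<omega> - block_integral a b \<xi> s \<omega>)" for \<omega>
    by (simp add: inner_simps)
  show ?case
    unfolding eq using elem_block.IH block_integral_increment_orthogonal[OF h(2-4) s \<eta>]
    by (subst Bochner_Integration.integral_add) (simp_all add: square_integrable_inner si)
qed simp

end

context switched_sde
begin

definition modes :: "('k \<Rightarrow> real^'n^'n) \<Rightarrow> real \<Rightarrow> real \<Rightarrow> 'w \<Rightarrow> real^'n"
  where "modes A t = off (sw t) t (\<lambda>s \<omega>. A (\<sigma> s) *v y s \<omega>)"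

lemma modes_measurable: "0 \<le> t \<Longrightarrow> (\<lambda>(s, \<omega>). modes A t s \<omega>) \<in> borel_measurable (borel \<Otimes>\<^sub>M M)"
  unfolding modes_def by (rule mode_joint_measurable)

lemma AE_modes: "AE s in lborel. s \<in> {0..t} \<longrightarrow> modes A t s \<omega> = A (\<sigma> s) *v y s \<omega>"
  unfolding modes_def by (rule AE_off[OF finite_sw])

lemma y_square_integrable: "0 \<le> t \<Longrightarrow> square_integrable M (y t)"
proof -
  assume t: "0 \<le> t"
  obtain K where "0 \<le> K" "\<And>s. s \<in> {0..t} \<Longrightarrow> (\<integral>\<^sup>+\<omega>. ennreal ((norm (y s \<omega>))\<^sup>2) \<partial>M) \<le> ennreal K"
    by (rule moment_bound[OF t]) blast
  then show ?thesis using square_integrableI(1)[OF y_measurable[OF t]] t by auto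
qed

lemma y_adapted_sq: "0 \<le> t \<Longrightarrow> adapted_sq t (y t)"
  by (simp add: adapted_sq_def y_adapted y_square_integrable)

lemma mean_energy_modes_le:
  assumes "0 \<le> s" "s \<le> t" and K: "\<And>u. u \<in> {0..t} \<Longrightarrow> (\<integral>\<^sup>+\<omega>. ennreal ((norm (y u \<omega>))\<^sup>2) \<partial>M) \<le> ennreal K"
    and c: "\<And>i x. norm (A i *v x) \<le> c * norm x" "0 \<le> c" and K0: "0 \<le> K"
  shows "mean_energy M {s<..t} (modes A t) \<le> ennreal (c\<^sup>2 * K * (t - s))"
proof -
  have t: "0 \<le> t" using assms by simp
  have "mean_energy M {s<..t} (modes A t) = (\<integral>\<^sup>+u\<in>{s<..t}. (\<integral>\<^sup>+\<omega>. ennreal ((norm (modes A t u \<omega>))\<^sup>2) \<partial>M) \<partial>lborel)"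
    by (rule mean_energy_Tonelli[OF modes_measurable[OF t]]) simp
  also have "\<dots> \<le> (\<integral>\<^sup>+u\<in>{s<..t}. ennreal (c\<^sup>2 * K) \<partial>lborel)"
  proof (rule nn_integral_mono)
    fix u
    have "(\<integral>\<^sup>+\<omega>. ennreal ((norm (modes A t u \<omega>))\<^sup>2) \<partial>M) \<le> ennreal (c\<^sup>2 * K)" if u: "u \<in> {s<..t}"
    proof -
      have u0: "0 \<le> u" using u assms by simp
      note [measurable] = y_measurable[OF u0]
      have "(\<integral>\<^sup>+\<omega>. ennreal ((norm (modes A t u \<omega>))\<^sup>2) \<partial>M) \<le> (\<integral>\<^sup>+\<omega>. ennreal (c\<^sup>2) * ennreal ((norm (y u \<omega>))\<^sup>2) \<partial>M)"
      proof (rule nn_integral_mono)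
        fix \<omega>
        have "norm (modes A t u \<omega>) \<le> c * norm (y u \<omega>)" using c by (auto simp: modes_def off_def indicator_def)
        from power_mono[OF this norm_ge_zero, of 2]
        show "ennreal ((norm (modes A t u \<omega>))\<^sup>2) \<le> ennreal (c\<^sup>2) * ennreal ((norm (y u \<omega>))\<^sup>2)"
          by (simp add: power_mult_distrib ennreal_mult'[symmetric] ennreal_leI)
      qed
      also have "\<dots> = ennreal (c\<^sup>2) * (\<integral>\<^sup>+\<omega>. ennreal ((norm (y u \<omega>))\<^sup>2) \<partial>M)" by (rule nn_integral_cmult) measurable
      also have "\<dots> \<le> ennreal (c\<^sup>2) * ennreal K" using u u0 by (intro mult_left_mono K) auto
      finally show ?thesis using K0 by (simp add: ennreal_mult')
    qed
    then show "(\<integral>\<^sup>+\<omega>. ennreal ((norm (modes A t u \<omega>))\<^sup>2) \<partial>M) * indicator {s<..t} u \<le> ennreal (c\<^sup>2 * K) * indicator {s<..t} u"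
      by (auto simp: indicator_def)
  qed
  also have "\<dots> = ennreal (c\<^sup>2 * K * (t - s))"
    using assms by (subst nn_integral_cmult) (auto simp: ennreal_mult'[symmetric] ennreal_mult''[symmetric])
  finally show ?thesis .
qed

text \<open>The solution is unbounded, so the approximation has two stages. The cut integrands
  converge as the level \<open>n\<close> grows; the error is either 0 or the full integrand, whose
  mean energy is finite by \<open>moment_bound\<close> and therefore dominates. Each cut integrand
  is bounded and has step approximations of its own.\<close>

lemma modes_approximation:
  assumes t: "0 \<le> t"
  obtains Z I K where "\<And>k::nat. elem (Z k) (I k)" "\<And>k s \<omega>. \<omega> \<in> space M \<Longrightarrow> norm (Z k s \<omega>) \<le> K k"
    "(\<lambda>k. mean_energy M {0..t} (\<lambda>s \<omega>. Z k s \<omega> - modes A t s \<omega>)) \<longlonglongrightarrow> 0"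
proof -
  obtain c where c: "0 < c" "\<And>i x. norm (A i *v x) \<le> c * norm x"
    using matrix_family_bound[of A] by blast
  obtain K where K: "0 \<le> K" "\<And>s. s \<in> {0..t} \<Longrightarrow> (\<integral>\<^sup>+\<omega>. ennreal ((norm (y s \<omega>))\<^sup>2) \<partial>M) \<le> ennreal K"
    by (rule moment_bound[OF t]) blast
  let ?X = "\<lambda>n. off (sw t) t (Xcut A n)"
  note mm = modes_measurable[OF t, of A]
  note xm = Xcut_off_measurable[OF t, of A]
  have lim: "(\<lambda>n. mean_energy M {0..t} (\<lambda>s \<omega>. ?X n s \<omega> - modes A t s \<omega>)) \<longlonglongrightarrow> 0"
  proof (rule mean_energy_tendsto_0[where D="\<lambda>s \<omega>. ennreal ((norm (modes A t s \<omega>))\<^sup>2)"])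
    note [measurable] = mm xm
    show "(\<lambda>(s, \<omega>). ?X n s \<omega> - modes A t s \<omega>) \<in> borel_measurable (borel \<Otimes>\<^sub>M M)" for n
      by measurable
    show "(\<lambda>(s, \<omega>). ennreal ((norm (modes A t s \<omega>))\<^sup>2)) \<in> borel_measurable (borel \<Otimes>\<^sub>M M)" by measurable
    have "mean_energy M {0..t} (modes A t) \<le> ennreal (c\<^sup>2 * K * (t - 0))"
      unfolding mean_energy_Icc_eq
      by (rule mean_energy_modes_le[OF order_refl t K(2) c(2) less_imp_le[OF c(1)] K(1)])
    then show "(\<integral>\<^sup>+\<omega>. (\<integral>\<^sup>+s\<in>{0..t}. ennreal ((norm (modes A t s \<omega>))\<^sup>2) \<partial>lborel) \<partial>M) < \<infinity>"
      unfolding mean_energy_def energy_def by (auto intro: le_less_trans)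
  next
    fix s \<omega> assume s: "s \<in> {0..t}" and \<omega>: "\<omega> \<in> space M"
    obtain B where B: "\<And>u. u \<in> {0..t} \<Longrightarrow> norm (y u \<omega>) \<le> B" using path_bounded[OF \<omega>] by blast
    have "\<forall>\<^sub>F n in sequentially. ?X n s \<omega> - modes A t s \<omega> = 0"
      using eventually_ge_at_top[of "nat \<lceil>B\<rceil>"]
    proof eventually_elim
      case (elim n)
      then have "B \<le> real n" by linarith
      then have "\<omega> \<in> below n t" using B \<omega> by (force simp: below_def)
      then show ?case using s cut_eq[of \<omega> n t s] by (simp add: off_def Xcut_def modes_def)
    qed
    then show "(\<lambda>n. ?X n s \<omega> - modes A t s \<omega>) \<longlonglongrightarrow> 0" by (rule tendsto_eventually)
    show "ennreal ((norm (?X n s \<omega> - modes A t s \<omega>))\<^sup>2) \<le> ennreal ((norm (modes A t s \<omega>))\<^sup>2)" for n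
      by (auto simp: off_def Xcut_def modes_def cut_def indicator_def)
  qed simp
  \<comment> \<open>A diagonal choice: for each level \<open>n\<close> one step process within
    \<open>1 / Suc n\<close>, packed into a triple with its integral and its bound so that a single
    choice function suffices.\<close>
  have "\<exists>p. elem (fst p) (fst (snd p)) \<and> (\<forall>s. \<forall>\<omega>\<in>space M. norm (fst p s \<omega>) \<le> snd (snd p)) \<and>
    mean_energy M {0..t} (\<lambda>s \<omega>. fst p s \<omega> - ?X n s \<omega>) < ennreal (1 / Suc n)" for n
  proof -
    obtain Z I K where Z: "\<And>k::nat. elem (Z k) (I k)" "\<And>k s \<omega>. \<omega> \<in> space M \<Longrightarrow> norm (Z k s \<omega>) \<le> K"
      "(\<lambda>k. mean_energy M {0..t} (\<lambda>s \<omega>. Z k s \<omega> - ?X n s \<omega>)) \<longlonglongrightarrow> 0"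
      by (rule Xcut_approximation[OF t, of A n]) blast
    have "\<forall>\<^sub>F k in sequentially. mean_energy M {0..t} (\<lambda>s \<omega>. Z k s \<omega> - ?X n s \<omega>) < ennreal (1 / Suc n)"
      by (rule order_tendstoD(2)[OF Z(3)]) simp
    then obtain k where "mean_energy M {0..t} (\<lambda>s \<omega>. Z k s \<omega> - ?X n s \<omega>) < ennreal (1 / Suc n)"
      by (auto simp: eventually_sequentially)
    with Z show ?thesis by (intro exI[of _ "(Z k, I k, K)"]) simp
  qed
  then have "\<exists>p. \<forall>n. elem (fst (p n)) (fst (snd (p n))) \<and> (\<forall>s. \<forall>\<omega>\<in>space M. norm (fst (p n) s \<omega>) \<le> snd (snd (p n))) \<and>
    mean_energy M {0..t} (\<lambda>s \<omega>. fst (p n) s \<omega> - ?X n s \<omega>) < ennreal (1 / Suc n)"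
    by (intro choice allI)
  then obtain p where p: "\<And>n. elem (fst (p n)) (fst (snd (p n))) \<and> (\<forall>s. \<forall>\<omega>\<in>space M. norm (fst (p n) s \<omega>) \<le> snd (snd (p n))) \<and>
    mean_energy M {0..t} (\<lambda>s \<omega>. fst (p n) s \<omega> - ?X n s \<omega>) < ennreal (1 / Suc n)" by blast
  define Z where "Z n = fst (p n)" for n
  define I where "I n = fst (snd (p n))" for n
  define B where "B n = snd (snd (p n))" for n
  have Z: "\<And>n. elem (Z n) (I n)" "\<And>n s \<omega>. \<omega> \<in> space M \<Longrightarrow> norm (Z n s \<omega>) \<le> B n"
    "\<And>n. mean_energy M {0..t} (\<lambda>s \<omega>. Z n s \<omega> - ?X n s \<omega>) < ennreal (1 / Suc n)"
    using p unfolding Z_def I_def B_def by blast+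
  have le: "mean_energy M {0..t} (\<lambda>s \<omega>. Z n s \<omega> - modes A t s \<omega>) \<le>
    2 * ennreal (1 / Suc n) + 2 * mean_energy M {0..t} (\<lambda>s \<omega>. ?X n s \<omega> - modes A t s \<omega>)" for n
  proof -
    note [measurable] = mm xm elem_joint_measurable[OF Z(1), of n]
    have "mean_energy M {0..t} (\<lambda>s \<omega>. (Z n s \<omega> - ?X n s \<omega>) + (?X n s \<omega> - modes A t s \<omega>)) \<le>
      2 * mean_energy M {0..t} (\<lambda>s \<omega>. Z n s \<omega> - ?X n s \<omega>) + 2 * mean_energy M {0..t} (\<lambda>s \<omega>. ?X n s \<omega> - modes A t s \<omega>)"
      by (rule mean_energy_add_le) measurable
    also have "\<dots> \<le> 2 * ennreal (1 / Suc n) + 2 * mean_energy M {0..t} (\<lambda>s \<omega>. ?X n s \<omega> - modes A t s \<omega>)"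
      by (intro add_mono mult_left_mono less_imp_le[OF Z(3)]) auto
    finally show ?thesis by simp
  qed
  have "(\<lambda>n. mean_energy M {0..t} (\<lambda>s \<omega>. Z n s \<omega> - modes A t s \<omega>)) \<longlonglongrightarrow> 0"
  proof (rule tendsto_sandwich[where f="\<lambda>_. 0"])
    have "(\<lambda>n. 1 / real (Suc n)) \<longlonglongrightarrow> 0" using LIMSEQ_inverse_real_of_nat by (simp add: inverse_eq_divide)
    then have "(\<lambda>n. ennreal (1 / real (Suc n))) \<longlonglongrightarrow> ennreal 0" by (rule tendsto_ennrealI)
    then have "(\<lambda>n. 2 * ennreal (1 / Suc n) + 2 * mean_energy M {0..t} (\<lambda>s \<omega>. ?X n s \<omega> - modes A t s \<omega>)) \<longlonglongrightarrow> 2 * ennreal 0 + 2 * 0"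
      by (intro tendsto_add ennreal_tendsto_cmult lim) auto
    then show "(\<lambda>n. 2 * ennreal (1 / Suc n) + 2 * mean_energy M {0..t} (\<lambda>s \<omega>. ?X n s \<omega> - modes A t s \<omega>)) \<longlonglongrightarrow> 0" by simp
  qed (use le in auto)
  with Z(1,2) show ?thesis using that by blast
qed

end

lemma mean_energy_cong:
  "(\<And>s \<omega>. s \<in> A \<Longrightarrow> \<omega> \<in> space M \<Longrightarrow> norm (Z s \<omega>) = norm (Z' s \<omega>)) \<Longrightarrow> mean_energy M A Z = mean_energy M A Z'"
  unfolding mean_energy_def energy_def
  by (intro nn_integral_cong) (auto simp: indicator_def)

lemma mean_energy_subset:
  assumes "A \<subseteq> B"
  shows "mean_energy M A Z \<le> mean_energy M B Z"
  unfolding mean_energy_def energy_def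
  by (intro nn_integral_mono) (use assms in \<open>auto simp: indicator_def\<close>)

context switched_sde
begin

lemma drift_measurable:
  assumes t: "0 \<le> t"
  shows "drift t \<in> borel_measurable M"
proof -
  have [measurable]: "(\<lambda>(\<omega>, s). modes G t s \<omega>) \<in> borel_measurable (M \<Otimes>\<^sub>M lborel)"
  proof -
    have [measurable]: "(\<lambda>(s, \<omega>). modes G t s \<omega>) \<in> borel_measurable (lborel \<Otimes>\<^sub>M M)"
      using modes_measurable[OF t, of G] unfolding borel_lborel_pair .
    show ?thesis by measurable
  qed
  have "(\<lambda>\<omega>. \<integral>s. modes G t s \<omega> \<partial>lborel) \<in> borel_measurable M"
    by (rule lborel.borel_measurable_lebesgue_integral) measurable
  moreover have "(\<integral>s. modes G t s \<omega> \<partial>lborel) = drift t \<omega>" if \<omega>: "\<omega> \<in> space M" for \<omega>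
    unfolding drift_def set_lebesgue_integral_def
  proof (rule integral_cong_AE)
    show "(\<lambda>s. modes G t s \<omega>) \<in> borel_measurable lborel"
      using joint_measurable_section[OF modes_measurable[OF t] \<omega>] by simp
    show "(\<lambda>s. indicator {0..t} s *\<^sub>R (G (\<sigma> s) *v y s \<omega>)) \<in> borel_measurable lborel"
      using mode_set_integrable(1)[OF \<omega> order_refl t, of G] unfolding set_integrable_def
      by (rule borel_measurable_integrable)
    show "AE s in lborel. modes G t s \<omega> = indicator {0..t} s *\<^sub>R (G (\<sigma> s) *v y s \<omega>)"
      using AE_modes[of t G \<omega>]
    proof eventually_elim
      case (elim s)
      show ?case
      proof (cases "s \<in> {0..t}")
        case True
        then show ?thesis using elim by simp
      next
        case False
        then have "s \<notin> {0<..t} - sw t" by auto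
        then show ?thesis using False by (simp add: modes_def off_def)
      qed
    qed
  qed
  ultimately show ?thesis by (simp cong: measurable_cong)
qed

lemma drift_diff:
  assumes "\<omega> \<in> space M" "0 \<le> s" "s \<le> t"
  shows "drift t \<omega> - drift s \<omega> = (LINT u:{s<..t}|lborel. G (\<sigma> u) *v y u \<omega>)"
proof -
  have un: "{0..t} = {0..s} \<union> {s<..t}" and disj: "{0..s} \<inter> {s<..t} = {}" using assms by auto
  have "drift t \<omega> = drift s \<omega> + (LINT u:{s<..t}|lborel. G (\<sigma> u) *v y u \<omega>)"
    unfolding drift_def un
    by (rule set_integral_Un[OF disj mode_set_integrable(1)[OF assms(1) order_refl assms(2)] mode_set_integrable(2)[OF assms]])
  then show ?thesis by simp
qed

text \<open>Almost surely this is the Ito integral over \<open>{s<..t}\<close>. Expressing it by the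
  solution and its drift avoids fixing a version of the integral at every time, and makes its
  decomposition of \<open>y t - y s\<close> an identity for all \<open>\<omega>\<close>.\<close>

definition noise :: "real \<Rightarrow> real \<Rightarrow> 'w \<Rightarrow> real^'n"
  where "noise s t \<omega> = y t \<omega> - y s \<omega> - (drift t \<omega> - drift s \<omega>)"

lemma noise_measurable: "0 \<le> s \<Longrightarrow> 0 \<le> t \<Longrightarrow> noise s t \<in> borel_measurable M"
  unfolding noise_def[abs_def] using y_measurable drift_measurable by (intro borel_measurable_diff)

lemma modes_restrict: "u \<in> {0..s} \<Longrightarrow> s \<le> t \<Longrightarrow> modes A s u \<omega> = modes A t u \<omega>"
  by (auto simp: modes_def off_def indicator_def sw_def)

text \<open>The integrals up to \<open>s\<close> and up to \<open>t\<close> are given independently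
  of each other. They are linked by one approximating sequence on \<open>{0..t}\<close>, which also
  works on \<open>{0..s}\<close> because restriction does not increase the energy. The second claim
  is an existence statement that hands the martingale property of the approximations on to
  \<open>noise_orthogonal\<close>.\<close>

lemma
  assumes s: "0 \<le> s" "s \<le> t" and \<xi>: "adapted_sq s \<xi>"
  shows noise_estimate: "(\<integral>\<^sup>+\<omega>. ennreal ((norm (noise s t \<omega> - (W t \<omega> - W s \<omega>) *\<^sub>R \<xi> \<omega>))\<^sup>2) \<partial>M) \<le>
      8 * mean_energy M {s<..t} (\<lambda>u \<omega>. modes H t u \<omega> - \<xi> \<omega>)"
    and noise_approximation: "\<exists>V. (\<forall>k::nat. square_integrable M (V k) \<and> (\<forall>\<eta>. adapted_sq s \<eta> \<longrightarrow> expectation (\<lambda>\<omega>. \<eta> \<omega> \<bullet> V k \<omega>) = 0)) \<and>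
      (\<lambda>k. \<integral>\<^sup>+\<omega>. ennreal ((norm (noise s t \<omega> - V k \<omega>))\<^sup>2) \<partial>M) \<longlonglongrightarrow> 0"
proof -
  have t: "0 \<le> t" using s by simp
  obtain Jt where Jt: "has_ito_integral M F W (\<lambda>s \<omega>. H (\<sigma> s) *v y s \<omega>) t Jt"
    and eqt: "AE \<omega> in M. y t \<omega> = y0 + drift t \<omega> + Jt \<omega>" by (rule solution[OF t])
  obtain Js where Js: "has_ito_integral M F W (\<lambda>s \<omega>. H (\<sigma> s) *v y s \<omega>) s Js"
    and eqs: "AE \<omega> in M. y s \<omega> = y0 + drift s \<omega> + Js \<omega>" by (rule solution[OF s(1)])
  have noise: "AE \<omega> in M. noise s t \<omega> = Jt \<omega> - Js \<omega>"
    using eqt eqs by eventually_elim (simp add: noise_def)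
  have [measurable]: "Jt \<in> borel_measurable M" "Js \<in> borel_measurable M"
    using Jt Js unfolding has_ito_integral_def by blast+
  obtain Z I K where Z: "\<And>k::nat. elem (Z k) (I k)" and Zb: "\<And>k s \<omega>. \<omega> \<in> space M \<Longrightarrow> norm (Z k s \<omega>) \<le> K k"
    and lim: "(\<lambda>k. mean_energy M {0..t} (\<lambda>s \<omega>. Z k s \<omega> - modes H t s \<omega>)) \<longlonglongrightarrow> 0"
    by (rule modes_approximation[OF t, of H]) blast
  define \<delta> where "\<delta> k = mean_energy M {0..t} (\<lambda>s \<omega>. Z k s \<omega> - modes H t s \<omega>)" for k
  note [measurable] = modes_measurable[OF t, of H]
  have Zm[measurable]: "(\<lambda>(s, \<omega>). Z k s \<omega>) \<in> borel_measurable (borel \<Otimes>\<^sub>M M)" for k by (rule elem_joint_measurable[OF Z])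
  have [measurable]: "I k t \<in> borel_measurable M" "I k s \<in> borel_measurable M" for k
    using elem_adapted[OF Z t] elem_adapted[OF Z s(1)] adapted_sq_square_integrable square_integrable_measurable by blast+
  have \<xi>m[measurable]: "\<xi> \<in> borel_measurable M" by (rule square_integrable_measurable[OF adapted_sq_square_integrable[OF \<xi>]])
  have [measurable]: "W s \<in> borel_measurable M" "W t \<in> borel_measurable M" using s t by (auto intro: W_measurable)
  have ms: "mean_energy M {0..s} (\<lambda>u \<omega>. Z k u \<omega> - modes H s u \<omega>) \<le> \<delta> k" for k
  proof -
    have "mean_energy M {0..s} (\<lambda>u \<omega>. Z k u \<omega> - modes H s u \<omega>) = mean_energy M {0..s} (\<lambda>u \<omega>. Z k u \<omega> - modes H t u \<omega>)"
      by (rule mean_energy_cong) (use modes_restrict s in auto)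
    also have "\<dots> \<le> \<delta> k" unfolding \<delta>_def by (rule mean_energy_subset) (use s in auto)
    finally show ?thesis .
  qed
  have lims: "(\<lambda>k. mean_energy M {0..s} (\<lambda>u \<omega>. Z k u \<omega> - modes H s u \<omega>)) \<longlonglongrightarrow> 0"
    by (rule tendsto_sandwich[OF _ _ tendsto_const lim]) (use ms in \<open>auto simp: \<delta>_def\<close>)
  have es: "(\<integral>\<^sup>+\<omega>. ennreal ((norm (Js \<omega> - I k s \<omega>))\<^sup>2) \<partial>M) \<le> 2 * \<delta> k" for k
  proof -
    have "(\<integral>\<^sup>+\<omega>\<in>space M. ennreal ((norm (Js \<omega> - I k s \<omega>))\<^sup>2) \<partial>M) \<le> 2 * mean_energy M {0..s} (\<lambda>u \<omega>. modes H s u \<omega> - Z k u \<omega>)"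
      by (rule ito_integral_estimate[OF Js s(1) sets.top modes_measurable[OF s(1)] AE_modes Z Zb lims Z])
    also have "mean_energy M {0..s} (\<lambda>u \<omega>. modes H s u \<omega> - Z k u \<omega>) = mean_energy M {0..s} (\<lambda>u \<omega>. Z k u \<omega> - modes H s u \<omega>)"
      by (rule mean_energy_cong) (simp add: norm_minus_commute)
    also have "2 * \<dots> \<le> 2 * \<delta> k" by (intro mult_left_mono ms) simp
    finally show ?thesis by (simp add: nn_set_integral_space)
  qed
  have et: "(\<integral>\<^sup>+\<omega>. ennreal ((norm (Jt \<omega> - I0 t \<omega>))\<^sup>2) \<partial>M) \<le> 2 * mean_energy M {0..t} (\<lambda>u \<omega>. modes H t u \<omega> - Z0 u \<omega>)"
    if "elem Z0 I0" for Z0 I0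
    using ito_integral_estimate[OF Jt t sets.top modes_measurable[OF t] AE_modes Z Zb lim that]
    by (simp add: nn_set_integral_space)
  have comb: "(\<integral>\<^sup>+\<omega>. ennreal ((norm (noise s t \<omega> - (A \<omega> - I k s \<omega>)))\<^sup>2) \<partial>M) \<le>
    2 * (\<integral>\<^sup>+\<omega>. ennreal ((norm (Jt \<omega> - A \<omega>))\<^sup>2) \<partial>M) + 4 * \<delta> k" if [measurable]: "A \<in> borel_measurable M" for A k
  proof -
    have "(\<integral>\<^sup>+\<omega>. ennreal ((norm (noise s t \<omega> - (A \<omega> - I k s \<omega>)))\<^sup>2) \<partial>M) \<le>
      (\<integral>\<^sup>+\<omega>. 2 * ennreal ((norm (Jt \<omega> - A \<omega>))\<^sup>2) + 2 * ennreal ((norm (Js \<omega> - I k s \<omega>))\<^sup>2) \<partial>M)"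
    proof (rule nn_integral_mono_AE, use noise in eventually_elim)
      case (elim \<omega>)
      have "norm (noise s t \<omega> - (A \<omega> - I k s \<omega>)) = norm ((Jt \<omega> - A \<omega>) - (Js \<omega> - I k s \<omega>))"
        unfolding elim by (simp add: algebra_simps)
      then have "ennreal ((norm (noise s t \<omega> - (A \<omega> - I k s \<omega>)))\<^sup>2) \<le>
        ennreal (2 * (norm (Jt \<omega> - A \<omega>))\<^sup>2 + 2 * (norm (Js \<omega> - I k s \<omega>))\<^sup>2)"
        by (simp only:) (intro ennreal_leI norm_diff_square_le)
      then show ?case by (simp add: ennreal_mult')
    qed
    also have "\<dots> = 2 * (\<integral>\<^sup>+\<omega>. ennreal ((norm (Jt \<omega> - A \<omega>))\<^sup>2) \<partial>M) + 2 * (\<integral>\<^sup>+\<omega>. ennreal ((norm (Js \<omega> - I k s \<omega>))\<^sup>2) \<partial>M)"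
      by (subst nn_integral_add) (auto simp: nn_integral_cmult)
    also have "\<dots> \<le> 2 * (\<integral>\<^sup>+\<omega>. ennreal ((norm (Jt \<omega> - A \<omega>))\<^sup>2) \<partial>M) + 2 * (2 * \<delta> k)"
      by (intro add_left_mono mult_left_mono es) simp
    finally show ?thesis by (simp add: mult.assoc[symmetric])
  qed
  have \<delta>0: "\<delta> \<longlonglongrightarrow> 0" using lim by (simp add: \<delta>_def[abs_def])
  let ?E = "mean_energy M {s<..t} (\<lambda>u \<omega>. modes H t u \<omega> - \<xi> \<omega>)"
  have "(\<integral>\<^sup>+\<omega>. ennreal ((norm (noise s t \<omega> - (W t \<omega> - W s \<omega>) *\<^sub>R \<xi> \<omega>))\<^sup>2) \<partial>M) \<le> 12 * \<delta> k + 8 * ?E" for k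
  proof -
    let ?Z0 = "\<lambda>u \<omega>. indicator {0<..s} u *\<^sub>R (1::real) *\<^sub>R Z k u \<omega> + indicator {s<..t} u *\<^sub>R \<xi> \<omega>"
    let ?I0 = "\<lambda>u \<omega>. (1::real) *\<^sub>R (I k (min u s) \<omega> - I k (min u 0) \<omega>) + block_integral s t \<xi> u \<omega>"
    have e0: "elem ?Z0 ?I0"
      by (intro elem_add elem_single elem_cutoff[OF Z, where B=1] \<xi>) (use s in auto)
    have I0: "?I0 t \<omega> = I k s \<omega> + (W t \<omega> - W s \<omega>) *\<^sub>R \<xi> \<omega>" for \<omega>
      using s t elem_at_0[OF Z, of k \<omega>] by (simp add: block_integral_def min_absorb2)
    have "mean_energy M {0..t} (\<lambda>u \<omega>. modes H t u \<omega> - ?Z0 u \<omega>) =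
      mean_energy M {0..t} (\<lambda>u \<omega>. indicator {0<..s} u *\<^sub>R (modes H t u \<omega> - Z k u \<omega>) + indicator {s<..t} u *\<^sub>R (modes H t u \<omega> - \<xi> \<omega>))"
      by (rule mean_energy_cong) (use s in \<open>auto simp: indicator_def modes_def off_def\<close>)
    also have "\<dots> \<le> 2 * mean_energy M {0..t} (\<lambda>u \<omega>. indicator {0<..s} u *\<^sub>R (modes H t u \<omega> - Z k u \<omega>)) +
      2 * mean_energy M {0..t} (\<lambda>u \<omega>. indicator {s<..t} u *\<^sub>R (modes H t u \<omega> - \<xi> \<omega>))"
      by (rule mean_energy_add_le) measurable
    also have "mean_energy M {0..t} (\<lambda>u \<omega>. indicator {0<..s} u *\<^sub>R (modes H t u \<omega> - Z k u \<omega>)) \<le> \<delta> k"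
    proof -
      have "mean_energy M {0..t} (\<lambda>u \<omega>. indicator {0<..s} u *\<^sub>R (modes H t u \<omega> - Z k u \<omega>)) \<le>
        ennreal (1\<^sup>2) * mean_energy M {0..t} (\<lambda>s \<omega>. Z k s \<omega> - modes H t s \<omega>)"
        by (rule mean_energy_bound) (measurable, auto simp: indicator_def norm_minus_commute)
      then show ?thesis by (simp add: \<delta>_def)
    qed
    also have "mean_energy M {0..t} (\<lambda>u \<omega>. indicator {s<..t} u *\<^sub>R (modes H t u \<omega> - \<xi> \<omega>)) = ?E"
      unfolding mean_energy_def energy_def
      by (intro nn_integral_cong) (use s in \<open>auto simp: indicator_def\<close>)
    finally have "mean_energy M {0..t} (\<lambda>u \<omega>. modes H t u \<omega> - ?Z0 u \<omega>) \<le> 2 * \<delta> k + 2 * ?E"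
      by (simp add: add_right_mono mult_left_mono)
    then have "(\<integral>\<^sup>+\<omega>. ennreal ((norm (Jt \<omega> - ?I0 t \<omega>))\<^sup>2) \<partial>M) \<le> 2 * (2 * \<delta> k + 2 * ?E)"
      using et[OF e0] by (meson mult_left_mono order_trans zero_le)
    then have "2 * (\<integral>\<^sup>+\<omega>. ennreal ((norm (Jt \<omega> - ?I0 t \<omega>))\<^sup>2) \<partial>M) \<le> 2 * (2 * (2 * \<delta> k + 2 * ?E))"
      by (rule mult_left_mono) simp
    moreover have "?I0 t \<in> borel_measurable M" unfolding I0 by measurable
    from comb[OF this, of k] have "(\<integral>\<^sup>+\<omega>. ennreal ((norm (noise s t \<omega> - (W t \<omega> - W s \<omega>) *\<^sub>R \<xi> \<omega>))\<^sup>2) \<partial>M) \<le>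
      2 * (\<integral>\<^sup>+\<omega>. ennreal ((norm (Jt \<omega> - ?I0 t \<omega>))\<^sup>2) \<partial>M) + 4 * \<delta> k"
      unfolding I0 by simp
    ultimately have "(\<integral>\<^sup>+\<omega>. ennreal ((norm (noise s t \<omega> - (W t \<omega> - W s \<omega>) *\<^sub>R \<xi> \<omega>))\<^sup>2) \<partial>M) \<le>
      2 * (2 * (2 * \<delta> k + 2 * ?E)) + 4 * \<delta> k"
      by (meson add_right_mono order_trans)
    also have "\<dots> = (8 * \<delta> k + 8 * ?E) + 4 * \<delta> k" by (simp add: distrib_left mult.assoc[symmetric])
    also have "\<dots> = (8 + 4) * \<delta> k + 8 * ?E" unfolding distrib_right by (simp add: add_ac)
    also have "\<dots> = 12 * \<delta> k + 8 * ?E" by simp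
    finally show ?thesis .
  qed
  moreover have "(\<lambda>k. 12 * \<delta> k + 8 * ?E) \<longlonglongrightarrow> 12 * 0 + 8 * ?E"
    by (intro tendsto_add tendsto_const ennreal_tendsto_cmult \<delta>0) simp
  ultimately show "(\<integral>\<^sup>+\<omega>. ennreal ((norm (noise s t \<omega> - (W t \<omega> - W s \<omega>) *\<^sub>R \<xi> \<omega>))\<^sup>2) \<partial>M) \<le> 8 * ?E"
    by (intro LIMSEQ_le_const[where X="\<lambda>k. 12 * \<delta> k + 8 * ?E"]) auto
  have conv: "(\<lambda>k. \<integral>\<^sup>+\<omega>. ennreal ((norm (noise s t \<omega> - (I k t \<omega> - I k s \<omega>)))\<^sup>2) \<partial>M) \<longlonglongrightarrow> 0"
  proof (rule tendsto_sandwich[where f="\<lambda>_. 0" and h="\<lambda>k. 8 * \<delta> k"])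
    have "(\<lambda>k. 8 * \<delta> k) \<longlonglongrightarrow> 8 * 0" by (intro ennreal_tendsto_cmult \<delta>0) simp
    then show "(\<lambda>k. 8 * \<delta> k) \<longlonglongrightarrow> 0" by simp
    have "(\<integral>\<^sup>+\<omega>. ennreal ((norm (noise s t \<omega> - (I k t \<omega> - I k s \<omega>)))\<^sup>2) \<partial>M) \<le> 8 * \<delta> k" for k
    proof -
      have "mean_energy M {0..t} (\<lambda>u \<omega>. modes H t u \<omega> - Z k u \<omega>) = \<delta> k"
        unfolding \<delta>_def by (rule mean_energy_cong) (simp add: norm_minus_commute)
      then have "(\<integral>\<^sup>+\<omega>. ennreal ((norm (Jt \<omega> - I k t \<omega>))\<^sup>2) \<partial>M) \<le> 2 * \<delta> k" using et[OF Z, of k] by simp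
      then have "2 * (\<integral>\<^sup>+\<omega>. ennreal ((norm (Jt \<omega> - I k t \<omega>))\<^sup>2) \<partial>M) + 4 * \<delta> k \<le> 2 * (2 * \<delta> k) + 4 * \<delta> k"
        by (intro add_right_mono mult_left_mono) auto
      also have "\<dots> = (4 + 4) * \<delta> k" unfolding distrib_right by (simp add: mult.assoc[symmetric])
      finally show ?thesis using comb[of "I k t" k] by (auto intro: order_trans)
    qed
    then show "\<forall>\<^sub>F k in sequentially. (\<integral>\<^sup>+\<omega>. ennreal ((norm (noise s t \<omega> - (I k t \<omega> - I k s \<omega>)))\<^sup>2) \<partial>M) \<le> 8 * \<delta> k" by simp
  qed auto
  show "\<exists>V. (\<forall>k::nat. square_integrable M (V k) \<and> (\<forall>\<eta>. adapted_sq s \<eta> \<longrightarrow> expectation (\<lambda>\<omega>. \<eta> \<omega> \<bullet> V k \<omega>) = 0)) \<and>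
      (\<lambda>k. \<integral>\<^sup>+\<omega>. ennreal ((norm (noise s t \<omega> - V k \<omega>))\<^sup>2) \<partial>M) \<longlonglongrightarrow> 0"
    using conv elem_increment_orthogonal[OF Z s]
      square_integrable_diff[OF adapted_sq_square_integrable[OF elem_adapted[OF Z t]]
        adapted_sq_square_integrable[OF elem_adapted[OF Z s(1)]]]
    by (intro exI[of _ "\<lambda>k \<omega>. I k t \<omega> - I k s \<omega>"]) auto
qed

lemma noise_square_integrable:
  assumes s: "0 \<le> s" "s \<le> t"
  shows "square_integrable M (noise s t)"
proof -
  have t: "0 \<le> t" using s by simp
  obtain h where h: "0 < h" "\<And>i x. norm (H i *v x) \<le> h * norm x" using matrix_family_bound[of H] by blast
  obtain K where K: "0 \<le> K" "\<And>u. u \<in> {0..t} \<Longrightarrow> (\<integral>\<^sup>+\<omega>. ennreal ((norm (y u \<omega>))\<^sup>2) \<partial>M) \<le> ennreal K"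
    by (rule moment_bound[OF t]) blast
  have "(\<integral>\<^sup>+\<omega>. ennreal ((norm (noise s t \<omega>))\<^sup>2) \<partial>M) \<le> 8 * mean_energy M {s<..t} (modes H t)"
    using noise_estimate[OF s adapted_sq_0] by simp
  also have "\<dots> \<le> 8 * ennreal (h\<^sup>2 * K * (t - s))"
    by (intro mult_left_mono mean_energy_modes_le[OF s K(2) h(2) less_imp_le[OF h(1)] K(1)]) auto
  also have "\<dots> = ennreal (8 * (h\<^sup>2 * K * (t - s)))" using ennreal_mult'[of 8] by simp
  finally show ?thesis by (rule square_integrableI(1)[OF noise_measurable[OF s(1) t]]) (use K s in auto)
qed

text \<open>Orthogonality passes to the mean square limit: the weighted inequality is taken first to
  the limit in \<open>k\<close> and then to small weights \<open>l\<close>.\<close>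

lemma noise_orthogonal:
  assumes s: "0 \<le> s" "s \<le> t" and \<eta>: "adapted_sq s \<eta>"
  shows "expectation (\<lambda>\<omega>. \<eta> \<omega> \<bullet> noise s t \<omega>) = 0"
proof -
  obtain V where V: "\<And>k::nat. square_integrable M (V k)" "\<And>k. expectation (\<lambda>\<omega>. \<eta> \<omega> \<bullet> V k \<omega>) = 0"
    and lim: "(\<lambda>k. \<integral>\<^sup>+\<omega>. ennreal ((norm (noise s t \<omega> - V k \<omega>))\<^sup>2) \<partial>M) \<longlonglongrightarrow> 0"
    using noise_approximation[OF s adapted_sq_0] \<eta> by blast
  note \<eta>s = adapted_sq_square_integrable[OF \<eta>] and ns = noise_square_integrable[OF s]
  have ds: "square_integrable M (\<lambda>\<omega>. noise s t \<omega> - V k \<omega>)" for k by (rule square_integrable_diff[OF ns V(1)])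
  define d where "d k = expectation (\<lambda>\<omega>. (norm (noise s t \<omega> - V k \<omega>))\<^sup>2)" for k
  have d: "d \<longlonglongrightarrow> 0"
  proof -
    have "0 \<le> d k" for k by (simp add: d_def)
    moreover have "(\<lambda>k. ennreal (d k)) \<longlonglongrightarrow> ennreal 0"
      using lim unfolding d_def nn_integral_square_integrable[OF ds] by simp
    ultimately show ?thesis by (subst (asm) tendsto_ennreal_iff) auto
  qed
  have le: "\<bar>expectation (\<lambda>\<omega>. \<eta> \<omega> \<bullet> noise s t \<omega>)\<bar> \<le> l * expectation (\<lambda>\<omega>. (norm (\<eta> \<omega>))\<^sup>2) + d k / l" if "0 < l" for l k
  proof -
    have "expectation (\<lambda>\<omega>. \<eta> \<omega> \<bullet> noise s t \<omega>) = expectation (\<lambda>\<omega>. \<eta> \<omega> \<bullet> (noise s t \<omega> - V k \<omega>))"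
      using V(2)[of k] square_integrable_inner[OF \<eta>s ns] square_integrable_inner[OF \<eta>s V(1)]
      by (simp add: inner_diff_right)
    then show ?thesis using expectation_inner_le_weighted[OF \<eta>s ds that, of k] by (simp add: d_def)
  qed
  have le': "\<bar>expectation (\<lambda>\<omega>. \<eta> \<omega> \<bullet> noise s t \<omega>)\<bar> \<le> l * expectation (\<lambda>\<omega>. (norm (\<eta> \<omega>))\<^sup>2)" if l: "0 < l" for l
  proof (rule LIMSEQ_le_const)
    have "(\<lambda>k. l * expectation (\<lambda>\<omega>. (norm (\<eta> \<omega>))\<^sup>2) + d k / l) \<longlonglongrightarrow> l * expectation (\<lambda>\<omega>. (norm (\<eta> \<omega>))\<^sup>2) + 0 / l"
      by (intro tendsto_intros d) (use l in auto)
    then show "(\<lambda>k. l * expectation (\<lambda>\<omega>. (norm (\<eta> \<omega>))\<^sup>2) + d k / l) \<longlonglongrightarrow> l * expectation (\<lambda>\<omega>. (norm (\<eta> \<omega>))\<^sup>2)" by simp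
  qed (use le[OF l] in auto)
  show ?thesis
  proof (rule ccontr)
    let ?x = "\<bar>expectation (\<lambda>\<omega>. \<eta> \<omega> \<bullet> noise s t \<omega>)\<bar>" and ?q = "expectation (\<lambda>\<omega>. (norm (\<eta> \<omega>))\<^sup>2)"
    assume "expectation (\<lambda>\<omega>. \<eta> \<omega> \<bullet> noise s t \<omega>) \<noteq> 0"
    then have x: "0 < ?x" by simp
    have q: "0 \<le> ?q" by simp
    \<comment> \<open>The weight makes \<open>l * ?q\<close> at most half of \<open>?x\<close>;
      adding 1 in the denominator covers \<open>?q = 0\<close>.\<close>
    have "?x \<le> ?x / (2 * (?q + 1)) * ?q" by (rule le') (use x q in \<open>simp add: add_nonneg_pos\<close>)
    also have "\<dots> \<le> ?x / 2"
    proof -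
      have "?q / (?q + 1) \<le> 1" using q by (subst divide_le_eq_1_pos) linarith+
      from mult_left_mono[OF this, of "?x / 2"] show ?thesis by (simp add: field_simps)
    qed
    finally show False using x by simp
  qed
qed

end


section \<open>The moment equation\<close>

context switched_sde
begin

lemma drift_increment_le:
  assumes \<omega>: "\<omega> \<in> space M" and s: "0 \<le> s" "s \<le> t"
  shows "ennreal ((norm (drift t \<omega> - drift s \<omega> - (t - s) *\<^sub>R z))\<^sup>2) \<le>
    ennreal (t - s) * energy {s<..t} (\<lambda>u \<omega>. modes G t u \<omega> - z) \<omega>"
proof -
  have c: "set_integrable lborel {s<..t} (\<lambda>u. z)"
    unfolding set_integrable_def by (intro integrable_scaleR_left integrable_real_indicator) (use s in auto)
  have "(LINT u:{s<..t}|lborel. G (\<sigma> u) *v y u \<omega> - z) = drift t \<omega> - drift s \<omega> - (LINT u:{s<..t}|lborel. z)"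
    unfolding drift_diff[OF \<omega> s] by (rule set_integral_diff(2)[OF mode_set_integrable(2)[OF \<omega> s] c])
  also have "(LINT u:{s<..t}|lborel. z) = (t - s) *\<^sub>R z"
    using s by (simp add: set_integral_const)
  finally have "ennreal ((norm (drift t \<omega> - drift s \<omega> - (t - s) *\<^sub>R z))\<^sup>2) =
    ennreal ((norm (LINT u:{s<..t}|lborel. G (\<sigma> u) *v y u \<omega> - z))\<^sup>2)" by simp
  also have "\<dots> \<le> emeasure lborel {s<..t} * (\<integral>\<^sup>+u\<in>{s<..t}. ennreal ((norm (G (\<sigma> u) *v y u \<omega> - z))\<^sup>2) \<partial>lborel)"
    by (rule norm_set_integral_square_le[OF set_integral_diff(1)[OF mode_set_integrable(2)[OF \<omega> s] c]]) simp
  also have "(\<integral>\<^sup>+u\<in>{s<..t}. ennreal ((norm (G (\<sigma> u) *v y u \<omega> - z))\<^sup>2) \<partial>lborel) = energy {s<..t} (\<lambda>u \<omega>. modes G t u \<omega> - z) \<omega>"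
    unfolding energy_def
    by (rule nn_integral_cong_AE, use AE_modes[of t G \<omega>] in eventually_elim) (use s in \<open>auto simp: indicator_def\<close>)
  finally show ?thesis using s by simp
qed

text \<open>In mean square the path has the regularity of the Wiener process. The noise contributes
  order \<open>t - s\<close>; the drift contributes the square of that, of which one factor is
  bounded by \<open>b\<close>.\<close>

lemma increment_bound:
  assumes b: "0 \<le> b"
  obtains C where "0 \<le> C" "\<And>t. t \<in> {0..b} \<Longrightarrow> (\<integral>\<^sup>+\<omega>. ennreal ((norm (y t \<omega>))\<^sup>2) \<partial>M) \<le> ennreal C"
    "\<And>s t. 0 \<le> s \<Longrightarrow> s \<le> t \<Longrightarrow> t \<le> b \<Longrightarrow> (\<integral>\<^sup>+\<omega>. ennreal ((norm (y t \<omega> - y s \<omega>))\<^sup>2) \<partial>M) \<le> ennreal (C * (t - s))"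
proof -
  obtain g where g: "0 < g" "\<And>i x. norm (G i *v x) \<le> g * norm x" using matrix_family_bound[of G] by blast
  obtain h where h: "0 < h" "\<And>i x. norm (H i *v x) \<le> h * norm x" using matrix_family_bound[of H] by blast
  obtain K where K: "0 \<le> K" "\<And>t. t \<in> {0..b} \<Longrightarrow> (\<integral>\<^sup>+\<omega>. ennreal ((norm (y t \<omega>))\<^sup>2) \<partial>M) \<le> ennreal K"
    by (rule moment_bound[OF b]) blast
  \<comment> \<open>\<open>K\<close> is included so that one constant bounds the moments as well as
    the increments; 16 is twice the 8 of \<open>noise_estimate\<close>, and the last term comes from
    the drift.\<close>
  define C where "C = K + (16 * h\<^sup>2 * K + 2 * b * g\<^sup>2 * K)"
  have nn: "0 \<le> 16 * h\<^sup>2 * K + 2 * b * g\<^sup>2 * K" using K b by simp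
  have C: "0 \<le> C" "K \<le> C" using nn K by (auto simp: C_def)
  have "(\<integral>\<^sup>+\<omega>. ennreal ((norm (y t \<omega> - y s \<omega>))\<^sup>2) \<partial>M) \<le> ennreal (C * (t - s))" if s: "0 \<le> s" "s \<le> t" "t \<le> b" for s t
  proof -
    have t: "0 \<le> t" using s by simp
    have Kt: "\<And>u. u \<in> {0..t} \<Longrightarrow> (\<integral>\<^sup>+\<omega>. ennreal ((norm (y u \<omega>))\<^sup>2) \<partial>M) \<le> ennreal K" using K s by auto
    note [measurable] = noise_measurable[OF s(1) t] energy_measurable[OF modes_measurable[OF t, of G]]
    have "(\<integral>\<^sup>+\<omega>. ennreal ((norm (y t \<omega> - y s \<omega>))\<^sup>2) \<partial>M) \<le>
      (\<integral>\<^sup>+\<omega>. 2 * ennreal ((norm (noise s t \<omega>))\<^sup>2) + 2 * (ennreal (t - s) * energy {s<..t} (modes G t) \<omega>) \<partial>M)"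
    proof (rule nn_integral_mono)
      fix \<omega> assume \<omega>: "\<omega> \<in> space M"
      have "ennreal ((norm (y t \<omega> - y s \<omega>))\<^sup>2) = ennreal ((norm (noise s t \<omega> + (drift t \<omega> - drift s \<omega>)))\<^sup>2)"
        by (simp add: noise_def)
      also have "\<dots> \<le> ennreal (2 * (norm (noise s t \<omega>))\<^sup>2 + 2 * (norm (drift t \<omega> - drift s \<omega>))\<^sup>2)"
        by (intro ennreal_leI norm_add_square_le)
      also have "\<dots> = 2 * ennreal ((norm (noise s t \<omega>))\<^sup>2) + 2 * ennreal ((norm (drift t \<omega> - drift s \<omega>))\<^sup>2)"
        by (simp add: ennreal_mult')
      also have "ennreal ((norm (drift t \<omega> - drift s \<omega>))\<^sup>2) \<le> ennreal (t - s) * energy {s<..t} (modes G t) \<omega>"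
        using drift_increment_le[OF \<omega> s(1,2), of 0] by simp
      finally show "ennreal ((norm (y t \<omega> - y s \<omega>))\<^sup>2) \<le>
        2 * ennreal ((norm (noise s t \<omega>))\<^sup>2) + 2 * (ennreal (t - s) * energy {s<..t} (modes G t) \<omega>)"
        by (simp add: add_left_mono mult_left_mono)
    qed
    also have "\<dots> = 2 * (\<integral>\<^sup>+\<omega>. ennreal ((norm (noise s t \<omega>))\<^sup>2) \<partial>M) + 2 * (ennreal (t - s) * mean_energy M {s<..t} (modes G t))"
      unfolding mean_energy_def by (subst nn_integral_add) (auto simp: nn_integral_cmult)
    also have "\<dots> \<le> 2 * (8 * ennreal (h\<^sup>2 * K * (t - s))) + 2 * (ennreal (t - s) * ennreal (g\<^sup>2 * K * (t - s)))"
    proof (intro add_mono mult_left_mono)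
      have "(\<integral>\<^sup>+\<omega>. ennreal ((norm (noise s t \<omega>))\<^sup>2) \<partial>M) \<le> 8 * mean_energy M {s<..t} (modes H t)"
        using noise_estimate[OF s(1,2) adapted_sq_0] by simp
      also have "\<dots> \<le> 8 * ennreal (h\<^sup>2 * K * (t - s))"
        by (intro mult_left_mono mean_energy_modes_le[OF s(1,2) Kt h(2) less_imp_le[OF h(1)] K(1)]) auto
      finally show "(\<integral>\<^sup>+\<omega>. ennreal ((norm (noise s t \<omega>))\<^sup>2) \<partial>M) \<le> 8 * ennreal (h\<^sup>2 * K * (t - s))" .
      show "mean_energy M {s<..t} (modes G t) \<le> ennreal (g\<^sup>2 * K * (t - s))"
        by (rule mean_energy_modes_le[OF s(1,2) Kt g(2) less_imp_le[OF g(1)] K(1)])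
    qed auto
    also have "\<dots> = ennreal (16 * (h\<^sup>2 * K * (t - s)) + 2 * ((t - s) * (g\<^sup>2 * K * (t - s))))"
    proof -
      have p: "0 \<le> h\<^sup>2 * K * (t - s)" "0 \<le> t - s" "0 \<le> g\<^sup>2 * K * (t - s)" using s K by auto
      have "2 * (8 * ennreal x) = ennreal (16 * x)" for x
        using ennreal_mult'[of 16 x] by (simp add: mult.assoc[symmetric])
      moreover have "2 * (ennreal p * ennreal q) = ennreal (2 * (p * q))" if "0 \<le> p" "0 \<le> q" for p q
        using that by (simp add: ennreal_mult)
      ultimately show ?thesis using p by (simp only: ennreal_plus mult_nonneg_nonneg zero_le_numeral)
    qed
    also have "\<dots> \<le> ennreal (C * (t - s))"
    proof (rule ennreal_leI)
      have "2 * ((t - s) * (g\<^sup>2 * K * (t - s))) \<le> 2 * (b * (g\<^sup>2 * K * (t - s)))"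
        using s K by (intro mult_left_mono mult_right_mono) auto
      then show "16 * (h\<^sup>2 * K * (t - s)) + 2 * ((t - s) * (g\<^sup>2 * K * (t - s))) \<le> C * (t - s)"
        using mult_nonneg_nonneg[OF K(1), of "t - s"] s unfolding C_def by (simp add: algebra_simps)
    qed
    finally show ?thesis .
  qed
  moreover have "(\<integral>\<^sup>+\<omega>. ennreal ((norm (y t \<omega>))\<^sup>2) \<partial>M) \<le> ennreal C" if "t \<in> {0..b}" for t
    using K(2)[OF that] ennreal_leI[OF C(2)] by (rule order_trans)
  ultimately show ?thesis using that[OF C(1)] by blast
qed

text \<open>The cost of freezing the state at its left-end value: an increment of mean square order
  \<open>u - s\<close>, integrated over the interval, gives order 2 in \<open>t - s\<close>. The
  mode is prescribed on the open interval only, since its value at a switching instant is arbitrary;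
  the endpoint \<open>t\<close> joins the exceptional null set.\<close>

lemma mode_increment_energy:
  assumes s: "0 \<le> s" "s \<le> t" and C: "0 \<le> C"
    "\<And>u. s \<le> u \<Longrightarrow> u \<le> t \<Longrightarrow> (\<integral>\<^sup>+\<omega>. ennreal ((norm (y u \<omega> - y s \<omega>))\<^sup>2) \<partial>M) \<le> ennreal (C * (u - s))"
    and mode: "\<And>u. u \<in> {s<..<t} \<Longrightarrow> \<sigma> u = i" and a: "\<And>x. norm (A i *v x) \<le> a * norm x"
  shows "mean_energy M {s<..t} (\<lambda>u \<omega>. modes A t u \<omega> - A i *v y s \<omega>) \<le> ennreal (a\<^sup>2 * (C * (t - s)\<^sup>2))"
proof -
  have t: "0 \<le> t" using s by simp
  let ?D = "off (sw t) t (\<lambda>u \<omega>. y u \<omega> - y s \<omega>)"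
  have Dm: "(\<lambda>(u, \<omega>). ?D u \<omega>) \<in> borel_measurable (borel \<Otimes>\<^sub>M M)"
    by (rule off_measurable[OF t _ sw_borel])
      (use y_measurable s in \<open>auto simp: left_continuous_except_def intro!: tendsto_diff y_tendsto_left borel_measurable_diff\<close>)
  have "energy {s<..t} (\<lambda>u \<omega>. modes A t u \<omega> - A i *v y s \<omega>) \<omega> \<le> ennreal (a\<^sup>2) * energy {s<..t} ?D \<omega>"
    if \<omega>: "\<omega> \<in> space M" for \<omega>
  proof -
    have "AE u in lborel. u \<notin> insert t (sw t)" by (rule AE_not_in_finite) (simp add: finite_sw)
    then have "AE u in lborel. u \<in> {s<..t} \<longrightarrow> modes A t u \<omega> - A i *v y s \<omega> = A i *v ?D u \<omega>"
      by eventually_elim (use mode s in \<open>auto simp: modes_def off_def matrix_vector_mult_diff_distrib\<close>)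
    then have "energy {s<..t} (\<lambda>u \<omega>. modes A t u \<omega> - A i *v y s \<omega>) \<omega> = energy {s<..t} (\<lambda>u \<omega>. A i *v ?D u \<omega>) \<omega>"
      by (rule energy_AE_cong)
    also have "\<dots> \<le> ennreal (a\<^sup>2) * energy {s<..t} ?D \<omega>"
      by (rule energy_bound[where Z="?D" and \<omega>=\<omega>, OF joint_measurable_section[OF Dm \<omega>]]) (use a in auto)
    finally show ?thesis .
  qed
  then have "mean_energy M {s<..t} (\<lambda>u \<omega>. modes A t u \<omega> - A i *v y s \<omega>) \<le> (\<integral>\<^sup>+\<omega>. ennreal (a\<^sup>2) * energy {s<..t} ?D \<omega> \<partial>M)"
    unfolding mean_energy_def by (rule nn_integral_mono)
  also have "\<dots> = ennreal (a\<^sup>2) * mean_energy M {s<..t} ?D"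
    unfolding mean_energy_def by (rule nn_integral_cmult, rule energy_measurable[OF Dm]) simp
  also have "mean_energy M {s<..t} ?D \<le> ennreal (C * (t - s)\<^sup>2)"
  proof -
    have "mean_energy M {s<..t} ?D = (\<integral>\<^sup>+u\<in>{s<..t}. (\<integral>\<^sup>+\<omega>. ennreal ((norm (?D u \<omega>))\<^sup>2) \<partial>M) \<partial>lborel)"
      by (rule mean_energy_Tonelli[OF Dm]) simp
    also have "\<dots> \<le> (\<integral>\<^sup>+u\<in>{s<..t}. ennreal (C * (t - s)) \<partial>lborel)"
    proof (rule nn_integral_mono)
      fix u
      have "(\<integral>\<^sup>+\<omega>. ennreal ((norm (?D u \<omega>))\<^sup>2) \<partial>M) \<le> ennreal (C * (t - s))" if u: "u \<in> {s<..t}"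
      proof -
        have "(\<integral>\<^sup>+\<omega>. ennreal ((norm (?D u \<omega>))\<^sup>2) \<partial>M) \<le> (\<integral>\<^sup>+\<omega>. ennreal ((norm (y u \<omega> - y s \<omega>))\<^sup>2) \<partial>M)"
          by (intro nn_integral_mono) (auto simp: off_def indicator_def)
        also have "\<dots> \<le> ennreal (C * (u - s))" using u by (intro C(2)) auto
        also have "\<dots> \<le> ennreal (C * (t - s))" using u C(1) by (intro ennreal_leI mult_left_mono) auto
        finally show ?thesis .
      qed
      then show "(\<integral>\<^sup>+\<omega>. ennreal ((norm (?D u \<omega>))\<^sup>2) \<partial>M) * indicator {s<..t} u \<le> ennreal (C * (t - s)) * indicator {s<..t} u"
        by (auto simp: indicator_def)
    qed
    also have "\<dots> = ennreal (C * (t - s)\<^sup>2)"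
      using s C(1) by (subst nn_integral_cmult) (auto simp: ennreal_mult'[symmetric] ennreal_mult''[symmetric] power2_eq_square mult.assoc)
    finally show ?thesis .
  qed
  finally show ?thesis using C(1) by (simp add: ennreal_mult' mult_left_mono)
qed

definition moment :: "real^'n^'n \<Rightarrow> real \<Rightarrow> real"
  where "moment Q t = expectation (\<lambda>\<omega>. y t \<omega> \<bullet> (Q *v y t \<omega>))"

text \<open>The infinitesimal generator of the diffusion in mode \<open>i\<close>, acting on
  quadratic forms with symmetric \<open>Q\<close>. It maps quadratic forms to quadratic forms, which
  is why second moments satisfy a closed linear equation.\<close>

definition generator :: "'k \<Rightarrow> real^'n^'n \<Rightarrow> real^'n^'n"
  where "generator i Q = transpose (G i) ** Q + Q ** G i + transpose (H i) ** Q ** H i"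

end

section \<open>Matrices and quadratic forms\<close>

lemma transpose_inner: "x \<bullet> (transpose A *v z) = (A *v x) \<bullet> z"
  for A :: "real^'n^'m"
proof -
  have "x \<bullet> (transpose A *v z) = (z v* A) \<bullet> x" by (simp add: inner_commute)
  also have "\<dots> = z \<bullet> (A *v x)" by (rule dot_lmul_matrix)
  finally show ?thesis by (simp add: inner_commute)
qed

lemma symmetric_inner: "symmetric_matrix Q \<Longrightarrow> x \<bullet> (Q *v z) = (Q *v x) \<bullet> z"
  using transpose_inner[of x Q z] by (simp add: symmetric_matrix_def)

lemma transpose_add: "transpose (A + B) = transpose A + transpose B"
  by (simp add: transpose_def vec_eq_iff)

text \<open>The norm of a matrix as an element of a Euclidean space is the Frobenius norm;
  Cauchy-Schwarz in every row shows that it dominates the operator norm.\<close>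

lemma norm_matrix_vector_le: "norm (A *v x) \<le> norm A * norm x"
  for A :: "real^'n^'m"
proof -
  have "norm (A *v x) = L2_set (\<lambda>i. \<bar>A $ i \<bullet> x\<bar>) UNIV"
    by (simp add: norm_vec_def matrix_vector_mul_component)
  also have "\<dots> \<le> L2_set (\<lambda>i. norm (A $ i) * norm x) UNIV"
    by (intro L2_set_mono Cauchy_Schwarz_ineq2) auto
  also have "\<dots> = norm A * norm x"
    by (simp add: L2_set_left_distrib norm_vec_def[of A])
  finally show ?thesis .
qed

lemma square_integrable_matrix:
  "square_integrable M X \<Longrightarrow> square_integrable M (\<lambda>\<omega>. A *v X \<omega>)" for A :: "real^'m^'l"
  by (rule square_integrable_bound[where c="norm A"])
    (auto dest: square_integrable_measurable simp: norm_matrix_vector_le)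

lemma expectation_matrix_le:
  fixes A :: "real^'m^'l"
  assumes X: "square_integrable M X"
  shows "integral\<^sup>L M (\<lambda>\<omega>. (norm (A *v X \<omega>))\<^sup>2) \<le> (norm A)\<^sup>2 * integral\<^sup>L M (\<lambda>\<omega>. (norm (X \<omega>))\<^sup>2)"
proof -
  have "integral\<^sup>L M (\<lambda>\<omega>. (norm (A *v X \<omega>))\<^sup>2) \<le> integral\<^sup>L M (\<lambda>\<omega>. (norm A)\<^sup>2 * (norm (X \<omega>))\<^sup>2)"
    by (intro integral_mono square_integrable_norm square_integrable_matrix X integrable_mult_right)
      (use power_mono[OF norm_matrix_vector_le norm_ge_zero, of _ _ 2] in \<open>simp add: power_mult_distrib\<close>)
  then show ?thesis by simp
qed

context switched_sde
begin

lemma generator_inner: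
  assumes "symmetric_matrix Q"
  shows "x \<bullet> (generator i Q *v x) = 2 * ((Q *v x) \<bullet> (G i *v x)) + (H i *v x) \<bullet> (Q *v (H i *v x))"
  unfolding generator_def
  by (simp add: matrix_vector_mult_add_rdistrib inner_add_right transpose_inner matrix_vector_mul_assoc[symmetric]
      symmetric_inner[OF assms, of x "G i *v x"] inner_commute[of "G i *v x" "Q *v x"]
      del: transpose_matrix_vector)

lemma generator_symmetric: "symmetric_matrix Q \<Longrightarrow> symmetric_matrix (generator i Q)"
  unfolding generator_def symmetric_matrix_def
  by (simp add: transpose_add matrix_transpose_mul matrix_mul_assoc add.commute)

lemma quadratic_integrable: "0 \<le> t \<Longrightarrow> integrable M (\<lambda>\<omega>. y t \<omega> \<bullet> (Q *v y t \<omega>))"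
proof (rule square_integrable_inner[OF y_square_integrable])
  assume t: "0 \<le> t"
  show "square_integrable M (\<lambda>\<omega>. Q *v y t \<omega>)"
    by (rule square_integrable_bound[OF y_square_integrable[OF t], of _ "norm Q"])
      (use y_measurable[OF t] norm_matrix_vector_le in auto)
qed

lemma moment_bounded:
  assumes t: "0 \<le> t"
  shows "\<bar>moment Q t\<bar> \<le> norm Q * expectation (\<lambda>\<omega>. (norm (y t \<omega>))\<^sup>2)"
proof -
  have "\<bar>moment Q t\<bar> \<le> expectation (\<lambda>\<omega>. \<bar>y t \<omega> \<bullet> (Q *v y t \<omega>)\<bar>)"
    unfolding moment_def by (rule integral_abs_bound)
  also have "\<dots> \<le> expectation (\<lambda>\<omega>. norm Q * (norm (y t \<omega>))\<^sup>2)"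
  proof (intro integral_mono integrable_abs quadratic_integrable t integrable_mult_right square_integrable_norm y_square_integrable)
    fix \<omega>
    have "\<bar>y t \<omega> \<bullet> (Q *v y t \<omega>)\<bar> \<le> norm (y t \<omega>) * (norm Q * norm (y t \<omega>))"
      by (rule order_trans[OF Cauchy_Schwarz_ineq2 mult_left_mono[OF norm_matrix_vector_le]]) simp
    then show "\<bar>y t \<omega> \<bullet> (Q *v y t \<omega>)\<bar> \<le> norm Q * (norm (y t \<omega>))\<^sup>2"
      by (simp add: power2_eq_square mult_ac)
  qed
  finally show ?thesis by simp
qed

text \<open>The two errors of one Euler-Maruyama step. Both integrands deviate from their frozen
  values by energy of order 2 in \<open>t - s\<close>; the drift gains another factor from
  Cauchy-Schwarz in time, the noise does not.\<close>

lemma remainder_bounds: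
  assumes s: "0 \<le> s" "s < t" and C: "0 \<le> C"
    "\<And>u. s \<le> u \<Longrightarrow> u \<le> t \<Longrightarrow> (\<integral>\<^sup>+\<omega>. ennreal ((norm (y u \<omega> - y s \<omega>))\<^sup>2) \<partial>M) \<le> ennreal (C * (u - s))"
    and mode: "\<And>u. u \<in> {s<..<t} \<Longrightarrow> \<sigma> u = i"
  defines "\<rho>1 \<equiv> \<lambda>\<omega>. drift t \<omega> - drift s \<omega> - (t - s) *\<^sub>R (G i *v y s \<omega>)"
    and "\<rho>2 \<equiv> \<lambda>\<omega>. noise s t \<omega> - (W t \<omega> - W s \<omega>) *\<^sub>R (H i *v y s \<omega>)"
  shows "square_integrable M \<rho>1" "expectation (\<lambda>\<omega>. (norm (\<rho>1 \<omega>))\<^sup>2) \<le> (norm (G i))\<^sup>2 * C * (t - s) ^ 3"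
    "square_integrable M \<rho>2" "expectation (\<lambda>\<omega>. (norm (\<rho>2 \<omega>))\<^sup>2) \<le> 8 * (norm (H i))\<^sup>2 * C * (t - s)\<^sup>2"
proof -
  have s': "s \<le> t" and t: "0 \<le> t" using s by auto
  note [measurable] = y_measurable[OF s(1)] drift_measurable[OF s(1)] drift_measurable[OF t]
    noise_measurable[OF s(1) t] W_measurable[OF s(1)] W_measurable[OF t] modes_measurable[OF t]
  have aH: "adapted_sq s (\<lambda>\<omega>. H i *v y s \<omega>)"
    unfolding adapted_sq_def
    by (intro conjI matrix_vector_measurable y_adapted square_integrable_matrix y_square_integrable s(1))
  have "(\<integral>\<^sup>+\<omega>. ennreal ((norm (\<rho>1 \<omega>))\<^sup>2) \<partial>M) \<le>
    (\<integral>\<^sup>+\<omega>. ennreal (t - s) * energy {s<..t} (\<lambda>u \<omega>. modes G t u \<omega> - G i *v y s \<omega>) \<omega> \<partial>M)"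
  proof (rule nn_integral_mono)
    fix \<omega> assume "\<omega> \<in> space M"
    from drift_increment_le[OF this s(1) s', of "G i *v y s \<omega>"]
    show "ennreal ((norm (\<rho>1 \<omega>))\<^sup>2) \<le> ennreal (t - s) * energy {s<..t} (\<lambda>u \<omega>. modes G t u \<omega> - G i *v y s \<omega>) \<omega>"
      by (simp add: \<rho>1_def energy_def)
  qed
  also have "\<dots> = ennreal (t - s) * mean_energy M {s<..t} (\<lambda>u \<omega>. modes G t u \<omega> - G i *v y s \<omega>)"
    unfolding mean_energy_def by (rule nn_integral_cmult, rule energy_measurable) measurable
  also have "\<dots> \<le> ennreal (t - s) * ennreal ((norm (G i))\<^sup>2 * (C * (t - s)\<^sup>2))"
    by (intro mult_left_mono mode_increment_energy[OF s(1) s' C mode norm_matrix_vector_le]) auto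
  also have "\<dots> = ennreal ((norm (G i))\<^sup>2 * C * (t - s) ^ 3)"
    using s C by (simp add: ennreal_mult'[symmetric] power3_eq_cube power2_eq_square mult_ac)
  finally have 1: "(\<integral>\<^sup>+\<omega>. ennreal ((norm (\<rho>1 \<omega>))\<^sup>2) \<partial>M) \<le> ennreal ((norm (G i))\<^sup>2 * C * (t - s) ^ 3)" .
  have m1: "\<rho>1 \<in> borel_measurable M" unfolding \<rho>1_def by measurable
  show "square_integrable M \<rho>1" "expectation (\<lambda>\<omega>. (norm (\<rho>1 \<omega>))\<^sup>2) \<le> (norm (G i))\<^sup>2 * C * (t - s) ^ 3"
    using square_integrableI[OF m1 1] s C by auto
  have "(\<integral>\<^sup>+\<omega>. ennreal ((norm (\<rho>2 \<omega>))\<^sup>2) \<partial>M) \<le> 8 * mean_energy M {s<..t} (\<lambda>u \<omega>. modes H t u \<omega> - H i *v y s \<omega>)"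
    unfolding \<rho>2_def by (rule noise_estimate[OF s(1) s' aH])
  also have "\<dots> \<le> 8 * ennreal ((norm (H i))\<^sup>2 * (C * (t - s)\<^sup>2))"
    by (intro mult_left_mono mode_increment_energy[OF s(1) s' C mode norm_matrix_vector_le]) auto
  also have "\<dots> = ennreal (8 * (norm (H i))\<^sup>2 * C * (t - s)\<^sup>2)"
    using ennreal_mult'[of 8 "(norm (H i))\<^sup>2 * (C * (t - s)\<^sup>2)"] by (simp add: mult_ac)
  finally have 2: "(\<integral>\<^sup>+\<omega>. ennreal ((norm (\<rho>2 \<omega>))\<^sup>2) \<partial>M) \<le> ennreal (8 * (norm (H i))\<^sup>2 * C * (t - s)\<^sup>2)" .
  have m2: "\<rho>2 \<in> borel_measurable M" unfolding \<rho>2_def by measurable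
  show "square_integrable M \<rho>2" "expectation (\<lambda>\<omega>. (norm (\<rho>2 \<omega>))\<^sup>2) \<le> 8 * (norm (H i))\<^sup>2 * C * (t - s)\<^sup>2"
    using square_integrableI[OF m2 2] s C by auto
qed


text \<open>With step length \<open>a\<close>, the increment splits into a frozen Wiener part
  \<open>N\<close> with second moment of order \<open>a\<close> and a rest \<open>w\<close> with
  second moment of order \<open>a\<^sup>2\<close>. The quadratic form of \<open>N\<close> and the
  drift term give the generator; every mixed or remaining term is of order
  \<open>a * sqrt a\<close>.\<close>

lemma moment_estimate:
  assumes b: "0 \<le> b" and Q: "symmetric_matrix Q"
  obtains c where "0 \<le> c" "\<And>s t i. 0 \<le> s \<Longrightarrow> s < t \<Longrightarrow> t \<le> b \<Longrightarrow> (\<And>u. u \<in> {s<..<t} \<Longrightarrow> \<sigma> u = i) \<Longrightarrow>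
    \<bar>moment Q t - moment Q s - (t - s) * moment (generator i Q) s\<bar> \<le> c * ((t - s) * sqrt (t - s))"
proof -
  obtain C where C: "0 \<le> C" "\<And>t. t \<in> {0..b} \<Longrightarrow> (\<integral>\<^sup>+\<omega>. ennreal ((norm (y t \<omega>))\<^sup>2) \<partial>M) \<le> ennreal C"
    "\<And>s t. 0 \<le> s \<Longrightarrow> s \<le> t \<Longrightarrow> t \<le> b \<Longrightarrow> (\<integral>\<^sup>+\<omega>. ennreal ((norm (y t \<omega> - y s \<omega>))\<^sup>2) \<partial>M) \<le> ennreal (C * (t - s))"
    by (rule increment_bound[OF b]) blast
  \<comment> \<open>Summing over all modes makes the final constant independent of the active
    mode.\<close>
  define g where "g = (\<Sum>i\<in>UNIV. (norm (G i))\<^sup>2)"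
  define h where "h = (\<Sum>i\<in>UNIV. (norm (H i))\<^sup>2)"
  have g: "(norm (G i))\<^sup>2 \<le> g" and h: "(norm (H i))\<^sup>2 \<le> h" for i
    unfolding g_def h_def by (rule member_le_sum; simp)+
  have g0: "0 \<le> g" and h0: "0 \<le> h" unfolding g_def h_def by (auto intro: sum_nonneg)
  define q where "q = (norm Q)\<^sup>2"
  have q0: "0 \<le> q" by (simp add: q_def)
  \<comment> \<open>The constant for the second moment of \<open>w\<close> relative to
    \<open>a\<^sup>2\<close>: three summands with a factor 3 each, where one power of
    \<open>a\<close> in the bound \<open>a ^ 3\<close> for \<open>\<rho>1\<close> is replaced by
    \<open>b\<close>. The next constant \<open>c\<close> collects \<open>B1\<close> and
    \<open>B2\<close>, both doubled, and \<open>B3\<close>.\<close>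
  define w3 where "w3 = 3 * (g * C) + 3 * (g * C * b) + 3 * (8 * h * C)"
  have w3: "0 \<le> w3" using g0 h0 C(1) b by (simp add: w3_def)
  define c where "c = 2 * (q * C + g * C) + 2 * (q * (h * C) + w3) + (q * w3 + w3) * sqrt b"
  have c0: "0 \<le> c" using g0 h0 C(1) b w3 q0 by (simp add: c_def)
  have "\<bar>moment Q t - moment Q s - (t - s) * moment (generator i Q) s\<bar> \<le> c * ((t - s) * sqrt (t - s))"
    if s: "0 \<le> s" "s < t" "t \<le> b" and mode: "\<And>u. u \<in> {s<..<t} \<Longrightarrow> \<sigma> u = i" for s t i
  proof -
    have s': "s \<le> t" and t: "0 \<le> t" and sb: "s \<in> {0..b}" using s by auto
    define a where "a = t - s"
    have a: "0 < a" "a \<le> b" using s by (auto simp: a_def)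
    define r where "r = sqrt a"
    have r: "0 < r" "r * r = a" "r \<le> sqrt b" using a by (auto simp: r_def)
    define \<rho>1 where "\<rho>1 \<omega> = drift t \<omega> - drift s \<omega> - (t - s) *\<^sub>R (G i *v y s \<omega>)" for \<omega>
    define N where "N \<omega> = (W t \<omega> - W s \<omega>) *\<^sub>R (H i *v y s \<omega>)" for \<omega>
    define \<rho>2 where "\<rho>2 \<omega> = noise s t \<omega> - N \<omega>" for \<omega>
    have Cs: "\<And>u. s \<le> u \<Longrightarrow> u \<le> t \<Longrightarrow> (\<integral>\<^sup>+\<omega>. ennreal ((norm (y u \<omega> - y s \<omega>))\<^sup>2) \<partial>M) \<le> ennreal (C * (u - s))"
      using C(3) s by auto
    note rb0 = remainder_bounds[OF s(1,2) C(1) Cs mode]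
    have rb: "square_integrable M \<rho>1" "expectation (\<lambda>\<omega>. (norm (\<rho>1 \<omega>))\<^sup>2) \<le> (norm (G i))\<^sup>2 * C * (t - s) ^ 3"
      "square_integrable M \<rho>2" "expectation (\<lambda>\<omega>. (norm (\<rho>2 \<omega>))\<^sup>2) \<le> 8 * (norm (H i))\<^sup>2 * C * (t - s)\<^sup>2"
      unfolding \<rho>1_def[abs_def] \<rho>2_def[abs_def] N_def by - (rule rb0; simp)+
    have sy: "square_integrable M (y s)" by (rule y_square_integrable[OF s(1)])
    have aY: "adapted_sq s (y s)" by (rule y_adapted_sq[OF s(1)])
    have lin: "adapted_sq s (\<lambda>\<omega>. A *v X \<omega>)" if "adapted_sq s X" for A :: "real^'n^'n" and X
      using that unfolding adapted_sq_def by (auto intro: matrix_vector_measurable square_integrable_matrix)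
    have aH: "adapted_sq s (\<lambda>\<omega>. H i *v y s \<omega>)" by (rule lin[OF aY])
    have aQH: "adapted_sq s (\<lambda>\<omega>. Q *v (H i *v y s \<omega>))" by (rule lin[OF aH])
    have aQ: "adapted_sq s (\<lambda>\<omega>. Q *v y s \<omega>)" by (rule lin[OF aY])
    have sN: "square_integrable M N"
      unfolding N_def[abs_def] by (rule adapted_sq_square_integrable[OF adapted_sq_increment[OF s(1) s' aH]])
    note sQ = adapted_sq_square_integrable[OF aQ]
    have sG: "square_integrable M (\<lambda>\<omega>. G i *v y s \<omega>)" by (rule square_integrable_matrix[OF sy])
    define w where "w \<omega> = a *\<^sub>R (G i *v y s \<omega>) + \<rho>1 \<omega> + \<rho>2 \<omega>" for \<omega>
    have sw: "square_integrable M w"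
      unfolding w_def[abs_def] by (intro square_integrable_add square_integrable_scaleR sG rb)
    have yt: "y t \<omega> = y s \<omega> + (N \<omega> + w \<omega>)" for \<omega>
      by (simp add: w_def \<rho>1_def \<rho>2_def noise_def a_def)
    have Ey: "expectation (\<lambda>\<omega>. (norm (y s \<omega>))\<^sup>2) \<le> C"
      by (rule square_integrableI(2)[OF y_measurable[OF s(1)] C(2)[OF sb] C(1)])
    have E1: "expectation (\<lambda>\<omega>. (norm (\<rho>1 \<omega>))\<^sup>2) \<le> g * C * a ^ 3"
      using rb(2) mult_right_mono[OF g, of "C * a ^ 3" i] C(1) a by (simp add: a_def mult.assoc)
    have E2: "expectation (\<lambda>\<omega>. (norm (\<rho>2 \<omega>))\<^sup>2) \<le> 8 * h * C * a\<^sup>2"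
      using rb(4) mult_right_mono[OF h, of "C * a\<^sup>2" i] C(1) a by (simp add: a_def mult.assoc)
    have EG: "expectation (\<lambda>\<omega>. (norm (a *\<^sub>R (G i *v y s \<omega>)))\<^sup>2) \<le> g * C * a\<^sup>2"
    proof -
      have "expectation (\<lambda>\<omega>. (norm (G i *v y s \<omega>))\<^sup>2) \<le> g * C"
        by (rule order_trans[OF expectation_matrix_le[OF sy] mult_mono[OF g Ey g0]]) simp
      from mult_right_mono[OF this, of "a\<^sup>2"] show ?thesis by (simp add: power_mult_distrib mult.commute)
    qed
    have EN: "expectation (\<lambda>\<omega>. (norm (N \<omega>))\<^sup>2) \<le> h * C * a"
    proof -
      have "expectation (\<lambda>\<omega>. (norm (N \<omega>))\<^sup>2) = a * expectation (\<lambda>\<omega>. (norm (H i *v y s \<omega>))\<^sup>2)"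
        using expectation_increment_increment[OF s(1) s' aH aH] by (simp only: N_def a_def power2_norm_eq_inner)
      also have "\<dots> \<le> a * (h * C)"
        using a by (intro mult_left_mono order_trans[OF expectation_matrix_le[OF sy] mult_mono[OF h Ey h0]]) auto
      finally show ?thesis by (simp add: mult_ac)
    qed
    have EQN: "expectation (\<lambda>\<omega>. (norm (Q *v N \<omega>))\<^sup>2) \<le> q * (h * C * a)"
      unfolding q_def by (rule order_trans[OF expectation_matrix_le[OF sN] mult_left_mono[OF EN]]) simp
    have EQ: "expectation (\<lambda>\<omega>. (norm (Q *v y s \<omega>))\<^sup>2) \<le> q * C"
      unfolding q_def by (rule order_trans[OF expectation_matrix_le[OF sy] mult_left_mono[OF Ey]]) simp
    have Ew: "expectation (\<lambda>\<omega>. (norm (w \<omega>))\<^sup>2) \<le> w3 * a\<^sup>2"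
    proof -
      have "expectation (\<lambda>\<omega>. (norm (w \<omega>))\<^sup>2) \<le>
        expectation (\<lambda>\<omega>. 3 * (norm (a *\<^sub>R (G i *v y s \<omega>)))\<^sup>2 + 3 * (norm (\<rho>1 \<omega>))\<^sup>2 + 3 * (norm (\<rho>2 \<omega>))\<^sup>2)"
        by (rule integral_mono[OF square_integrable_norm[OF sw]], unfold w_def)
          (intro Bochner_Integration.integrable_add integrable_mult_right square_integrable_norm
            square_integrable_scaleR sG rb norm_add3_square_le)+
      also have "\<dots> = 3 * expectation (\<lambda>\<omega>. (norm (a *\<^sub>R (G i *v y s \<omega>)))\<^sup>2) +
        3 * expectation (\<lambda>\<omega>. (norm (\<rho>1 \<omega>))\<^sup>2) + 3 * expectation (\<lambda>\<omega>. (norm (\<rho>2 \<omega>))\<^sup>2)"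
        using square_integrable_norm[OF square_integrable_scaleR[OF sG]] square_integrable_norm[OF rb(1)]
          square_integrable_norm[OF rb(3)] by simp
      also have "\<dots> \<le> 3 * (g * C * a\<^sup>2) + 3 * (g * C * a ^ 3) + 3 * (8 * h * C * a\<^sup>2)"
        using EG E1 E2 by (intro add_mono mult_left_mono) auto
      also have "\<dots> \<le> 3 * (g * C * a\<^sup>2) + 3 * (g * C * (b * a\<^sup>2)) + 3 * (8 * h * C * a\<^sup>2)"
      proof -
        have "a ^ 3 \<le> b * a\<^sup>2" using a by (simp add: power3_eq_cube power2_eq_square)
        then show ?thesis using g0 C(1) by (intro add_mono mult_left_mono order_refl) auto
      qed
      also have "\<dots> = w3 * a\<^sup>2" by (simp add: w3_def algebra_simps)
      finally show ?thesis .
    qed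
    \<comment> \<open>In the term linear in \<open>Q *v y s \<omega>\<close>, \<open>N\<close> and
      \<open>\<rho>2\<close> are recombined to the full noise, whose contribution has mean zero.
      Cauchy-Schwarz alone would bound the contribution of \<open>\<rho>2\<close> only by order
      \<open>a\<close>, the order of the generator term.\<close>
    have exp: "y t \<omega> \<bullet> (Q *v y t \<omega>) = y s \<omega> \<bullet> (Q *v y s \<omega>) +
      (2 * ((Q *v y s \<omega>) \<bullet> noise s t \<omega>) + 2 * a * ((Q *v y s \<omega>) \<bullet> (G i *v y s \<omega>)) + 2 * ((Q *v y s \<omega>) \<bullet> \<rho>1 \<omega>) +
       N \<omega> \<bullet> (Q *v N \<omega>) + 2 * ((Q *v N \<omega>) \<bullet> w \<omega>) + (Q *v w \<omega>) \<bullet> w \<omega>)" for \<omega>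
    proof -
      have nw: "N \<omega> + w \<omega> = noise s t \<omega> + a *\<^sub>R (G i *v y s \<omega>) + \<rho>1 \<omega>" by (simp add: w_def \<rho>2_def)
      have "y t \<omega> \<bullet> (Q *v y t \<omega>) = y s \<omega> \<bullet> (Q *v y s \<omega>) + 2 * ((Q *v y s \<omega>) \<bullet> (N \<omega> + w \<omega>)) + (N \<omega> + w \<omega>) \<bullet> (Q *v (N \<omega> + w \<omega>))"
        unfolding yt using symmetric_inner[OF Q, of "y s \<omega>" "N \<omega> + w \<omega>"]
        by (simp only: matrix_vector_right_distrib[of Q "y s \<omega>"] inner_add_left[of "y s \<omega>"] inner_add_right[of _ "Q *v y s \<omega>"] inner_commute[of "N \<omega> + w \<omega>" "Q *v y s \<omega>"])
      also have "(Q *v y s \<omega>) \<bullet> (N \<omega> + w \<omega>) = (Q *v y s \<omega>) \<bullet> noise s t \<omega> + a * ((Q *v y s \<omega>) \<bullet> (G i *v y s \<omega>)) + (Q *v y s \<omega>) \<bullet> \<rho>1 \<omega>"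
        unfolding nw by (simp add: inner_add_right)
      also have "(N \<omega> + w \<omega>) \<bullet> (Q *v (N \<omega> + w \<omega>)) = N \<omega> \<bullet> (Q *v N \<omega>) + 2 * ((Q *v N \<omega>) \<bullet> w \<omega>) + (Q *v w \<omega>) \<bullet> w \<omega>"
        using symmetric_inner[OF Q, of "N \<omega>" "w \<omega>"]
        by (simp add: matrix_vector_right_distrib inner_add_left inner_add_right inner_commute)
      finally show ?thesis by (simp add: algebra_simps)
    qed
    have ns: "square_integrable M (noise s t)" by (rule noise_square_integrable[OF s(1) s'])
    note ints = quadratic_integrable[OF s(1)] square_integrable_inner[OF sQ ns] square_integrable_inner[OF sQ sG]
      square_integrable_inner[OF sQ rb(1)] square_integrable_inner[OF sN square_integrable_matrix[OF sN]]
      square_integrable_inner[OF square_integrable_matrix[OF sN] sw] square_integrable_inner[OF square_integrable_matrix[OF sw] sw]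
    have mt: "moment Q t = moment Q s + (2 * expectation (\<lambda>\<omega>. (Q *v y s \<omega>) \<bullet> noise s t \<omega>) +
      2 * a * expectation (\<lambda>\<omega>. (Q *v y s \<omega>) \<bullet> (G i *v y s \<omega>)) + 2 * expectation (\<lambda>\<omega>. (Q *v y s \<omega>) \<bullet> \<rho>1 \<omega>) +
      expectation (\<lambda>\<omega>. N \<omega> \<bullet> (Q *v N \<omega>)) + 2 * expectation (\<lambda>\<omega>. (Q *v N \<omega>) \<bullet> w \<omega>) + expectation (\<lambda>\<omega>. (Q *v w \<omega>) \<bullet> w \<omega>))"
      unfolding moment_def exp using ints by simp
    have n0: "expectation (\<lambda>\<omega>. (Q *v y s \<omega>) \<bullet> noise s t \<omega>) = 0" by (rule noise_orthogonal[OF s(1) s' aQ])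
    have NN: "expectation (\<lambda>\<omega>. N \<omega> \<bullet> (Q *v N \<omega>)) = a * expectation (\<lambda>\<omega>. (H i *v y s \<omega>) \<bullet> (Q *v (H i *v y s \<omega>)))"
      using expectation_increment_increment[OF s(1) s' aH aQH]
      by (simp add: N_def a_def matrix_vector_mult_scaleR)
    have gen: "moment (generator i Q) s = 2 * expectation (\<lambda>\<omega>. (Q *v y s \<omega>) \<bullet> (G i *v y s \<omega>)) +
      expectation (\<lambda>\<omega>. (H i *v y s \<omega>) \<bullet> (Q *v (H i *v y s \<omega>)))"
      unfolding moment_def generator_inner[OF Q]
      using square_integrable_inner[OF sQ sG] square_integrable_inner[OF adapted_sq_square_integrable[OF aH] adapted_sq_square_integrable[OF aQH]]
      by simp
    \<comment> \<open>The weights balance the two terms of the inequality: \<open>a * r\<close> for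
      second moments of order 1 and \<open>a ^ 3\<close>, in \<open>B2\<close> the weight
      \<open>r\<close> for orders \<open>a\<close> and \<open>a\<^sup>2\<close>. In
      \<open>B3\<close> both are of order \<open>a\<^sup>2\<close>, and one \<open>r\<close> is
      bounded by \<open>sqrt b\<close>.\<close>
    have B1: "\<bar>expectation (\<lambda>\<omega>. (Q *v y s \<omega>) \<bullet> \<rho>1 \<omega>)\<bar> \<le> (q * C + g * C) * (a * r)"
    proof -
      have "\<bar>expectation (\<lambda>\<omega>. (Q *v y s \<omega>) \<bullet> \<rho>1 \<omega>)\<bar> \<le>
        (a * r) * expectation (\<lambda>\<omega>. (norm (Q *v y s \<omega>))\<^sup>2) + expectation (\<lambda>\<omega>. (norm (\<rho>1 \<omega>))\<^sup>2) / (a * r)"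
        by (rule expectation_inner_le_weighted[OF sQ rb(1)]) (use a r in simp)
      also have "\<dots> \<le> (a * r) * (q * C) + (g * C * a ^ 3) / (a * r)"
        using a r by (intro add_mono mult_left_mono divide_right_mono EQ E1) auto
      also have "(g * C * a ^ 3) / (a * r) = g * C * (a * r)"
      proof -
        have "a ^ 3 / (a * r) = a * r" using a r by (simp add: field_simps power3_eq_cube)
        then show ?thesis by (simp add: divide_inverse mult.assoc)
      qed
      finally show ?thesis by (simp add: algebra_simps)
    qed
    have B2: "\<bar>expectation (\<lambda>\<omega>. (Q *v N \<omega>) \<bullet> w \<omega>)\<bar> \<le> (q * (h * C) + w3) * (a * r)"
    proof -
      have "\<bar>expectation (\<lambda>\<omega>. (Q *v N \<omega>) \<bullet> w \<omega>)\<bar> \<le>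
        r * expectation (\<lambda>\<omega>. (norm (Q *v N \<omega>))\<^sup>2) + expectation (\<lambda>\<omega>. (norm (w \<omega>))\<^sup>2) / r"
        by (rule expectation_inner_le_weighted[OF square_integrable_matrix[OF sN] sw r(1)])
      also have "\<dots> \<le> r * (q * (h * C * a)) + (w3 * a\<^sup>2) / r"
        using r by (intro add_mono mult_left_mono divide_right_mono EQN Ew) auto
      also have "(w3 * a\<^sup>2) / r = w3 * (a * r)"
      proof -
        have "a\<^sup>2 / r = a * r" using r by (simp add: field_simps power2_eq_square)
        then show ?thesis by (simp add: divide_inverse mult.assoc)
      qed
      finally show ?thesis by (simp add: algebra_simps)
    qed
    have B3: "\<bar>expectation (\<lambda>\<omega>. (Q *v w \<omega>) \<bullet> w \<omega>)\<bar> \<le> (q * w3 + w3) * sqrt b * (a * r)"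
    proof -
      have "\<bar>expectation (\<lambda>\<omega>. (Q *v w \<omega>) \<bullet> w \<omega>)\<bar> \<le>
        1 * expectation (\<lambda>\<omega>. (norm (Q *v w \<omega>))\<^sup>2) + expectation (\<lambda>\<omega>. (norm (w \<omega>))\<^sup>2) / 1"
        by (rule expectation_inner_le_weighted[OF square_integrable_matrix[OF sw] sw]) simp
      also have "\<dots> \<le> 1 * (q * (w3 * a\<^sup>2)) + w3 * a\<^sup>2 / 1"
        unfolding q_def
        by (intro add_mono mult_left_mono divide_right_mono Ew order_trans[OF expectation_matrix_le[OF sw]]) auto
      also have "\<dots> = (q * w3 + w3) * (r * (a * r))" using r(2) by (simp add: algebra_simps power2_eq_square)
      also have "\<dots> \<le> (q * w3 + w3) * (sqrt b * (a * r))"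
        using r a q0 w3 by (intro mult_left_mono mult_right_mono) auto
      finally show ?thesis by (simp add: mult.assoc)
    qed
    have "moment Q t - moment Q s - a * moment (generator i Q) s =
      2 * expectation (\<lambda>\<omega>. (Q *v y s \<omega>) \<bullet> \<rho>1 \<omega>) + 2 * expectation (\<lambda>\<omega>. (Q *v N \<omega>) \<bullet> w \<omega>) + expectation (\<lambda>\<omega>. (Q *v w \<omega>) \<bullet> w \<omega>)"
      unfolding mt gen n0 NN by (simp add: algebra_simps)
    then have "\<bar>moment Q t - moment Q s - a * moment (generator i Q) s\<bar> \<le>
      2 * ((q * C + g * C) * (a * r)) + 2 * ((q * (h * C) + w3) * (a * r)) + (q * w3 + w3) * sqrt b * (a * r)"
      using B1 B2 B3 by linarith
    also have "\<dots> = c * (a * r)" by (simp add: c_def algebra_simps)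
    finally show ?thesis by (simp add: a_def r_def)
  qed
  with c0 show ?thesis using that by blast
qed

end

section \<open>Differential calculus from one-step estimates\<close>

lemma continuous_from_increments:
  fixes f g :: "real \<Rightarrow> real"
  assumes est: "\<And>s t. c \<le> s \<Longrightarrow> s < t \<Longrightarrow> t \<le> d \<Longrightarrow> \<bar>f t - f s - (t - s) * g s\<bar> \<le> C * ((t - s) * sqrt (t - s))"
    and B: "\<And>s. s \<in> {c..d} \<Longrightarrow> \<bar>g s\<bar> \<le> B" and nn: "0 \<le> C" "0 \<le> B" "c \<le> d"
  shows "continuous_on {c..d} f"
proof (rule lipschitz_on_continuous_on[where L="B + C * sqrt (d - c)"], rule lipschitz_onI)
  have le: "\<bar>f t - f s\<bar> \<le> (B + C * sqrt (d - c)) * (t - s)" if st: "c \<le> s" "s < t" "t \<le> d" for s t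
  proof -
    have "\<bar>f t - f s\<bar> \<le> \<bar>(t - s) * g s\<bar> + C * ((t - s) * sqrt (t - s))" using est[OF st] by linarith
    also have "\<dots> \<le> (t - s) * B + C * ((t - s) * sqrt (d - c))"
      using B[of s] st nn by (intro add_mono mult_left_mono) (auto simp: abs_mult)
    finally show ?thesis by (simp add: algebra_simps)
  qed
  show "dist (f x) (f y) \<le> (B + C * sqrt (d - c)) * dist x y" if "x \<in> {c..d}" "y \<in> {c..d}" for x y
    using le[of x y] le[of y x] that by (cases x y rule: linorder_cases) (auto simp: dist_real_def)
qed (use nn in simp)

text \<open>The one-step estimate refers to the left end of each interval. A difference quotient
  taken to the left of \<open>t\<close> is therefore close to \<open>g x\<close>, not to
  \<open>g t\<close>, and continuity of \<open>g\<close> bridges the gap.\<close>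

lemma derivative_from_increments:
  fixes f g :: "real \<Rightarrow> real"
  assumes est: "\<And>s t. c \<le> s \<Longrightarrow> s < t \<Longrightarrow> t \<le> d \<Longrightarrow> \<bar>f t - f s - (t - s) * g s\<bar> \<le> C * ((t - s) * sqrt (t - s))"
    and g: "continuous_on {c..d} g" and t: "t \<in> {c..d}"
  shows "(f has_real_derivative g t) (at t within {c..d})"
  unfolding has_field_derivative_iff
proof (rule LIM_zero_cancel, rule Lim_null_comparison)
  have "((\<lambda>x. C * sqrt \<bar>x - t\<bar> + \<bar>g x - g t\<bar>) \<longlongrightarrow> C * sqrt \<bar>t - t\<bar> + \<bar>g t - g t\<bar>) (at t within {c..d})"
    using g t by (intro tendsto_intros) (auto simp: continuous_on_def)
  then show "((\<lambda>x. C * sqrt \<bar>x - t\<bar> + \<bar>g x - g t\<bar>) \<longlongrightarrow> 0) (at t within {c..d})" by simp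
  have quot: "\<bar>(f v - f u) / (v - u) - g u\<bar> \<le> C * sqrt (v - u)" if uv: "c \<le> u" "u < v" "v \<le> d" for u v
  proof -
    have "(f v - f u) / (v - u) - g u = (f v - f u - (v - u) * g u) / (v - u)" using uv by (simp add: field_simps)
    then have "\<bar>(f v - f u) / (v - u) - g u\<bar> = \<bar>f v - f u - (v - u) * g u\<bar> / (v - u)" using uv by simp
    also have "\<dots> \<le> C * ((v - u) * sqrt (v - u)) / (v - u)" by (rule divide_right_mono[OF est[OF uv]]) (use uv in simp)
    finally show ?thesis using uv by simp
  qed
  show "\<forall>\<^sub>F x in at t within {c..d}. norm ((f x - f t) / (x - t) - g t) \<le> C * sqrt \<bar>x - t\<bar> + \<bar>g x - g t\<bar>"
    unfolding eventually_at_filter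
  proof (intro always_eventually allI impI)
    fix x assume x: "x \<noteq> t" "x \<in> {c..d}"
    consider "t < x" | "x < t" using x by linarith
    then show "norm ((f x - f t) / (x - t) - g t) \<le> C * sqrt \<bar>x - t\<bar> + \<bar>g x - g t\<bar>"
    proof cases
      case 1
      then show ?thesis using quot[of t x] x t by simp
    next
      case 2
      have "(f x - f t) / (x - t) = (f t - f x) / (t - x)" by (metis minus_diff_eq minus_divide_divide)
      then show ?thesis using quot[of x t] x t 2 by simp
    qed
  qed
qed

text \<open>Gronwall's inequality in differential form: \<open>exp (- (k * t)) * f t\<close> does
  not increase. It is applied with negative \<open>k\<close> for decay, nonnegative \<open>k\<close>
  for growth, and \<open>k = 0\<close> in the dwell phase; neither \<open>k\<close> nor
  \<open>f\<close> has a prescribed sign.\<close>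

lemma exponential_estimate:
  fixes f f' :: "real \<Rightarrow> real"
  assumes cd: "c \<le> d" and f: "\<And>t. t \<in> {c..d} \<Longrightarrow> (f has_real_derivative f' t) (at t within {c..d})"
    and le: "\<And>t. t \<in> {c..d} \<Longrightarrow> f' t \<le> k * f t"
  shows "f d \<le> exp (k * (d - c)) * f c"
proof -
  let ?h = "\<lambda>t. exp (- (k * t)) * f t"
  have D: "(?h has_real_derivative exp (- (k * t)) * (f' t - k * f t)) (at t within {c..d})" if "t \<in> {c..d}" for t
    by (auto intro!: derivative_eq_intros f[OF that] simp: algebra_simps)
  have "?h d \<le> ?h c"
  proof (rule DERIV_nonpos_imp_decreasing_open[OF cd])
    fix x assume x: "c < x" "x < d"
    have "exp (- (k * x)) * (f' x - k * f x) \<le> 0"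
      using le[of x] x by (intro mult_nonneg_nonpos) auto
    then show "\<exists>y. (?h has_real_derivative y) (at x) \<and> y \<le> 0"
      using D[of x] x by (auto simp: at_within_Icc_at)
  qed (rule DERIV_continuous_on[OF D])
  then have "exp (k * d) * ?h d \<le> exp (k * d) * ?h c" by (rule mult_left_mono) simp
  then show ?thesis by (simp add: mult.assoc[symmetric] exp_add[symmetric] right_diff_distrib)
qed

context switched_sde
begin

lemma second_moment_bound:
  assumes "0 \<le> b"
  obtains C where "0 \<le> C" "\<And>t. t \<in> {0..b} \<Longrightarrow> expectation (\<lambda>\<omega>. (norm (y t \<omega>))\<^sup>2) \<le> C"
proof -
  obtain C where C: "0 \<le> C" "\<And>t. t \<in> {0..b} \<Longrightarrow> (\<integral>\<^sup>+\<omega>. ennreal ((norm (y t \<omega>))\<^sup>2) \<partial>M) \<le> ennreal C"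
    by (rule moment_bound[OF assms]) blast
  show ?thesis
    by (rule that[OF C(1)], rule square_integrableI(2)[OF y_measurable C(2) C(1)]) auto
qed

text \<open>Continuity of \<open>moment Q\<close> rests only on a bound for the moment of
  \<open>generator i Q\<close>. This order prevents a circle: the derivative of
  \<open>moment Q\<close> requires continuity of the moment of \<open>generator i Q\<close>, which
  is the present lemma for another matrix.\<close>

lemma moment_continuous:
  assumes cd: "0 \<le> c" "c \<le> d" and mode: "\<And>u. u \<in> {c<..<d} \<Longrightarrow> \<sigma> u = i" and Q: "symmetric_matrix Q"
  shows "continuous_on {c..d} (moment Q)"
proof -
  have d: "0 \<le> d" using cd by simp
  obtain k where k: "0 \<le> k" "\<And>s t i. 0 \<le> s \<Longrightarrow> s < t \<Longrightarrow> t \<le> d \<Longrightarrow> (\<And>u. u \<in> {s<..<t} \<Longrightarrow> \<sigma> u = i) \<Longrightarrow>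
    \<bar>moment Q t - moment Q s - (t - s) * moment (generator i Q) s\<bar> \<le> k * ((t - s) * sqrt (t - s))"
    by (rule moment_estimate[OF d Q]) blast
  obtain C where C: "0 \<le> C" "\<And>t. t \<in> {0..d} \<Longrightarrow> expectation (\<lambda>\<omega>. (norm (y t \<omega>))\<^sup>2) \<le> C"
    by (rule second_moment_bound[OF d]) blast
  show ?thesis
  proof (rule continuous_from_increments[where g="moment (generator i Q)" and C=k and B="norm (generator i Q) * C"])
    show "\<bar>moment Q t - moment Q s - (t - s) * moment (generator i Q) s\<bar> \<le> k * ((t - s) * sqrt (t - s))"
      if "c \<le> s" "s < t" "t \<le> d" for s t
      by (rule k(2)) (use that cd mode in auto)
    show "\<bar>moment (generator i Q) s\<bar> \<le> norm (generator i Q) * C" if "s \<in> {c..d}" for s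
      by (rule order_trans[OF moment_bounded mult_left_mono[OF C(2)]]) (use that cd in auto)
  qed (use k C cd in auto)
qed

lemma moment_derivative:
  assumes cd: "0 \<le> c" "c \<le> d" and mode: "\<And>u. u \<in> {c<..<d} \<Longrightarrow> \<sigma> u = i" and Q: "symmetric_matrix Q"
    and t: "t \<in> {c..d}"
  shows "(moment Q has_real_derivative moment (generator i Q) t) (at t within {c..d})"
proof -
  have d: "0 \<le> d" using cd by simp
  obtain k where k: "0 \<le> k" "\<And>s t i. 0 \<le> s \<Longrightarrow> s < t \<Longrightarrow> t \<le> d \<Longrightarrow> (\<And>u. u \<in> {s<..<t} \<Longrightarrow> \<sigma> u = i) \<Longrightarrow>
    \<bar>moment Q t - moment Q s - (t - s) * moment (generator i Q) s\<bar> \<le> k * ((t - s) * sqrt (t - s))"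
    by (rule moment_estimate[OF d Q]) blast
  show ?thesis
  proof (rule derivative_from_increments[where C=k])
    show "\<bar>moment Q t - moment Q s - (t - s) * moment (generator i Q) s\<bar> \<le> k * ((t - s) * sqrt (t - s))"
      if "c \<le> s" "s < t" "t \<le> d" for s t
      by (rule k(2)) (use that cd mode in auto)
    show "continuous_on {c..d} (moment (generator i Q))"
      by (rule moment_continuous[OF cd mode generator_symmetric[OF Q]])
  qed (rule t)
qed

lemma moment_add: "0 \<le> t \<Longrightarrow> moment (A + B) t = moment A t + moment B t"
  unfolding moment_def
  by (simp add: matrix_vector_mult_add_rdistrib inner_add_right quadratic_integrable)

lemma moment_scaleR: "moment (c *\<^sub>R A) t = c * moment A t"
  unfolding moment_def by (simp add: scaleR_matrix_vector_assoc[symmetric])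

lemma moment_diff: "0 \<le> t \<Longrightarrow> moment (A - B) t = moment A t - moment B t"
  unfolding moment_def
  by (simp add: matrix_vector_mult_diff_rdistrib inner_diff_right quadratic_integrable)

lemma moment_mono:
  assumes "0 \<le> t" "\<And>x. x \<bullet> (A *v x) \<le> x \<bullet> (B *v x)"
  shows "moment A t \<le> moment B t"
  unfolding moment_def by (intro integral_mono quadratic_integrable assms)

text \<open>A product rule. Moments are linear in the matrix, so the difference quotient splits into
  the error \<open>?E\<close> of the quotient of \<open>S\<close>, the moment of \<open>S'\<close>
  at the moving time, and the quotient with \<open>S \<tau>\<close> held fixed. The error term
  vanishes because second moments are bounded on the interval.\<close>

lemma moment_time_derivative:
  assumes c: "0 \<le> c" and T: "0 < T" and mode: "\<And>u. u \<in> {c<..<c + T} \<Longrightarrow> \<sigma> u = i"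
    and S: "\<And>\<tau>. \<tau> \<in> {0..T} \<Longrightarrow> symmetric_matrix (S \<tau>)"
    and S': "(S has_vector_derivative S') (at \<tau> within {0..T})" "symmetric_matrix S'" and \<tau>: "\<tau> \<in> {0..T}"
  shows "((\<lambda>\<tau>. moment (S \<tau>) (c + \<tau>)) has_real_derivative moment (S' + generator i (S \<tau>)) (c + \<tau>)) (at \<tau> within {0..T})"
  unfolding has_field_derivative_iff
proof (rule Lim_transform_eventually)
  let ?F = "at \<tau> within {0..T}"
  have cT: "c \<le> c + T" "0 \<le> c + T" using T c by auto
  obtain C where C: "0 \<le> C" "\<And>t. t \<in> {0..c + T} \<Longrightarrow> expectation (\<lambda>\<omega>. (norm (y t \<omega>))\<^sup>2) \<le> C"
    by (rule second_moment_bound[OF cT(2)]) blast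
  let ?E = "\<lambda>x. (1 / (x - \<tau>)) *\<^sub>R (S x - S \<tau>) - S'"
  have E0: "((\<lambda>x. norm (?E x) * C) \<longlongrightarrow> 0) ?F"
  proof -
    have "((\<lambda>x. norm (S x - S \<tau> - (x - \<tau>) *\<^sub>R S') / norm (x - \<tau>)) \<longlongrightarrow> 0) ?F"
      using S'(1) unfolding has_vector_derivative_def has_derivative_iff_norm by blast
    then have "((\<lambda>x. norm (?E x)) \<longlongrightarrow> 0) ?F"
    proof (rule Lim_transform_eventually)
      show "\<forall>\<^sub>F x in ?F. norm (S x - S \<tau> - (x - \<tau>) *\<^sub>R S') / norm (x - \<tau>) = norm (?E x)"
        unfolding eventually_at_filter
      proof (intro always_eventually allI impI)
        fix x assume "x \<noteq> \<tau>"
        then have "?E x = (1 / (x - \<tau>)) *\<^sub>R (S x - S \<tau> - (x - \<tau>) *\<^sub>R S')" by (simp add: scaleR_diff_right)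
        then show "norm (S x - S \<tau> - (x - \<tau>) *\<^sub>R S') / norm (x - \<tau>) = norm (?E x)" by (simp add: divide_inverse)
      qed
    qed
    from tendsto_mult[OF this tendsto_const[of C]] show ?thesis by simp
  qed
  have l1: "((\<lambda>x. moment (?E x) (c + x)) \<longlongrightarrow> 0) ?F"
  proof (rule Lim_null_comparison[OF _ E0])
    show "\<forall>\<^sub>F x in ?F. norm (moment (?E x) (c + x)) \<le> norm (?E x) * C"
      unfolding eventually_at_filter
    proof (intro always_eventually allI impI)
      fix x assume "x \<in> {0..T}"
      then show "norm (moment (?E x) (c + x)) \<le> norm (?E x) * C"
        using order_trans[OF moment_bounded mult_left_mono[OF C(2)], of "c + x"] c by auto
    qed
  qed
  have sh: "((\<lambda>x. c + x) \<longlongrightarrow> c + \<tau>) ?F" "\<forall>\<^sub>F x in ?F. c + x \<in> {c..c + T}"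
    by (intro tendsto_intros) (auto simp: eventually_at_filter)
  have l2: "((\<lambda>x. moment S' (c + x)) \<longlongrightarrow> moment S' (c + \<tau>)) ?F"
  proof (rule continuous_on_tendsto_compose[OF _ sh(1) _ sh(2)])
    show "continuous_on {c..c + T} (moment S')" by (rule moment_continuous[OF c cT(1) mode S'(2)])
  qed (use \<tau> in auto)
  have sub: "(\<lambda>x. c + x) ` {0..T} \<subseteq> {c..c + T}" by auto
  have "(moment (S \<tau>) has_real_derivative moment (generator i (S \<tau>)) (c + \<tau>)) (at (c + \<tau>) within {c..c + T})"
    by (rule moment_derivative[OF c cT(1) mode S[OF \<tau>]]) (use \<tau> in auto)
  then have "(moment (S \<tau>) has_real_derivative moment (generator i (S \<tau>)) (c + \<tau>)) (at (c + \<tau>) within (\<lambda>x. c + x) ` {0..T})"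
    by (rule DERIV_subset[OF _ sub])
  then have "((\<lambda>x. moment (S \<tau>) (c + x)) has_real_derivative moment (generator i (S \<tau>)) (c + \<tau>) * (0 + 1)) ?F"
    by (rule DERIV_image_chain[unfolded o_def]) (auto intro!: derivative_eq_intros)
  then have l3: "((\<lambda>x. (moment (S \<tau>) (c + x) - moment (S \<tau>) (c + \<tau>)) / (x - \<tau>)) \<longlongrightarrow> moment (generator i (S \<tau>)) (c + \<tau>)) ?F"
    unfolding has_field_derivative_iff by simp
  show "((\<lambda>x. moment (?E x) (c + x) + moment S' (c + x) + (moment (S \<tau>) (c + x) - moment (S \<tau>) (c + \<tau>)) / (x - \<tau>))
    \<longlongrightarrow> moment (S' + generator i (S \<tau>)) (c + \<tau>)) ?F"
    using tendsto_add[OF tendsto_add[OF l1 l2] l3] c \<tau> by (simp add: moment_add)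
  show "\<forall>\<^sub>F x in ?F. moment (?E x) (c + x) + moment S' (c + x) + (moment (S \<tau>) (c + x) - moment (S \<tau>) (c + \<tau>)) / (x - \<tau>) =
    (moment (S x) (c + x) - moment (S \<tau>) (c + \<tau>)) / (x - \<tau>)"
    unfolding eventually_at_filter
  proof (intro always_eventually allI impI)
    fix x assume x: "x \<noteq> \<tau>" "x \<in> {0..T}"
    then have "0 \<le> c + x" using c by simp
    then show "moment (?E x) (c + x) + moment S' (c + x) + (moment (S \<tau>) (c + x) - moment (S \<tau>) (c + \<tau>)) / (x - \<tau>) =
      (moment (S x) (c + x) - moment (S \<tau>) (c + \<tau>)) / (x - \<tau>)"
      using x by (simp add: moment_diff moment_scaleR diff_divide_distrib)
  qed
qed

end

section \<open>Exponential decay\<close>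

text \<open>Each form attains a positive minimum on the compact unit sphere, homogeneity extends the
  bound to all vectors, and finitely many modes share one constant.\<close>

lemma positive_family_bound:
  fixes A :: "'k::finite \<Rightarrow> real^'n^'n"
  assumes pos: "\<And>i x. x \<noteq> 0 \<Longrightarrow> 0 < x \<bullet> (A i *v x)"
  obtains r where "0 < r" "\<And>i x. r * (norm x)\<^sup>2 \<le> x \<bullet> (A i *v x)"
proof -
  have "\<exists>r>0. \<forall>x. r * (norm x)\<^sup>2 \<le> x \<bullet> (A i *v x)" for i
  proof -
    have "continuous_on (sphere 0 1) (\<lambda>x. x \<bullet> (A i *v x))"
      by (intro continuous_intros linear_continuous_on matrix_vector_mul_bounded_linear)
    moreover have "sphere 0 1 \<noteq> ({} :: (real^'n) set)" by simp
    ultimately obtain z where z: "z \<in> sphere 0 1" "\<And>x. x \<in> sphere 0 1 \<Longrightarrow> z \<bullet> (A i *v z) \<le> x \<bullet> (A i *v x)"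
      using continuous_attains_inf[OF compact_sphere] by blast
    have "(z \<bullet> (A i *v z)) * (norm x)\<^sup>2 \<le> x \<bullet> (A i *v x)" for x
    proof (cases "x = 0")
      case False
      define u where "u = (1 / norm x) *\<^sub>R x"
      have x: "x = norm x *\<^sub>R u" and "u \<in> sphere 0 1" using False by (auto simp: u_def)
      then have "(z \<bullet> (A i *v z)) * (norm x)\<^sup>2 \<le> (u \<bullet> (A i *v u)) * (norm x)\<^sup>2" using z(2) by (intro mult_right_mono) auto
      also have "\<dots> = (norm x *\<^sub>R u) \<bullet> (A i *v (norm x *\<^sub>R u))"
        by (simp add: matrix_vector_mult_scaleR power2_eq_square)
      finally show ?thesis using x by simp
    qed simp
    moreover have "0 < z \<bullet> (A i *v z)" using z(1) by (intro pos) auto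
    ultimately show ?thesis by blast
  qed
  then obtain r where r: "\<And>i. 0 < r i" "\<And>i x. r i * (norm x)\<^sup>2 \<le> x \<bullet> (A i *v x)" by metis
  have "Min (range r) * (norm x)\<^sup>2 \<le> x \<bullet> (A i *v x)" for i x
    by (rule order_trans[OF mult_right_mono r(2)]) auto
  moreover have "0 < Min (range r)" using r(1) by auto
  ultimately show ?thesis using that by blast
qed

lemma block_diag_positive:
  fixes B :: "'k::finite \<Rightarrow> real^'n^'n"
  assumes "0 \<prec> block_diag B" "x \<noteq> 0"
  shows "0 < x \<bullet> (B i *v x)"
proof -
  \<comment> \<open>\<open>x\<close> placed in block \<open>i\<close> and 0 in all others, so that
    only this block contributes.\<close>
  define X :: "real^('k \<times> 'n)" where "X = (\<chi> p. if fst p = i then x $ snd p else 0)"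
  have "X \<noteq> 0"
  proof -
    obtain j where "x $ j \<noteq> 0" using assms(2) by (auto simp: vec_eq_iff)
    then have "X $ (i, j) \<noteq> 0" by (simp add: X_def)
    then show ?thesis by auto
  qed
  then have "0 < X \<bullet> (block_diag B *v X)" using assms(1) by (simp add: loewner_less_def)
  also have "X \<bullet> (block_diag B *v X) = (\<Sum>p\<in>UNIV. \<Sum>q\<in>UNIV. X $ p * (block_diag B $ p $ q * X $ q))"
    by (simp add: inner_vec_def matrix_vector_mult_def sum_distrib_left)
  also have "\<dots> = (\<Sum>k\<in>UNIV. \<Sum>a\<in>UNIV. \<Sum>l\<in>UNIV. \<Sum>b\<in>UNIV. X $ (k, a) * (block_diag B $ (k, a) $ (l, b) * X $ (l, b)))"
    by (simp add: UNIV_Times_UNIV[symmetric] sum.cartesian_product' del: UNIV_Times_UNIV)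
  also have "\<dots> = (\<Sum>k\<in>UNIV. if k = i then (\<Sum>a\<in>UNIV. \<Sum>b\<in>UNIV. x $ a * (B i $ a $ b * x $ b)) else 0)"
  proof (rule sum.cong[OF refl])
    fix k
    have "(\<Sum>l\<in>UNIV. \<Sum>b\<in>UNIV. X $ (i, a) * (block_diag B $ (i, a) $ (l, b) * X $ (l, b))) =
      (\<Sum>l\<in>UNIV. if l = i then (\<Sum>b\<in>UNIV. x $ a * (B i $ a $ b * x $ b)) else 0)" for a
      by (rule sum.cong[OF refl]) (simp add: X_def block_diag_def)
    then show "(\<Sum>a\<in>UNIV. \<Sum>l\<in>UNIV. \<Sum>b\<in>UNIV. X $ (k, a) * (block_diag B $ (k, a) $ (l, b) * X $ (l, b))) =
      (if k = i then (\<Sum>a\<in>UNIV. \<Sum>b\<in>UNIV. x $ a * (B i $ a $ b * x $ b)) else 0)"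
      by (auto simp: X_def)
  qed
  also have "\<dots> = x \<bullet> (B i *v x)"
    by (simp add: inner_vec_def matrix_vector_mult_def sum_distrib_left)
  finally show ?thesis .
qed

lemma quadratic_form_le: "x \<bullet> (A *v x) \<le> norm A * (norm x)\<^sup>2" for A :: "real^'n^'n"
proof -
  have "x \<bullet> (A *v x) \<le> norm x * norm (A *v x)" by (rule norm_cauchy_schwarz)
  also have "\<dots> \<le> norm x * (norm A * norm x)" by (intro mult_left_mono norm_matrix_vector_le) simp
  finally show ?thesis by (simp add: power2_eq_square mult_ac)
qed

lemma symmetric_matrix_diff: "symmetric_matrix A \<Longrightarrow> symmetric_matrix B \<Longrightarrow> symmetric_matrix (A - B)"
  by (simp add: symmetric_matrix_def transpose_def vec_eq_iff)

text \<open>Away from its switching instants the signal is locally constant, hence constant on a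
  connected set. Switching instants are positive by definition, so the interval has to lie in the
  positive half-line.\<close>

lemma constant_between_switches:
  assumes "\<And>u. u \<in> {a<..<b} \<Longrightarrow> u \<notin> switching_instants \<sigma>" and a: "0 \<le> a" "a < b"
  obtains i where "\<And>u. u \<in> {a<..<b} \<Longrightarrow> \<sigma> u = i"
proof -
  have "\<sigma> u = \<sigma> ((a + b) / 2)" if u: "u \<in> {a<..<b}" for u
  proof (rule connected_local_const[where A="{a<..<b}"])
    show "\<forall>v\<in>{a<..<b}. \<forall>\<^sub>F w in at v within {a<..<b}. \<sigma> v = \<sigma> w"
    proof
      fix v assume v: "v \<in> {a<..<b}"
      then have "\<forall>\<^sub>F w in nhds v. \<sigma> w = \<sigma> v"
        using assms(1)[OF v] a by (auto simp: switching_instants_def)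
      then show "\<forall>\<^sub>F w in at v within {a<..<b}. \<sigma> v = \<sigma> w"
        by (auto simp: eventually_at_filter elim: eventually_mono)
    qed
  qed (use u a in auto)
  then show ?thesis by (rule that)
qed

section \<open>Decay along the switching instants\<close>

context switched_sde
begin

lemma moment_identity: "moment (mat 1) t = expectation (\<lambda>\<omega>. (norm (y t \<omega>))\<^sup>2)"
  by (simp add: moment_def power2_norm_eq_inner)

lemma symmetric_identity: "symmetric_matrix (mat 1 :: real^'n^'n)"
  by (simp add: symmetric_matrix_def transpose_mat)

text \<open>A switching instant may have the same mode on both sides, since the value of the signal at the
  instant itself is arbitrary. Then the jump condition is not available, but \<open>E[y \<bullet> R\<^sub>i(T) y]\<close> simply
  continues to decay across the instant.\<close>

definition last_switch :: "real \<Rightarrow> real"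
  where "last_switch t = Max (insert 0 (switching_instants \<sigma> \<inter> {0<..<t}))"

text \<open>The maximum ranges over instants strictly before \<open>t\<close>; at a switching
  instant it therefore yields the preceding one, along which the later induction descends. The
  default 0 is the initial time.\<close>

lemma last_switch:
  assumes t: "0 < t"
  shows "last_switch t = 0 \<or> last_switch t \<in> switching_instants \<sigma>" "0 \<le> last_switch t" "last_switch t < t"
    "\<exists>i. \<forall>u\<in>{last_switch t<..<t}. \<sigma> u = i"
proof -
  have fin: "finite (insert 0 (switching_instants \<sigma> \<inter> {0<..<t}))"
    by (rule finite_subset[of _ "insert 0 (sw t)"]) (use finite_sw in \<open>auto simp: sw_def\<close>)
  have mem: "last_switch t \<in> insert 0 (switching_instants \<sigma> \<inter> {0<..<t})"
    unfolding last_switch_def by (rule Max_in[OF fin]) simp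
  show "last_switch t = 0 \<or> last_switch t \<in> switching_instants \<sigma>" "last_switch t < t"
    using mem t by auto
  show nn: "0 \<le> last_switch t" unfolding last_switch_def using fin by (intro Max_ge) auto
  have "u \<notin> switching_instants \<sigma>" if u: "u \<in> {last_switch t<..<t}" for u
  proof
    assume "u \<in> switching_instants \<sigma>"
    then have "u \<le> last_switch t" unfolding last_switch_def using u nn by (intro Max_ge[OF fin]) auto
    with u show False by simp
  qed
  then obtain i where "\<And>u. u \<in> {last_switch t<..<t} \<Longrightarrow> \<sigma> u = i"
    by (rule constant_between_switches[OF _ nn \<open>last_switch t < t\<close>]) blast+
  then show "\<exists>i. \<forall>u\<in>{last_switch t<..<t}. \<sigma> u = i" by blast
qed

text \<open>\<open>?V i\<close>, the moment of \<open>R i T\<close>, is the Lyapunov function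
  followed from one switching instant to the next. In the dwell phase
  \<open>moment (R i \<tau>)\<close> links the two ends. At times inside the phase the second moment
  is allowed to grow exponentially for a duration of at most \<open>T\<close>, which costs only a
  constant factor.\<close>

lemma exponential_stability:
  fixes R R' :: "'k \<Rightarrow> real \<Rightarrow> real^'n^'n" and T \<epsilon> :: real
  assumes T: "0 < T" and \<epsilon>: "0 < \<epsilon>" and dwell: "min_dwell_time T \<sigma>"
    and sym: "\<And>i \<tau>. \<tau> \<in> {0..T} \<Longrightarrow> symmetric_matrix (R i \<tau>)"
    and sym': "\<And>i \<tau>. \<tau> \<in> {0..T} \<Longrightarrow> symmetric_matrix (R' i \<tau>)"
    and deriv: "\<And>i \<tau>. \<tau> \<in> {0..T} \<Longrightarrow> (R i has_vector_derivative R' i \<tau>) (at \<tau> within {0..T})"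
    and pos: "\<And>i x. x \<noteq> 0 \<Longrightarrow> 0 < x \<bullet> (R i T *v x)"
    and neg: "\<And>i x. x \<noteq> 0 \<Longrightarrow> 0 < x \<bullet> ((- generator i (R i T)) *v x)"
    and flow: "\<And>i \<tau> x. \<tau> \<in> {0..T} \<Longrightarrow> x \<bullet> ((R' i \<tau> + generator i (R i \<tau>)) *v x) \<le> 0"
    and jump: "\<And>i j x. i \<noteq> j \<Longrightarrow> x \<bullet> ((R i 0 + \<epsilon> *\<^sub>R mat 1) *v x) \<le> x \<bullet> (R j T *v x)"
  obtains K \<beta> where "0 < \<beta>" "\<And>t. 0 < t \<Longrightarrow> moment (mat 1) t \<le> K * exp (- (\<beta> * t))"
proof -
  let ?m = "moment (mat 1)" and ?V = "\<lambda>i. moment (R i T)"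
  have TT: "T \<in> {0..T}" "0 \<in> {0..T}" using T by auto
  obtain r where r: "0 < r" "\<And>i x. r * (norm x)\<^sup>2 \<le> x \<bullet> (R i T *v x)"
    using positive_family_bound[of "\<lambda>i. R i T"] pos by blast
  obtain \<beta>0 where \<beta>0: "0 < \<beta>0" "\<And>i x. \<beta>0 * (norm x)\<^sup>2 \<le> x \<bullet> ((- generator i (R i T)) *v x)"
    using positive_family_bound[of "\<lambda>i. - generator i (R i T)"] neg by blast
  define \<rho> where "\<rho> = 1 + (\<Sum>i\<in>UNIV. norm (R i T))"
  have \<rho>: "0 < \<rho>" unfolding \<rho>_def by (intro add_pos_nonneg sum_nonneg) auto
  have R\<rho>: "norm (R i T) \<le> \<rho>" for i
    unfolding \<rho>_def using member_le_sum[of i UNIV "\<lambda>i. norm (R i T)"] by simp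
  define \<gamma> where "\<gamma> = (\<Sum>i\<in>UNIV. norm (generator i (mat 1)))"
  have \<gamma>: "0 \<le> \<gamma>" "norm (generator i (mat 1)) \<le> \<gamma>" for i
    unfolding \<gamma>_def using member_le_sum[of i UNIV "\<lambda>i. norm (generator i (mat 1))"] by (auto intro: sum_nonneg)
  \<comment> \<open>One rate for both mechanisms. Below \<open>\<beta>0 / \<rho>\<close> it is a
    decay rate of \<open>?V i\<close> once the dwell phase is over; below
    \<open>\<epsilon> / (\<rho> * T)\<close> the jump factor \<open>1 - \<epsilon> / \<rho>\<close>
    is at most \<open>exp (- (\<beta> * T))\<close>, as if the decay had gone on through the dwell
    phase.\<close>
  define \<beta> where "\<beta> = min (\<beta>0 / \<rho>) (\<epsilon> / (\<rho> * T))"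
  have \<beta>: "0 < \<beta>" using \<beta>0 \<rho> \<epsilon> T by (simp add: \<beta>_def)
  have \<beta>1: "\<beta> * \<rho> \<le> \<beta>0"
  proof -
    have "\<beta> \<le> \<beta>0 / \<rho>" by (simp add: \<beta>_def)
    then show ?thesis using \<rho> by (simp add: pos_le_divide_eq)
  qed
  have \<beta>2: "\<beta> * T \<le> \<epsilon> / \<rho>"
  proof -
    have "\<beta> \<le> \<epsilon> / (\<rho> * T)" by (simp add: \<beta>_def)
    then have "\<beta> * T \<le> \<epsilon> / (\<rho> * T) * T" using T by (intro mult_right_mono) auto
    then show ?thesis using T by simp
  qed
  have scale: "x \<bullet> ((c *\<^sub>R A) *v x) = c * (x \<bullet> (A *v x))" for c x and A :: "real^'n^'n"
    by (simp add: scaleR_matrix_vector_assoc[symmetric])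
  have nrm: "x \<bullet> (mat 1 *v x) = (norm x)\<^sup>2" for x :: "real^'n" by (simp add: power2_norm_eq_inner)
  have m0: "0 \<le> ?m t" for t by (simp add: moment_identity)
  have Vm: "?V i t \<le> \<rho> * ?m t" "r * ?m t \<le> ?V i t" if "0 \<le> t" for i t
  proof -
    have "moment (R i T) t \<le> moment (\<rho> *\<^sub>R mat 1) t"
      by (rule moment_mono[OF that]) (unfold scale nrm, rule order_trans[OF quadratic_form_le mult_right_mono[OF R\<rho>]], simp)
    then show "?V i t \<le> \<rho> * ?m t" by (simp add: moment_scaleR)
    have "moment (r *\<^sub>R mat 1) t \<le> moment (R i T) t"
      by (rule moment_mono[OF that]) (unfold scale nrm, rule r(2))
    then show "r * ?m t \<le> ?V i t" by (simp add: moment_scaleR)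
  qed
  have V0: "0 \<le> ?V i t" if "0 \<le> t" for i t
    using Vm(2)[OF that, of i] m0[of t] r(1) by (meson mult_nonneg_nonneg less_imp_le order_trans)
  have decay: "?V i d \<le> exp (- (\<beta> * (d - c))) * ?V i c"
    if cd: "0 \<le> c" "c \<le> d" and mode: "\<And>u. u \<in> {c<..<d} \<Longrightarrow> \<sigma> u = i" for c d i
  proof -
    have "?V i d \<le> exp ((- \<beta>) * (d - c)) * ?V i c"
    proof (rule exponential_estimate[OF cd(2)])
      fix t assume t: "t \<in> {c..d}"
      show "(?V i has_real_derivative moment (generator i (R i T)) t) (at t within {c..d})"
        by (rule moment_derivative[OF cd mode sym[OF TT(1)] t])
      have "moment (generator i (R i T)) t \<le> moment ((- \<beta>) *\<^sub>R R i T) t"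
      proof (rule moment_mono)
        fix x :: "real^'n"
        have "\<beta> * (x \<bullet> (R i T *v x)) \<le> \<beta> * (\<rho> * (norm x)\<^sup>2)"
          using \<beta> by (intro mult_left_mono order_trans[OF quadratic_form_le mult_right_mono[OF R\<rho>]]) auto
        also have "\<dots> \<le> \<beta>0 * (norm x)\<^sup>2" using mult_right_mono[OF \<beta>1, of "(norm x)\<^sup>2"] by (simp add: mult.assoc)
        also have "\<dots> \<le> - (x \<bullet> (generator i (R i T) *v x))"
          using \<beta>0(2)[of x i] scale[of x "-1" "generator i (R i T)"] by simp
        finally show "x \<bullet> (generator i (R i T) *v x) \<le> x \<bullet> (((- \<beta>) *\<^sub>R R i T) *v x)" unfolding scale by simp
      qed (use t cd in simp)
      then show "moment (generator i (R i T)) t \<le> - \<beta> * ?V i t" by (simp only: moment_scaleR)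
    qed
    then show ?thesis by simp
  qed
  have growth: "?m d \<le> exp (\<gamma> * (d - c)) * ?m c"
    if cd: "0 \<le> c" "c \<le> d" and mode: "\<And>u. u \<in> {c<..<d} \<Longrightarrow> \<sigma> u = i" for c d i
  proof (rule exponential_estimate[OF cd(2)])
    fix t assume t: "t \<in> {c..d}"
    show "(?m has_real_derivative moment (generator i (mat 1)) t) (at t within {c..d})"
      by (rule moment_derivative[OF cd mode symmetric_identity t])
    have "moment (generator i (mat 1)) t \<le> moment (\<gamma> *\<^sub>R mat 1) t"
      by (rule moment_mono) (use t cd in simp, unfold scale nrm, rule order_trans[OF quadratic_form_le mult_right_mono[OF \<gamma>(2)]], simp)
    then show "moment (generator i (mat 1)) t \<le> \<gamma> * ?m t" by (simp only: moment_scaleR)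
  qed
  have dwelling: "?V i (c + T) \<le> moment (R i 0) c"
    if c: "0 \<le> c" and mode: "\<And>u. u \<in> {c<..<c + T} \<Longrightarrow> \<sigma> u = i" for c i
  proof -
    have "moment (R i T) (c + T) \<le> exp (0 * (T - 0)) * moment (R i 0) (c + 0)"
    proof (rule exponential_estimate[where f="\<lambda>\<tau>. moment (R i \<tau>) (c + \<tau>)"])
      fix \<tau> assume \<tau>: "\<tau> \<in> {0..T}"
      show "((\<lambda>\<tau>. moment (R i \<tau>) (c + \<tau>)) has_real_derivative moment (R' i \<tau> + generator i (R i \<tau>)) (c + \<tau>)) (at \<tau> within {0..T})"
        by (rule moment_time_derivative[OF c T mode sym deriv[OF \<tau>] sym'[OF \<tau>] \<tau>])
      have "moment (R' i \<tau> + generator i (R i \<tau>)) (c + \<tau>) \<le> moment 0 (c + \<tau>)"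
        by (rule moment_mono) (use flow[OF \<tau>] c \<tau> in auto)
      then show "moment (R' i \<tau> + generator i (R i \<tau>)) (c + \<tau>) \<le> 0 * moment (R i \<tau>) (c + \<tau>)" by (simp add: moment_def)
    qed (use T in simp)
    then show ?thesis by simp
  qed
  have jumping: "moment (R i 0) c \<le> exp (- (\<beta> * T)) * ?V j c" if "i \<noteq> j" "0 \<le> c" for i j c
  proof -
    have "moment (R i 0 + \<epsilon> *\<^sub>R mat 1) c \<le> ?V j c" by (rule moment_mono[OF that(2) jump[OF that(1)]])
    then have "moment (R i 0) c \<le> ?V j c - \<epsilon> * ?m c" using that by (simp add: moment_add moment_scaleR)
    also have "\<dots> \<le> ?V j c - (\<epsilon> / \<rho>) * ?V j c"
      using mult_left_mono[OF Vm(1)[OF that(2), of j], of "\<epsilon> / \<rho>"] \<epsilon> \<rho> by simp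
    also have "\<dots> = (1 - \<epsilon> / \<rho>) * ?V j c" by (simp add: left_diff_distrib)
    also have "\<dots> \<le> exp (- (\<beta> * T)) * ?V j c"
    proof (rule mult_right_mono[OF _ V0[OF that(2)]])
      have "1 - \<epsilon> / \<rho> \<le> 1 + (- (\<beta> * T))" using \<beta>2 by simp
      also have "\<dots> \<le> exp (- (\<beta> * T))" by (rule exp_ge_add_one_self)
      finally show "1 - \<epsilon> / \<rho> \<le> exp (- (\<beta> * T))" .
    qed
    finally show ?thesis .
  qed
  \<comment> \<open>The first dwell phase is not preceded by a jump, so the second moment may grow
    by \<open>exp (\<gamma> * T)\<close>; \<open>\<rho>\<close> converts it to \<open>?V i\<close>,
    and \<open>exp (\<beta> * T)\<close> makes up for the decay missing in this phase.\<close>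
  define C0 where "C0 = \<rho> * exp (\<gamma> * T) * exp (\<beta> * T) * ?m 0"
  have C0: "0 \<le> C0" using \<rho> m0 by (simp add: C0_def)
  \<comment> \<open>The claim concerns the mode that is left at \<open>t\<close>, since the jump
    condition bounds the new form at age 0 by the form of the old mode. The induction runs over the
    number of switching instants up to \<open>t\<close>.\<close>
  have at_switch: "?V i t \<le> C0 * exp (- (\<beta> * t))"
    if "t \<in> switching_instants \<sigma>" "\<And>u. u \<in> {last_switch t<..<t} \<Longrightarrow> \<sigma> u = i" for t i
    using that
  proof (induction "card (sw t)" arbitrary: t i rule: less_induct)
    case less
    define p where "p = last_switch t"
    have t: "0 < t" using less.prems(1) by (simp add: switching_instants_def)
    note p = last_switch[OF t, folded p_def]
    have mode: "\<And>u. u \<in> {p<..<t} \<Longrightarrow> \<sigma> u = i" using less.prems(2) by (simp add: p_def)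
    have pT: "p + T \<le> t" using dwell p less.prems(1) by (force simp: min_dwell_time_def)
    have start: "?V i t \<le> exp (- (\<beta> * (t - (p + T)))) * ?V i (p + T)"
      by (rule decay) (use p(2) pT T mode in auto)
    have step: "?V i t \<le> C0 * exp (- (\<beta> * t))" if "?V i (p + T) \<le> C0 * exp (- (\<beta> * (p + T)))"
    proof -
      have "?V i t \<le> exp (- (\<beta> * (t - (p + T)))) * (C0 * exp (- (\<beta> * (p + T))))"
        by (rule order_trans[OF start mult_left_mono[OF that]]) simp
      also have "\<dots> = C0 * (exp (- (\<beta> * (t - (p + T)))) * exp (- (\<beta> * (p + T))))" by simp
      also have "\<dots> = C0 * exp (- (\<beta> * t))" unfolding exp_add[symmetric] by (simp add: algebra_simps)
      finally show ?thesis .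
    qed
    show ?case
    proof (cases "p = 0")
      case True
      have "?V i T \<le> \<rho> * ?m T" by (rule Vm(1)) (use T in simp)
      also have "\<dots> \<le> \<rho> * (exp (\<gamma> * (T - 0)) * ?m 0)"
        using \<rho> T mode pT True by (intro mult_left_mono growth) auto
      also have "\<dots> = C0 * exp (- (\<beta> * T))" by (simp add: C0_def exp_minus field_simps)
      finally show ?thesis using True by (intro step) simp
    next
      case False
      then have ps: "p \<in> switching_instants \<sigma>" and p0: "0 < p" using p by auto
      have "t \<in> sw t" "t \<notin> sw p" "sw p \<subseteq> sw t" using less.prems(1) p(3) by (auto simp: sw_def)
      then have sub: "sw p \<subset> sw t" by blast
      obtain j where j: "\<And>u. u \<in> {last_switch p<..<p} \<Longrightarrow> \<sigma> u = j" using last_switch(4)[OF p0] by blast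
      have IH: "?V j p \<le> C0 * exp (- (\<beta> * p))"
        by (rule less.hyps[OF psubset_card_mono[OF finite_sw sub] ps j])
      have "?V i (p + T) \<le> exp (- (\<beta> * T)) * ?V j p"
      proof (cases "i = j")
        case True
        have "?V i (p + T) \<le> exp (- (\<beta> * (p + T - p))) * ?V i p"
          by (rule decay) (use p(2) pT T mode in auto)
        then show ?thesis using True by simp
      next
        case False
        have "?V i (p + T) \<le> moment (R i 0) p" by (rule dwelling) (use p(2) pT mode in auto)
        also have "\<dots> \<le> exp (- (\<beta> * T)) * ?V j p" by (rule jumping[OF False p(2)])
        finally show ?thesis .
      qed
      also have "\<dots> \<le> exp (- (\<beta> * T)) * (C0 * exp (- (\<beta> * p)))" by (rule mult_left_mono[OF IH]) simp
      also have "\<dots> = C0 * (exp (- (\<beta> * T)) * exp (- (\<beta> * p)))" by simp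
      also have "\<dots> = C0 * exp (- (\<beta> * (p + T)))" unfolding exp_add[symmetric] by (simp add: algebra_simps)
      finally show ?thesis by (rule step)
    qed
  qed
  \<comment> \<open>The first summand serves the case that no switch precedes \<open>t\<close>, the
    second the case that \<open>p\<close> is a switching instant, where \<open>r\<close> converts
    \<open>?V j\<close> back to the second moment.\<close>
  define C1 where "C1 = ?m 0 + C0 / r"
  have C1: "0 \<le> C1" using C0 r m0 by (simp add: C1_def)
  \<comment> \<open>The 1 is for times within the dwell phase, where growth alone is used;
    \<open>\<rho> / r\<close> is for later times, where the bound passes to \<open>?V i\<close> and
    back. In both cases growth lasts at most \<open>T\<close>, and \<open>exp (\<beta> * T)\<close>
    pays for the decay missing meanwhile.\<close>
  define L where "L = (1 + \<rho> / r) * (exp (\<gamma> * T) * exp (\<beta> * T))"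
  have "?m t \<le> (L * C1) * exp (- (\<beta> * t))" if t: "0 < t" for t
  proof -
    define p where "p = last_switch t"
    note p = last_switch[OF t, folded p_def]
    obtain i where mode: "\<And>u. u \<in> {p<..<t} \<Longrightarrow> \<sigma> u = i" using p(4) by blast
    have mp: "?m p \<le> C1 * exp (- (\<beta> * p))"
    proof (cases "p = 0")
      case True
      then show ?thesis using C0 r by (simp add: C1_def)
    next
      case False
      then have ps: "p \<in> switching_instants \<sigma>" and p0: "0 < p" using p by auto
      obtain j where j: "\<And>u. u \<in> {last_switch p<..<p} \<Longrightarrow> \<sigma> u = j" using last_switch(4)[OF p0] by blast
      have "r * ?m p \<le> C0 * exp (- (\<beta> * p))" by (rule order_trans[OF Vm(2)[OF p(2)] at_switch[OF ps j]])
      then have "?m p \<le> C0 / r * exp (- (\<beta> * p))" using r(1) by (simp add: field_simps)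
      also have "\<dots> \<le> C1 * exp (- (\<beta> * p))" using m0 by (intro mult_right_mono) (auto simp: C1_def)
      finally show ?thesis .
    qed
    have step: "?m t \<le> L * exp (- (\<beta> * (t - p))) * ?m p"
    proof (cases "t \<le> p + T")
      case True
      have "?m t \<le> exp (\<gamma> * (t - p)) * ?m p" by (rule growth) (use p mode in auto)
      also have "\<dots> \<le> L * exp (- (\<beta> * (t - p))) * ?m p"
      proof (rule mult_right_mono[OF _ m0])
        have "\<gamma> * (t - p) \<le> \<gamma> * T" "\<beta> * (t - p) \<le> \<beta> * T"
          using True \<gamma>(1) \<beta> by (auto intro!: mult_left_mono)
        then have "\<gamma> * (t - p) \<le> \<gamma> * T + (\<beta> * T - \<beta> * (t - p))" by linarith
        then have "exp (\<gamma> * (t - p)) \<le> exp (\<gamma> * T) * exp (\<beta> * T - \<beta> * (t - p))"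
          unfolding exp_add[symmetric] by simp
        also have "\<dots> = 1 * (exp (\<gamma> * T) * exp (\<beta> * T)) * exp (- (\<beta> * (t - p)))"
          by (simp add: exp_diff exp_minus divide_inverse)
        also have "\<dots> \<le> L * exp (- (\<beta> * (t - p)))"
          unfolding L_def using \<rho> r by (intro mult_right_mono) auto
        finally show "exp (\<gamma> * (t - p)) \<le> L * exp (- (\<beta> * (t - p)))" .
      qed
      finally show ?thesis .
    next
      case False
      have pT: "0 \<le> p + T" using p T by simp
      have "r * ?m t \<le> ?V i t" by (rule Vm(2)) (use t in simp)
      also have "\<dots> \<le> exp (- (\<beta> * (t - (p + T)))) * ?V i (p + T)"
        by (rule decay) (use p T False mode in auto)
      also have "\<dots> \<le> exp (- (\<beta> * (t - (p + T)))) * (\<rho> * (exp (\<gamma> * (p + T - p)) * ?m p))"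
      proof (rule mult_left_mono)
        have "?V i (p + T) \<le> \<rho> * ?m (p + T)" by (rule Vm(1)[OF pT])
        also have "\<dots> \<le> \<rho> * (exp (\<gamma> * (p + T - p)) * ?m p)"
          using \<rho> p T False mode by (intro mult_left_mono growth) auto
        finally show "?V i (p + T) \<le> \<rho> * (exp (\<gamma> * (p + T - p)) * ?m p)" .
      qed simp
      finally have "?m t \<le> exp (- (\<beta> * (t - (p + T)))) * (\<rho> * (exp (\<gamma> * T) * ?m p)) / r"
        using r(1) by (simp add: field_simps)
      also have "exp (- (\<beta> * (t - (p + T)))) = exp (\<beta> * T) * exp (- (\<beta> * (t - p)))"
        unfolding exp_add[symmetric] by (simp add: algebra_simps)
      also have "exp (\<beta> * T) * exp (- (\<beta> * (t - p))) * (\<rho> * (exp (\<gamma> * T) * ?m p)) / r =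
        (\<rho> / r * (exp (\<gamma> * T) * exp (\<beta> * T))) * exp (- (\<beta> * (t - p))) * ?m p" by simp
      also have "\<dots> \<le> L * exp (- (\<beta> * (t - p))) * ?m p"
        unfolding L_def by (intro mult_right_mono m0) auto
      finally show ?thesis .
    qed
    have L0: "0 \<le> L" unfolding L_def using \<rho> r by simp
    have "?m t \<le> L * exp (- (\<beta> * (t - p))) * (C1 * exp (- (\<beta> * p)))"
      by (rule order_trans[OF step mult_left_mono[OF mp]]) (use L0 in simp)
    also have "\<dots> = (L * C1) * (exp (- (\<beta> * (t - p))) * exp (- (\<beta> * p)))" by simp
    also have "\<dots> = (L * C1) * exp (- (\<beta> * t))" unfolding exp_add[symmetric] by (simp add: algebra_simps)
    finally show ?thesis .
  qed
  then show ?thesis by (rule that[OF \<beta>])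
qed

end

theorem corollary10:
  fixes M :: "'w measure" and F :: "real \<Rightarrow> 'w measure" and W :: "real \<Rightarrow> 'w \<Rightarrow> real"
    and G H :: "'k::finite \<Rightarrow> real^'n^'n"
    and R R' :: "'k \<Rightarrow> real \<Rightarrow> real^'n^'n"
    and T \<epsilon> :: real
  assumes W: "wiener_process M F W"
    and T_pos: "0 < T" and eps_pos: "0 < \<epsilon>"
    and R_sym: "\<And>i \<tau>. \<tau> \<in> {0..T} \<Longrightarrow> symmetric_matrix (R i \<tau>)"
    and R_deriv: "\<And>i \<tau>. \<tau> \<in> {0..T} \<Longrightarrow>
      (R i has_vector_derivative R' i \<tau>) (at \<tau> within {0..T})"
    and R_pos: "0 \<prec> block_diag (\<lambda>i. R i T)"
    and LMI_end: "\<And>i. transpose (G i) ** R i T + R i T ** G i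
      + transpose (H i) ** R i T ** H i \<prec> 0"
    and LMI_flow: "\<And>i \<tau>. \<tau> \<in> {0..T} \<Longrightarrow>
      R' i \<tau> + transpose (G i) ** R i \<tau> + R i \<tau> ** G i
      + transpose (H i) ** R i \<tau> ** H i \<preceq> 0"
    and LMI_jump: "\<And>i j. i \<noteq> j \<Longrightarrow> R i 0 - R j T + \<epsilon> *\<^sub>R mat 1 \<preceq> 0"
  shows "mean_square_stable_min_dwell M F W G H T"
proof -
  have pos: "0 < x \<bullet> (R i T *v x)" if "x \<noteq> 0" for i x
    using block_diag_positive[OF R_pos that] .
  show ?thesis
    unfolding mean_square_stable_min_dwell_def
  proof (intro allI impI)
    fix \<sigma> y0 y
    assume pc: "piecewise_constant \<sigma>" and dwell: "min_dwell_time T \<sigma>" and sol: "switched_solution M F W G H \<sigma> y0 y"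
    interpret wiener_process M F W by (rule W)
    interpret switched_sde M F W G H \<sigma> y0 y by unfold_locales (fact pc sol)+
    have flow: "R' i \<tau> + generator i (R i \<tau>) \<preceq> 0" if "\<tau> \<in> {0..T}" for i \<tau>
      using LMI_flow[OF that, of i] by (simp add: generator_def add.assoc)
    \<comment> \<open>The relation \<open>\<preceq>\<close> includes symmetry of the difference, and
      \<open>generator\<close> preserves symmetry, so symmetry of \<open>R' i \<tau>\<close> follows
      from the flow inequality.\<close>
    have sym': "symmetric_matrix (R' i \<tau>)" if \<tau>: "\<tau> \<in> {0..T}" for i \<tau>
    proof -
      have "symmetric_matrix (0 - (R' i \<tau> + generator i (R i \<tau>)))" using flow[OF \<tau>] by (simp add: loewner_le_def)
      from symmetric_matrix_diff[OF symmetric_matrix_diff[OF _ this] generator_symmetric[OF R_sym[OF \<tau>]], of 0 i i]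
      show ?thesis by (simp add: symmetric_matrix_def transpose_def vec_eq_iff)
    qed
    have neg: "0 < x \<bullet> ((- generator i (R i T)) *v x)" if "x \<noteq> 0" for i x
      using LMI_end[of i] that by (simp add: loewner_less_def generator_def)
    have flow': "x \<bullet> ((R' i \<tau> + generator i (R i \<tau>)) *v x) \<le> 0" if "\<tau> \<in> {0..T}" for i \<tau> x
    proof -
      have "0 \<le> x \<bullet> ((0 - (R' i \<tau> + generator i (R i \<tau>))) *v x)" using flow[OF that, of i] unfolding loewner_le_def by blast
      then show ?thesis unfolding matrix_vector_mult_diff_rdistrib inner_diff_right by simp
    qed
    have jump: "x \<bullet> ((R i 0 + \<epsilon> *\<^sub>R mat 1) *v x) \<le> x \<bullet> (R j T *v x)" if "i \<noteq> j" for i j x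
    proof -
      have "0 \<le> x \<bullet> ((0 - (R i 0 - R j T + \<epsilon> *\<^sub>R mat 1)) *v x)" using LMI_jump[OF that] unfolding loewner_le_def by blast
      then show ?thesis
        unfolding matrix_vector_mult_diff_rdistrib matrix_vector_mult_add_rdistrib inner_diff_right inner_add_right by simp
    qed
    obtain K \<beta> where \<beta>: "0 < \<beta>" and le: "\<And>t. 0 < t \<Longrightarrow> moment (mat 1) t \<le> K * exp (- (\<beta> * t))"
      by (rule exponential_stability[OF T_pos eps_pos dwell R_sym sym' R_deriv pos neg flow' jump]) blast+
    show "((\<lambda>t. \<integral>\<^sup>+\<omega>. ennreal ((norm (y t \<omega>))\<^sup>2) \<partial>M) \<longlongrightarrow> 0) at_top"
    proof (rule tendsto_sandwich[where f="\<lambda>_. 0" and h="\<lambda>t. ennreal (K * exp (- (\<beta> * t)))"])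
      have "filterlim (\<lambda>t. \<beta> * t) at_top at_top"
        by (rule filterlim_tendsto_pos_mult_at_top[OF tendsto_const \<beta> filterlim_ident])
      then have "filterlim (\<lambda>t. - (\<beta> * t)) at_bot at_top" by (simp add: filterlim_uminus_at_bot)
      then have "((\<lambda>t. K * exp (- (\<beta> * t))) \<longlongrightarrow> 0) at_top"
        by (intro tendsto_mult_right_zero filterlim_compose[OF exp_at_bot])
      from tendsto_ennrealI[OF this] show "((\<lambda>t. ennreal (K * exp (- (\<beta> * t)))) \<longlongrightarrow> 0) at_top" by simp
      show "\<forall>\<^sub>F t in at_top. (\<integral>\<^sup>+\<omega>. ennreal ((norm (y t \<omega>))\<^sup>2) \<partial>M) \<le> ennreal (K * exp (- (\<beta> * t)))"
        using eventually_gt_at_top[of 0]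
      proof eventually_elim
        case (elim t)
        \<comment> \<open>\<open>le\<close> bounds an \<open>expectation\<close>, which would be 0
          by default for a function that is not integrable; only square integrability identifies it
          with the nonnegative integral in the goal.\<close>
        then have "square_integrable M (y t)" by (intro y_square_integrable) simp
        then show ?case using le[OF elim] unfolding moment_identity
          by (simp add: nn_integral_square_integrable ennreal_leI)
      qed
    qed auto
  qed
qed

end
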